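(* Let $\mathcal H$ be a Hilbert space (finite- or infinite-dimensional), $\mathbb P:=B(\mathcal H)^{++}$, $n\ge2$, let $M:\mathbb P^n\to\mathbb P$ be a map satisfying (A) joint monotonicity, (B) homogeneity, (C) monotone continuity and (D) normalization, and let $\sigma_1,\dots,\sigma_n$ be operator means with $\sigma_j\ne\mathfrak l$ for all $j$. For every $A_1,\dots,A_n\in\mathbb P$ there exists a unique $X_0\in\mathbb P$ which satisfies $$X_0=M(X_0\sigma_1A_1,\dots,X_0\sigma_nA_n).$$ Furthermore: (1) If $Y\in\mathbb P$ and $Y\ge M(Y\sigma_1A_1,\dots,Y\sigma_nA_n)$, then $Y\ge X_0$. (2) If $Y'\in\mathbb P$ and $Y'\le M(Y'\sigma_1A_1,\dots,Y'\sigma_nA_n)$, then $Y'\le X_0$.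
   Context: $B(\mathcal H)^{++}=\mathbb P$ is the set of positive invertible bounded operators on $\mathcal H$. Properties of $M$: (A) if $A_j\le B_j$ in $\mathbb P$ for $1\le j\le n$, then $M(A_1,\dots,A_n)\le M(B_1,\dots,B_n)$; (B) $M(\alpha A_1,\dots,\alpha A_n)=\alpha M(A_1,\dots,A_n)$ for $A_j\in\mathbb P$, $\alpha>0$; (C) if $A_{j,k}\in\mathbb P$ ($k\in\mathbb N$) and $A_{j,k}\searrow A_j\in\mathbb P$ as $k\to\infty$ for $1\le j\le n$, then $M(A_{1,k},\dots,A_{n,k})\to M(A_1,\dots,A_n)$ in the strong operator topology, and the same holds if $A_{j,k}\nearrow A_j\in\mathbb P$ for $1\le j\le n$ (here $\searrow$, $\nearrow$ denote decreasing, increasing sequences converging in the strong operator topology); (D) $M(I,\dots,I)=I$. Operator means are in the sense of Kubo–Ando: each operator mean $\sigma$ is given by its representing function $f_\sigma$, a non-negative operator monotone function on $[0,\infty)$ with $f_\sigma(1)=1$, through $A\sigma B=A^{1/2}f_\sigma(A^{-1/2}BA^{-1/2})A^{1/2}$ for $A,B\in\mathbb P$. $\mathfrak l$ is the left trivial mean $A\mathfrak lB=A$ ($f_{\mathfrak l}\equiv1$). *)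

theory Defs
  imports "HOL-Analysis.Analysis" "HOL-Computational_Algebra.Polynomial"
begin

section \<open>Complex Hilbert spaces\<close>

text \<open>The inner product is linear in its first argument. The real part of it is the inner product
  of \<^class>\<open>real_inner\<close>, so the norm is the Hilbert space norm. No dimension is prescribed; the
  zero space is allowed.\<close>

class complex_inner = real_inner +
  fixes scaleC :: "complex \<Rightarrow> 'a \<Rightarrow> 'a"  (infixr \<open>*\<^sub>C\<close> 75)
    and cinner :: "'a \<Rightarrow> 'a \<Rightarrow> complex"
  assumes scaleC_add_right: "a *\<^sub>C (x + y) = a *\<^sub>C x + a *\<^sub>C y"
    and scaleC_add_left: "(a + b) *\<^sub>C x = a *\<^sub>C x + b *\<^sub>C x"
    and scaleC_scaleC: "a *\<^sub>C b *\<^sub>C x = (a * b) *\<^sub>C x"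
    and scaleC_of_real: "complex_of_real r *\<^sub>C x = r *\<^sub>R x"
    and cinner_commute: "cinner x y = cnj (cinner y x)"
    and cinner_add_left: "cinner (x + y) z = cinner x z + cinner y z"
    and cinner_scaleC_left: "cinner (a *\<^sub>C x) y = a * cinner x y"
    and inner_eq_Re_cinner: "inner x y = Re (cinner x y)"

class complex_hilbert = complex_inner + complete_space

section \<open>The Hilbert space of square-summable complex sequences\<close>

typedef ell2 = "{x :: nat \<Rightarrow> complex. summable (\<lambda>i. (cmod (x i))\<^sup>2)}"
  morphisms ell2_nth Abs_ell2
  by (rule exI[of _ "\<lambda>_. 0"]) simp

setup_lifting type_definition_ell2

lemma ell2_summable: "summable (\<lambda>i. (cmod (ell2_nth x i))\<^sup>2)"
  using ell2_nth[of x] by simp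

lemma square_summable_add:
  fixes x y :: "nat \<Rightarrow> complex"
  assumes "summable (\<lambda>i. (cmod (x i))\<^sup>2)" "summable (\<lambda>i. (cmod (y i))\<^sup>2)"
  shows "summable (\<lambda>i. (cmod (x i + y i))\<^sup>2)"
proof (rule summable_comparison_test')
  show "summable (\<lambda>i. 2 * (cmod (x i))\<^sup>2 + 2 * (cmod (y i))\<^sup>2)"
    using assms by (intro summable_add summable_mult)
next
  fix i :: nat
  have "(cmod (x i + y i))\<^sup>2 \<le> (cmod (x i) + cmod (y i))\<^sup>2"
    by (simp add: norm_triangle_ineq power_mono)
  also have "\<dots> \<le> 2 * (cmod (x i))\<^sup>2 + 2 * (cmod (y i))\<^sup>2"
    using sum_squares_bound[of "cmod (x i)" "cmod (y i)"] by (simp add: power2_sum)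
  finally show "norm ((cmod (x i + y i))\<^sup>2) \<le> 2 * (cmod (x i))\<^sup>2 + 2 * (cmod (y i))\<^sup>2"
    by simp
qed

lemma square_summable_scale:
  fixes x :: "nat \<Rightarrow> complex"
  assumes "summable (\<lambda>i. (cmod (x i))\<^sup>2)"
  shows "summable (\<lambda>i. (cmod (c * x i))\<^sup>2)"
  using summable_mult[OF assms, of "(cmod c)\<^sup>2"] by (simp add: norm_mult power_mult_distrib)

lemma square_summable_diff:
  fixes x y :: "nat \<Rightarrow> complex"
  assumes "summable (\<lambda>i. (cmod (x i))\<^sup>2)" "summable (\<lambda>i. (cmod (y i))\<^sup>2)"
  shows "summable (\<lambda>i. (cmod (x i - y i))\<^sup>2)"
  using square_summable_add[OF assms(1) square_summable_scale[OF assms(2), of "-1"]] by simp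

lemma square_summable_mult:
  fixes x y :: "nat \<Rightarrow> complex"
  assumes "summable (\<lambda>i. (cmod (x i))\<^sup>2)" "summable (\<lambda>i. (cmod (y i))\<^sup>2)"
  shows "summable (\<lambda>i. x i * cnj (y i))"
proof (rule summable_comparison_test')
  show "summable (\<lambda>i. (cmod (x i))\<^sup>2 + (cmod (y i))\<^sup>2)"
    using assms by (intro summable_add)
next
  fix i :: nat
  show "norm (x i * cnj (y i)) \<le> (cmod (x i))\<^sup>2 + (cmod (y i))\<^sup>2"
  proof -
    have "2 * (cmod (x i) * cmod (y i)) \<le> (cmod (x i))\<^sup>2 + (cmod (y i))\<^sup>2"
      using sum_squares_bound[of "cmod (x i)" "cmod (y i)"] by (simp add: mult.assoc)
    moreover have "0 \<le> cmod (x i) * cmod (y i)" by simp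
    ultimately show ?thesis unfolding norm_mult complex_mod_cnj by linarith
  qed
qed

instantiation ell2 :: complex_inner
begin

lift_definition zero_ell2 :: ell2 is "\<lambda>_. 0" by simp
lift_definition plus_ell2 :: "ell2 \<Rightarrow> ell2 \<Rightarrow> ell2" is "\<lambda>x y i. x i + y i"
  by (simp add: square_summable_add)
lift_definition minus_ell2 :: "ell2 \<Rightarrow> ell2 \<Rightarrow> ell2" is "\<lambda>x y i. x i - y i"
  by (simp add: square_summable_diff)
lift_definition uminus_ell2 :: "ell2 \<Rightarrow> ell2" is "\<lambda>x i. - x i" by simp
lift_definition scaleC_ell2 :: "complex \<Rightarrow> ell2 \<Rightarrow> ell2" is "\<lambda>c x i. c * x i"
  by (simp add: square_summable_scale)
lift_definition scaleR_ell2 :: "real \<Rightarrow> ell2 \<Rightarrow> ell2" is "\<lambda>r x i. complex_of_real r * x i"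
  by (simp add: square_summable_scale)
lift_definition cinner_ell2 :: "ell2 \<Rightarrow> ell2 \<Rightarrow> complex" is "\<lambda>x y. \<Sum>i. x i * cnj (y i)" .

definition inner_ell2 :: "ell2 \<Rightarrow> ell2 \<Rightarrow> real" where "inner_ell2 x y = Re (cinner x y)"
definition norm_ell2 :: "ell2 \<Rightarrow> real" where "norm_ell2 x = sqrt (inner x x)"
definition dist_ell2 :: "ell2 \<Rightarrow> ell2 \<Rightarrow> real" where "dist_ell2 x y = norm (x - y)"
definition sgn_ell2 :: "ell2 \<Rightarrow> ell2" where "sgn_ell2 x = inverse (norm x) *\<^sub>R x"
definition uniformity_ell2 :: "(ell2 \<times> ell2) filter" where
  "uniformity_ell2 = (INF e\<in>{0<..}. principal {(x, y). dist x y < e})"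
definition open_ell2 :: "ell2 set \<Rightarrow> bool" where
  "open_ell2 U \<longleftrightarrow> (\<forall>x\<in>U. \<forall>\<^sub>F (x', y) in uniformity. x' = x \<longrightarrow> y \<in> U)"

lemma cinner_ell2_self:
  "cinner x x = complex_of_real (\<Sum>i. (cmod (ell2_nth x i))\<^sup>2)" for x :: ell2
proof -
  have "cinner x x = (\<Sum>i. complex_of_real ((cmod (ell2_nth x i))\<^sup>2))"
    by (simp only: cinner_ell2.rep_eq complex_norm_square)
  also have "\<dots> = complex_of_real (\<Sum>i. (cmod (ell2_nth x i))\<^sup>2)"
    by (rule suminf_of_real[symmetric]) (rule ell2_summable)
  finally show ?thesis .
qed

instance
proof
  fix x y z :: ell2 and a b :: complex and r s :: real
  show "x + y + z = x + (y + z)" "x + y = y + x" "0 + x = x" "- x + x = 0" "x - y = x + - y"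
    by (transfer; simp add: fun_eq_iff)+
  show "r *\<^sub>R (x + y) = r *\<^sub>R x + r *\<^sub>R y" "(r + s) *\<^sub>R x = r *\<^sub>R x + s *\<^sub>R x"
    "r *\<^sub>R s *\<^sub>R x = (r * s) *\<^sub>R x" "1 *\<^sub>R x = x"
    by (transfer; simp add: fun_eq_iff algebra_simps)+
  show "a *\<^sub>C (x + y) = a *\<^sub>C x + a *\<^sub>C y" "(a + b) *\<^sub>C x = a *\<^sub>C x + b *\<^sub>C x"
    "a *\<^sub>C b *\<^sub>C x = (a * b) *\<^sub>C x" "complex_of_real r *\<^sub>C x = r *\<^sub>R x"
    by (transfer; simp add: fun_eq_iff algebra_simps)+
  show dist: "dist x y = norm (x - y)" and "sgn x = inverse (norm x) *\<^sub>R x"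
    "norm x = sqrt (inner x x)" "inner x y = Re (cinner x y)"
    by (simp_all add: dist_ell2_def sgn_ell2_def norm_ell2_def inner_ell2_def)
  show "uniformity = (INF e\<in>{0<..}. principal {(x :: ell2, y). dist x y < e})"
    by (rule uniformity_ell2_def)
  show "open U \<longleftrightarrow> (\<forall>x\<in>U. \<forall>\<^sub>F (x', y) in uniformity. x' = x \<longrightarrow> y \<in> U)" for U :: "ell2 set"
    by (rule open_ell2_def)
  have commute: "cinner x y = cnj (cinner y x)" for x y :: ell2
  proof -
    have s: "summable (\<lambda>i. ell2_nth y i * cnj (ell2_nth x i))"
      by (intro square_summable_mult ell2_summable)
    have "(\<lambda>i. cnj (ell2_nth y i * cnj (ell2_nth x i))) sums
      cnj (\<Sum>i. ell2_nth y i * cnj (ell2_nth x i))"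
      using summable_sums[OF s] by (simp only: sums_cnj)
    then show ?thesis
      by (simp add: cinner_ell2.rep_eq sums_iff mult.commute)
  qed
  have add: "cinner (x + y) z = cinner x z + cinner y z" for x y z :: ell2
    using suminf_add[OF square_summable_mult[OF ell2_summable[of x] ell2_summable[of z]]
        square_summable_mult[OF ell2_summable[of y] ell2_summable[of z]]]
    by (simp add: cinner_ell2.rep_eq plus_ell2.rep_eq distrib_right)
  have scale: "cinner (a *\<^sub>C x) y = a * cinner x y" for a and x y :: ell2
    using suminf_mult[OF square_summable_mult[OF ell2_summable[of x] ell2_summable[of y]], of a]
    by (simp add: cinner_ell2.rep_eq scaleC_ell2.rep_eq mult.assoc)
  show "cinner x y = cnj (cinner y x)" "cinner (x + y) z = cinner x z + cinner y z"
    "cinner (a *\<^sub>C x) y = a * cinner x y"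
    by (rule commute add scale)+
  show "inner x y = inner y x"
    unfolding inner_ell2_def by (subst commute) simp
  show "inner (x + y) z = inner x z + inner y z"
    by (simp add: inner_ell2_def add)
  have "r *\<^sub>R x = complex_of_real r *\<^sub>C x"
    by (transfer; simp)
  then show "inner (r *\<^sub>R x) y = r * inner x y"
    by (simp add: inner_ell2_def scale)
  show "0 \<le> inner x x"
    by (simp add: inner_ell2_def cinner_ell2_self suminf_nonneg ell2_summable)
  show "inner x x = 0 \<longleftrightarrow> x = 0"
  proof -
    have "inner x x = 0 \<longleftrightarrow> (\<forall>i. (cmod (ell2_nth x i))\<^sup>2 = 0)"
      by (simp add: inner_ell2_def cinner_ell2_self suminf_eq_zero_iff ell2_summable)
    also have "\<dots> \<longleftrightarrow> x = 0"
      by (auto simp: ell2_nth_inject[symmetric] zero_ell2.rep_eq fun_eq_iff)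
    finally show ?thesis .
  qed
qed

end

lemma ell2_norm_power2: "(norm x)\<^sup>2 = (\<Sum>i. (cmod (ell2_nth x i))\<^sup>2)" for x :: ell2
proof -
  have "(norm x)\<^sup>2 = inner x x" by (rule power2_norm_eq_inner)
  then show ?thesis by (simp add: inner_ell2_def cinner_ell2_self)
qed

lemma ell2_partial_sum_le: "(\<Sum>i<K. (cmod (ell2_nth x i))\<^sup>2) \<le> (norm x)\<^sup>2" for x :: ell2
  unfolding ell2_norm_power2 by (rule sum_le_suminf) (auto intro: ell2_summable)

lemma ell2_nth_le_norm: "cmod (ell2_nth x i) \<le> norm x" for x :: ell2
proof -
  have "(cmod (ell2_nth x i))\<^sup>2 \<le> (\<Sum>j<Suc i. (cmod (ell2_nth x j))\<^sup>2)"
    by (rule member_le_sum) auto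
  also have "\<dots> \<le> (norm x)\<^sup>2" by (rule ell2_partial_sum_le)
  finally show ?thesis by (rule power2_le_imp_le) simp
qed

instance ell2 :: complex_hilbert
proof
  fix X :: "nat \<Rightarrow> ell2"
  assume X: "Cauchy X"
  have "Cauchy (\<lambda>n. ell2_nth (X n) i)" for i
  proof (rule CauchyI)
    fix e :: real assume "e > 0"
    then obtain N where N: "\<And>m n. m \<ge> N \<Longrightarrow> n \<ge> N \<Longrightarrow> norm (X m - X n) < e"
      using CauchyD[OF X] by blast
    have "norm (ell2_nth (X m) i - ell2_nth (X n) i) < e" if "m \<ge> N" "n \<ge> N" for m n
      using ell2_nth_le_norm[of "X m - X n" i] N[OF that] by (simp add: minus_ell2.rep_eq)
    then show "\<exists>M. \<forall>m\<ge>M. \<forall>n\<ge>M. norm (ell2_nth (X m) i - ell2_nth (X n) i) < e" by blast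
  qed
  then have "\<forall>i. \<exists>l. (\<lambda>n. ell2_nth (X n) i) \<longlonglongrightarrow> l"
    by (simp add: Cauchy_convergent_iff convergent_def)
  then obtain l where l: "\<And>i. (\<lambda>n. ell2_nth (X n) i) \<longlonglongrightarrow> l i" by metis
  have partial: "(\<Sum>i<K. (cmod (ell2_nth (X m) i - l i))\<^sup>2) \<le> e\<^sup>2"
    if N: "\<And>m n. m \<ge> N \<Longrightarrow> n \<ge> N \<Longrightarrow> norm (X m - X n) < e" and "m \<ge> N" for N m K e
  proof (rule LIMSEQ_le_const2)
    show "(\<lambda>n. \<Sum>i<K. (cmod (ell2_nth (X m) i - ell2_nth (X n) i))\<^sup>2)
      \<longlonglongrightarrow> (\<Sum>i<K. (cmod (ell2_nth (X m) i - l i))\<^sup>2)"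
      by (intro tendsto_intros l)
    have "(\<Sum>i<K. (cmod (ell2_nth (X m) i - ell2_nth (X n) i))\<^sup>2) \<le> e\<^sup>2" if "n \<ge> N" for n
    proof -
      have "(\<Sum>i<K. (cmod (ell2_nth (X m) i - ell2_nth (X n) i))\<^sup>2) \<le> (norm (X m - X n))\<^sup>2"
        using ell2_partial_sum_le[where x = "X m - X n" and K = K] by (simp add: minus_ell2.rep_eq)
      also have "\<dots> \<le> e\<^sup>2"
        using N[OF \<open>m \<ge> N\<close> that] by (intro power_mono) auto
      finally show ?thesis .
    qed
    then show "\<exists>N. \<forall>n\<ge>N. (\<Sum>i<K. (cmod (ell2_nth (X m) i - ell2_nth (X n) i))\<^sup>2) \<le> e\<^sup>2"
      by blast
  qed
  have diff: "summable (\<lambda>i. (cmod (ell2_nth (X m) i - l i))\<^sup>2)"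
    "(\<Sum>i. (cmod (ell2_nth (X m) i - l i))\<^sup>2) \<le> e\<^sup>2"
    if N: "\<And>m n. m \<ge> N \<Longrightarrow> n \<ge> N \<Longrightarrow> norm (X m - X n) < e" and "m \<ge> N" for N m e
  proof -
    have le: "(\<Sum>i<K. (cmod (ell2_nth (X m) i - l i))\<^sup>2) \<le> e\<^sup>2" for K
      by (rule partial[of N e m K, OF N \<open>m \<ge> N\<close>])
    show s: "summable (\<lambda>i. (cmod (ell2_nth (X m) i - l i))\<^sup>2)"
      by (rule summableI_nonneg_bounded[where x = "e\<^sup>2", OF zero_le_power2 le])
    show "(\<Sum>i. (cmod (ell2_nth (X m) i - l i))\<^sup>2) \<le> e\<^sup>2"
      by (rule suminf_le_const[OF s le])
  qed
  obtain N1 where N1: "\<And>m n. m \<ge> N1 \<Longrightarrow> n \<ge> N1 \<Longrightarrow> norm (X m - X n) < 1"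
    using CauchyD[OF X, of 1] by auto
  have "summable (\<lambda>i. (cmod (l i))\<^sup>2)"
    using square_summable_diff[OF ell2_summable[of "X N1"] diff(1)[of N1 1 N1, OF N1 order_refl]] by simp
  then have L: "ell2_nth (Abs_ell2 l) = l"
    by (simp add: Abs_ell2_inverse)
  define L where "L = Abs_ell2 l"
  have "X \<longlonglongrightarrow> L"
  proof (rule LIMSEQ_I)
    fix r :: real assume "r > 0"
    then have "r / 2 > 0" by simp
    then obtain N where N: "\<And>m n. m \<ge> N \<Longrightarrow> n \<ge> N \<Longrightarrow> norm (X m - X n) < r / 2"
      using CauchyD[OF X] by blast
    have "norm (X n - L) < r" if "n \<ge> N" for n
    proof -
      have "(norm (X n - L))\<^sup>2 \<le> (r / 2)\<^sup>2"
        unfolding ell2_norm_power2 minus_ell2.rep_eq L_def L by (rule diff(2)[of N "r / 2" n, OF N that])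
      then have "norm (X n - L) \<le> r / 2"
        by (rule power2_le_imp_le) (use \<open>r > 0\<close> in simp)
      then show ?thesis using \<open>r > 0\<close> by simp
    qed
    then show "\<exists>no. \<forall>n\<ge>no. norm (X n - L) < r" by blast
  qed
  then show "convergent X" by (auto simp: convergent_def)
qed

section \<open>Positive operators\<close>

text \<open>The bounded operators on a complex Hilbert space are those elements of the library type
  of bounded \<^emph>\<open>real\<close>-linear maps that are complex-linear; both have the same operator norm.\<close>

definition B_H :: "('h::complex_inner \<Rightarrow>\<^sub>L 'h) set" where
  "B_H = {A. \<forall>c x. blinfun_apply A (c *\<^sub>C x) = c *\<^sub>C blinfun_apply A x}"

definition positive_op :: "('h::complex_inner \<Rightarrow>\<^sub>L 'h) \<Rightarrow> bool" where
  "positive_op A \<longleftrightarrow> A \<in> B_H \<and> (\<forall>x. cinner (blinfun_apply A x) x \<in> nonneg_Reals)"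

definition loewner_le :: "('h::complex_inner \<Rightarrow>\<^sub>L 'h) \<Rightarrow> ('h \<Rightarrow>\<^sub>L 'h) \<Rightarrow> bool"
    (infix \<open>\<sqsubseteq>\<close> 50) where
  "A \<sqsubseteq> B \<longleftrightarrow> positive_op (B - A)"

definition is_inverse_op :: "('h::complex_inner \<Rightarrow>\<^sub>L 'h) \<Rightarrow> ('h \<Rightarrow>\<^sub>L 'h) \<Rightarrow> bool" where
  "is_inverse_op A B \<longleftrightarrow> B \<in> B_H \<and> A o\<^sub>L B = id_blinfun \<and> B o\<^sub>L A = id_blinfun"

definition inverse_op :: "('h::complex_inner \<Rightarrow>\<^sub>L 'h) \<Rightarrow> ('h \<Rightarrow>\<^sub>L 'h)" where
  "inverse_op A = (THE B. is_inverse_op A B)"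

definition PP :: "('h::complex_inner \<Rightarrow>\<^sub>L 'h) set" where
  "PP = {A. positive_op A \<and> (\<exists>B. is_inverse_op A B)}"

definition sot_tendsto :: "(nat \<Rightarrow> 'h::complex_inner \<Rightarrow>\<^sub>L 'h) \<Rightarrow> ('h \<Rightarrow>\<^sub>L 'h) \<Rightarrow> bool" where
  "sot_tendsto T S \<longleftrightarrow> (\<forall>x. (\<lambda>k. blinfun_apply (T k) x) \<longlonglongrightarrow> blinfun_apply S x)"

definition decreases_to :: "(nat \<Rightarrow> 'h::complex_inner \<Rightarrow>\<^sub>L 'h) \<Rightarrow> ('h \<Rightarrow>\<^sub>L 'h) \<Rightarrow> bool" where
  "decreases_to T S \<longleftrightarrow> (\<forall>k. T (Suc k) \<sqsubseteq> T k) \<and> sot_tendsto T S"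

definition increases_to :: "(nat \<Rightarrow> 'h::complex_inner \<Rightarrow>\<^sub>L 'h) \<Rightarrow> ('h \<Rightarrow>\<^sub>L 'h) \<Rightarrow> bool" where
  "increases_to T S \<longleftrightarrow> (\<forall>k. T k \<sqsubseteq> T (Suc k)) \<and> sot_tendsto T S"

section \<open>Continuous functional calculus\<close>

definition poly_op :: "real poly \<Rightarrow> ('h::complex_inner \<Rightarrow>\<^sub>L 'h) \<Rightarrow> ('h \<Rightarrow>\<^sub>L 'h)" where
  "poly_op p A = (\<Sum>i\<le>degree p. coeff p i *\<^sub>R (((o\<^sub>L) A ^^ i) id_blinfun))"

text \<open>For a positive operator \<open>A\<close>, whose spectrum lies in \<open>[0, \<parallel>A\<parallel>]\<close>, and \<open>f\<close> continuous on
  \<open>[0, \<infinity>)\<close>, \<open>f(A)\<close> is the norm limit of \<open>p\<^sub>k(A)\<close> for any polynomials \<open>p\<^sub>k\<close> converging to \<open>f\<close>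
  uniformly on \<open>[0, \<parallel>A\<parallel>]\<close>. The description is meaningful for such \<open>f\<close> and \<open>A\<close> only.\<close>

definition fun_op :: "(real \<Rightarrow> real) \<Rightarrow> ('h::complex_inner \<Rightarrow>\<^sub>L 'h) \<Rightarrow> ('h \<Rightarrow>\<^sub>L 'h)" where
  "fun_op f A = (THE T. \<forall>p :: nat \<Rightarrow> real poly.
     uniform_limit {0..norm A} (\<lambda>k t. poly (p k) t) f sequentially \<longrightarrow>
     (\<lambda>k. poly_op (p k) A) \<longlonglongrightarrow> T)"

abbreviation sqrt_op :: "('h::complex_inner \<Rightarrow>\<^sub>L 'h) \<Rightarrow> ('h \<Rightarrow>\<^sub>L 'h)" where
  "sqrt_op \<equiv> fun_op sqrt"

section \<open>Operator means\<close>

text \<open>Operator monotonicity refers to an infinite-dimensional Hilbert space; \<open>\<ell>\<^sup>2\<close> is taken for it,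
  which makes the notion independent of the space on which a mean is considered. Monotonicity on a
  given space of finite dimension would be a strictly weaker condition. Operator monotone functions
  on \<open>[0, \<infinity>)\<close> are continuous by convention (on \<open>(0, \<infinity>)\<close> this is automatic).\<close>

definition operator_monotone :: "(real \<Rightarrow> real) \<Rightarrow> bool" where
  "operator_monotone f \<longleftrightarrow> continuous_on {0..} f \<and>
     (\<forall>A B :: ell2 \<Rightarrow>\<^sub>L ell2. positive_op A \<and> positive_op B \<and> A \<sqsubseteq> B \<longrightarrow> fun_op f A \<sqsubseteq> fun_op f B)"

text \<open>An operator mean is given by its representing function; the values of that function on the
  negative reals play no role. The left trivial mean has the representing function \<open>1\<close>.\<close>

definition representing_function :: "(real \<Rightarrow> real) \<Rightarrow> bool" where
  "representing_function f \<longleftrightarrow> operator_monotone f \<and> (\<forall>t\<ge>0. f t \<ge> 0) \<and> f 1 = 1"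

definition op_mean :: "(real \<Rightarrow> real) \<Rightarrow> ('h::complex_inner \<Rightarrow>\<^sub>L 'h) \<Rightarrow> ('h \<Rightarrow>\<^sub>L 'h) \<Rightarrow> ('h \<Rightarrow>\<^sub>L 'h)" where
  "op_mean f A B = sqrt_op A o\<^sub>L
     fun_op f (inverse_op (sqrt_op A) o\<^sub>L B o\<^sub>L inverse_op (sqrt_op A)) o\<^sub>L sqrt_op A"

definition is_left_trivial :: "(real \<Rightarrow> real) \<Rightarrow> bool" where
  "is_left_trivial f \<longleftrightarrow> (\<forall>t\<ge>0. f t = 1)"

section \<open>Properties of maps on tuples of positive invertible operators\<close>

text \<open>An \<open>n\<close>-tuple is a function on a finite type \<open>'n\<close> with \<open>n\<close> elements. Only tuples with all
  entries in \<^const>\<open>PP\<close> are considered.\<close>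

definition maps_PP :: "(('n::finite \<Rightarrow> 'h::complex_inner \<Rightarrow>\<^sub>L 'h) \<Rightarrow> 'h \<Rightarrow>\<^sub>L 'h) \<Rightarrow> bool" where
  "maps_PP M \<longleftrightarrow> (\<forall>A. (\<forall>j. A j \<in> PP) \<longrightarrow> M A \<in> PP)"

definition jointly_monotone ::
    "(('n::finite \<Rightarrow> 'h::complex_inner \<Rightarrow>\<^sub>L 'h) \<Rightarrow> 'h \<Rightarrow>\<^sub>L 'h) \<Rightarrow> bool" where
  "jointly_monotone M \<longleftrightarrow>
     (\<forall>A B. (\<forall>j. A j \<in> PP \<and> B j \<in> PP \<and> A j \<sqsubseteq> B j) \<longrightarrow> M A \<sqsubseteq> M B)"

definition homogeneous ::
    "(('n::finite \<Rightarrow> 'h::complex_inner \<Rightarrow>\<^sub>L 'h) \<Rightarrow> 'h \<Rightarrow>\<^sub>L 'h) \<Rightarrow> bool" where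
  "homogeneous M \<longleftrightarrow>
     (\<forall>A (\<alpha>::real). (\<forall>j. A j \<in> PP) \<and> \<alpha> > 0 \<longrightarrow> M (\<lambda>j. \<alpha> *\<^sub>R A j) = \<alpha> *\<^sub>R M A)"

definition monotone_continuous ::
    "(('n::finite \<Rightarrow> 'h::complex_inner \<Rightarrow>\<^sub>L 'h) \<Rightarrow> 'h \<Rightarrow>\<^sub>L 'h) \<Rightarrow> bool" where
  "monotone_continuous M \<longleftrightarrow>
     (\<forall>A T. (\<forall>j k. T j k \<in> PP) \<and> (\<forall>j. A j \<in> PP) \<and>
        ((\<forall>j. decreases_to (T j) (A j)) \<or> (\<forall>j. increases_to (T j) (A j))) \<longrightarrow>
        sot_tendsto (\<lambda>k. M (\<lambda>j. T j k)) (M A))"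

definition normalized ::
    "(('n::finite \<Rightarrow> 'h::complex_inner \<Rightarrow>\<^sub>L 'h) \<Rightarrow> 'h \<Rightarrow>\<^sub>L 'h) \<Rightarrow> bool" where
  "normalized M \<longleftrightarrow> M (\<lambda>_. id_blinfun) = id_blinfun"

end

theory Submission
  imports Defs "HOL-Computational_Algebra.Fundamental_Theorem_Algebra"
begin

text \<open>Put \<open>G(X) = M(X \<sigma>\<^sub>1 A\<^sub>1, \<dots>, X \<sigma>\<^sub>n A\<^sub>n)\<close>. Existence: \<open>G\<close> is monotone, and \<open>G(\<beta>I) \<le> \<beta>I\<close>,
  \<open>G(\<gamma>I) \<ge> \<gamma>I\<close> for large \<open>\<beta>\<close> and small \<open>\<gamma>\<close>, so the iterates of \<open>\<beta>I\<close> decrease to a fixed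
  point. Uniqueness and comparison: since no \<open>\<sigma>\<^sub>j\<close> is the left trivial mean, the representing
  functions are strictly increasing, whence \<open>G(\<alpha>X) \<le> \<alpha>r G(X)\<close> with some \<open>r < 1\<close> for each
  \<open>\<alpha> > 1\<close>; thus the least \<open>\<alpha> \<ge> 1\<close> with \<open>X \<le> \<alpha>Y\<close> is 1 whenever \<open>X \<le> G(X)\<close> and \<open>G(Y) \<le> Y\<close>.

  No integral representation of operator monotone functions is needed. Monotonicity of \<open>X \<sigma> A\<close>
  in \<open>X\<close> comes from Hansen's inequality, which applies operator monotonicity on \<open>H \<times> H\<close>. The latter
  is inherited from \<open>\<ell>\<^sup>2\<close>, because a polynomial in \<open>A\<close>, evaluated at one vector, only sees a
  finite-dimensional subspace. An operator monotone function with \<open>f(a) = f(b)\<close> for some \<open>a < b\<close>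
  is constant, as is seen from pairs \<open>A \<le> B\<close> of rank two with slightly rotated eigenvectors.\<close>

section \<open>Complex inner product spaces\<close>

text \<open>\<open>fun_op\<close> is a definite description, so nothing about f(A) is available
  until the limit is shown to exist and to be independent of the approximating polynomials. This
  reduces to one fact: a polynomial that is nonnegative on an interval containing the numerical
  range of a self-adjoint operator yields a positive operator. It comes from the factorization of
  real polynomials, so no spectrum is ever defined; bounds
  \<open>m * (norm x)\<^sup>2 \<le> inner (A x) x\<close> take its place, and membership in
  \<open>PP\<close> becomes such a bound with m > 0. Strong limits of products and inverses are
  taken under norm bounds, which is why the iteration is kept between \<gamma>I and \<beta>I: this
  bounds the iterates and their inverses. The factor r comes from compactness of
  [d, \<open>norm D\<close>], where D = X^(-1/2) A X^(-1/2) and d > 0 is a lower bound of its form.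
  It may depend on X and \<alpha>, which suffices, since the comparison uses it only at Y and the
  least \<alpha>.\<close>

instance complex_hilbert \<subseteq> banach ..

text \<open>Conjugate linearity in the second argument turns the imaginary part of <x, y> into the
  real part of <x, iy>. The proofs below can thus mostly stay with the real
  \<open>inner\<close>.\<close>

lemma cinner_eq: "cinner x y = Complex (inner x y) (inner x (\<i> *\<^sub>C y))"
  for x y :: "'a::complex_inner"
proof -
  have "cinner x (\<i> *\<^sub>C y) = cnj (\<i> * cinner y x)"
    by (subst cinner_commute) (simp add: cinner_scaleC_left)
  also have "\<dots> = - \<i> * cinner x y"
    by (subst (2) cinner_commute) simp
  finally show ?thesis by (simp add: inner_eq_Re_cinner complex_eq_iff)
qed

lemma scaleC_i_i: "\<i> *\<^sub>C \<i> *\<^sub>C x = - x" for x :: "'a::complex_inner"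
  using scaleC_of_real[of "-1" x] by (simp add: scaleC_scaleC)

lemma scaleC_one [simp]: "1 *\<^sub>C x = x" for x :: "'a::complex_inner"
  using scaleC_of_real[of 1 x] by simp

lemma scaleC_scaleR: "a *\<^sub>C r *\<^sub>R x = r *\<^sub>R a *\<^sub>C x" for x :: "'a::complex_inner"
  by (simp flip: scaleC_of_real add: scaleC_scaleC mult.commute)

lemma scaleC_zero_left [simp]: "0 *\<^sub>C x = 0" for x :: "'a::complex_inner"
  using scaleC_of_real[of 0 x] by simp

lemma scaleC_zero_right [simp]: "a *\<^sub>C (0 :: 'a::complex_inner) = 0"
  using scaleC_add_right[of a 0 "0::'a"] by simp

lemma scaleC_minus_right: "a *\<^sub>C (- x) = - (a *\<^sub>C x)" for x :: "'a::complex_inner"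
  using scaleC_add_right[of a x "-x"] by (simp add: eq_neg_iff_add_eq_0 add.commute)

lemma scaleC_diff_right: "a *\<^sub>C (x - y) = a *\<^sub>C x - a *\<^sub>C y" for x :: "'a::complex_inner"
  using scaleC_add_right[of a x "-y"] by (simp add: scaleC_minus_right)

lemma scaleC_eq: "a *\<^sub>C x = Re a *\<^sub>R x + Im a *\<^sub>R \<i> *\<^sub>C x" for x :: "'a::complex_inner"
proof -
  have "a *\<^sub>C x = (complex_of_real (Re a) + complex_of_real (Im a) * \<i>) *\<^sub>C x"
    by (metis complex_eq mult.commute)
  then show ?thesis
    by (simp only: scaleC_add_left scaleC_of_real flip: scaleC_scaleC)
qed

lemma inner_scaleC_i: "inner (\<i> *\<^sub>C x) y = - inner x (\<i> *\<^sub>C y)" for x y :: "'a::complex_inner"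
proof -
  have "inner (\<i> *\<^sub>C x) y = - Im (cinner x y)"
    by (simp add: inner_eq_Re_cinner cinner_scaleC_left)
  then show ?thesis by (simp add: cinner_eq)
qed

lemma inner_scaleC: "inner (a *\<^sub>C x) y = inner x (cnj a *\<^sub>C y)" for x y :: "'a::complex_inner"
  by (simp add: scaleC_eq[of a] scaleC_eq[of "cnj a"] inner_add_left inner_diff_right inner_scaleC_i)

lemma norm_scaleC: "norm (a *\<^sub>C x) = cmod a * norm x" for x :: "'a::complex_inner"
proof -
  have "cnj a * a = complex_of_real ((cmod a)\<^sup>2)"
    by (metis complex_norm_square mult.commute)
  then have "(norm (a *\<^sub>C x))\<^sup>2 = (cmod a * norm x)\<^sup>2"
    by (simp add: power2_norm_eq_inner inner_scaleC scaleC_scaleC scaleC_of_real power_mult_distrib)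
  then show ?thesis by (simp add: power2_eq_iff_nonneg)
qed

lemma bounded_linear_scaleC: "bounded_linear (\<lambda>x. a *\<^sub>C (x :: 'a::complex_inner))"
  by (rule bounded_linear_intro[where K = "cmod a"])
     (simp_all add: scaleC_add_right scaleC_scaleR norm_scaleC mult.commute)

section \<open>Self-adjoint operators\<close>

text \<open>Symmetry for the real inner product suffices: applied to x and iy, with complex
  linearity, it also gives equality of the imaginary parts.\<close>

definition selfadj :: "('h::complex_inner \<Rightarrow>\<^sub>L 'h) \<Rightarrow> bool" where
  "selfadj A \<longleftrightarrow> A \<in> B_H \<and> (\<forall>x y. inner (A x) y = inner x (A y))"

lemma selfadjD: "selfadj A \<Longrightarrow> inner (A x) y = inner x (A y)"
  by (simp add: selfadj_def)

lemma B_HD: "A \<in> B_H \<Longrightarrow> A (c *\<^sub>C x) = c *\<^sub>C A x"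
  by (simp add: B_H_def)

lemma selfadj_commute: "selfadj A \<Longrightarrow> inner (A x) y = inner (A y) x"
  by (metis selfadjD inner_commute)

text \<open>On a complex space a real quadratic form forces self-adjointness, so positivity can be
  checked with the real inner product alone.\<close>

lemma positive_op_iff: "positive_op A \<longleftrightarrow> selfadj A \<and> (\<forall>x. 0 \<le> inner (A x) x)"
proof
  assume pos: "positive_op A"
  then have BH: "A \<in> B_H" and nn: "\<And>x. cinner (A x) x \<in> nonneg_Reals"
    by (auto simp: positive_op_def)
  have i0: "inner (A x) (\<i> *\<^sub>C x) = 0" for x
    using nn[of x] by (simp add: complex_nonneg_Reals_iff cinner_eq)
  \<comment> \<open>Polarization of \<open>i0\<close>.\<close>
  have "inner (A x) (\<i> *\<^sub>C y) + inner (A y) (\<i> *\<^sub>C x) = 0" for x y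
    using i0[of "x + y"] i0[of x] i0[of y]
    by (simp add: blinfun.add_right scaleC_add_right inner_add_left inner_add_right)
  note polar = this
  have "inner (A x) y = inner x (A y)" for x y
  proof -
    \<comment> \<open>Replacing y by -(iy) turns the polarized identity into symmetry.\<close>
    have "inner (A x) y + inner (\<i> *\<^sub>C A y) (\<i> *\<^sub>C x) * (-1) = 0"
      using polar[of x "- (\<i> *\<^sub>C y)"] B_HD[OF BH, of \<i> y]
      by (simp add: blinfun.minus_right scaleC_minus_right scaleC_i_i)
    then show ?thesis by (simp add: inner_scaleC_i scaleC_i_i inner_commute)
  qed
  moreover have "0 \<le> inner (A x) x" for x
    using nn[of x] by (simp add: complex_nonneg_Reals_iff cinner_eq)
  ultimately show "selfadj A \<and> (\<forall>x. 0 \<le> inner (A x) x)"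
    using BH by (simp add: selfadj_def)
next
  assume R: "selfadj A \<and> (\<forall>x. 0 \<le> inner (A x) x)"
  then have BH: "A \<in> B_H" by (simp add: selfadj_def)
  have "inner (A x) (\<i> *\<^sub>C x) = 0" for x
  proof -
    have "inner (A x) (\<i> *\<^sub>C x) = inner x (\<i> *\<^sub>C A x)"
      using R by (simp add: selfadjD B_HD[OF BH])
    also have "\<dots> = - inner (A x) (\<i> *\<^sub>C x)"
      by (metis inner_commute inner_scaleC_i)
    finally show ?thesis by simp
  qed
  then show "positive_op A"
    using R BH by (simp add: positive_op_def complex_nonneg_Reals_iff cinner_eq)
qed

lemma positive_selfadj: "positive_op A \<Longrightarrow> selfadj A"
  by (simp add: positive_op_iff)

lemma B_H_add: "A \<in> B_H \<Longrightarrow> B \<in> B_H \<Longrightarrow> A + B \<in> B_H"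
  by (simp add: B_H_def blinfun.add_left scaleC_add_right)
lemma B_H_diff: "A \<in> B_H \<Longrightarrow> B \<in> B_H \<Longrightarrow> A - B \<in> B_H"
  by (simp add: B_H_def blinfun.diff_left scaleC_diff_right)
lemma B_H_scaleR: "A \<in> B_H \<Longrightarrow> c *\<^sub>R A \<in> B_H"
  by (simp add: B_H_def blinfun.scaleR_left scaleC_scaleR)
lemma B_H_id: "id_blinfun \<in> B_H"
  by (simp add: B_H_def)
lemma B_H_comp: "A \<in> B_H \<Longrightarrow> B \<in> B_H \<Longrightarrow> A o\<^sub>L B \<in> B_H"
  by (simp add: B_H_def)

lemma selfadj_add: "selfadj A \<Longrightarrow> selfadj B \<Longrightarrow> selfadj (A + B)"
  by (simp add: selfadj_def B_H_add blinfun.add_left inner_add_left inner_add_right)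
lemma selfadj_diff: "selfadj A \<Longrightarrow> selfadj B \<Longrightarrow> selfadj (A - B)"
  by (simp add: selfadj_def B_H_diff blinfun.diff_left inner_diff_left inner_diff_right)
lemma selfadj_scaleR: "selfadj A \<Longrightarrow> selfadj (c *\<^sub>R A)"
  by (simp add: selfadj_def B_H_scaleR blinfun.scaleR_left)
lemma selfadj_id: "selfadj id_blinfun"
  by (simp add: selfadj_def B_H_id)
lemma selfadj_zero: "selfadj 0"
  by (simp add: selfadj_def B_H_def)

lemma selfadj_conj: "selfadj S \<Longrightarrow> selfadj A \<Longrightarrow> selfadj (S o\<^sub>L A o\<^sub>L S)"
  by (simp add: selfadj_def B_H_comp)

lemma loewner_leD: "A \<sqsubseteq> B \<Longrightarrow> inner (A x) x \<le> inner (B x) x"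
  by (simp add: loewner_le_def positive_op_iff blinfun.diff_left inner_diff_left)

lemma loewner_le_iff:
  "selfadj A \<Longrightarrow> selfadj B \<Longrightarrow> A \<sqsubseteq> B \<longleftrightarrow> (\<forall>x. inner (A x) x \<le> inner (B x) x)"
  by (simp add: loewner_le_def positive_op_iff selfadj_diff blinfun.diff_left inner_diff_left)

lemma loewner_le_trans: "A \<sqsubseteq> B \<Longrightarrow> B \<sqsubseteq> C \<Longrightarrow> A \<sqsubseteq> C"
  using selfadj_add[of "C - B" "B - A"] loewner_leD[of A B] loewner_leD[of B C]
  by (fastforce simp: loewner_le_def positive_op_iff blinfun.diff_left inner_diff_left
      intro: order_trans)

section \<open>Norm estimates from the quadratic form\<close>

lemma abs_inner_blinfun_le: "\<bar>inner (A x) x\<bar> \<le> norm A * (norm x)\<^sup>2"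
  for A :: "'a::real_inner \<Rightarrow>\<^sub>L 'a"
proof -
  have "\<bar>inner (A x) x\<bar> \<le> norm (A x) * norm x"
    by (rule Cauchy_Schwarz_ineq2)
  also have "\<dots> \<le> norm A * norm x * norm x"
    by (intro mult_right_mono norm_blinfun) auto
  finally show ?thesis by (simp add: power2_eq_square mult.assoc)
qed

text \<open>The norm of a self-adjoint operator is its numerical radius: polarization expresses
  \<open>inner (A x) y\<close> through values of the quadratic form, and the parallelogram law
  evaluates the squares that result.\<close>

lemma norm_selfadj_le:
  assumes A: "selfadj A" and c: "0 \<le> c"
    and le: "\<And>x. \<bar>inner (A x) x\<bar> \<le> c * (norm x)\<^sup>2"
  shows "norm A \<le> c"
proof (rule norm_blinfun_bound[OF c])
  fix x
  have pol: "2 * inner (A x) y \<le> c * ((norm x)\<^sup>2 + (norm y)\<^sup>2)" for y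
  proof -
    have "4 * inner (A x) y = inner (A (x + y)) (x + y) - inner (A (x - y)) (x - y)"
      using selfadj_commute[OF A, of x y]
      by (simp add: blinfun.add_right blinfun.diff_right inner_add_left inner_add_right
          inner_diff_left inner_diff_right)
    also have "\<dots> \<le> c * (norm (x + y))\<^sup>2 + c * (norm (x - y))\<^sup>2"
      using le[of "x + y"] le[of "x - y"] by linarith
    also have "\<dots> = 2 * (c * ((norm x)\<^sup>2 + (norm y)\<^sup>2))"
      by (simp add: power2_norm_eq_inner inner_add_left inner_add_right inner_diff_left
          inner_diff_right inner_commute[of y x] algebra_simps)
    finally show ?thesis by simp
  qed
  show "norm (A x) \<le> c * norm x"
  proof (cases "A x = 0")
    case True then show ?thesis using c by simp
  next
    case False
    then have x: "norm x > 0" by auto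
    \<comment> \<open>\<open>A x\<close> rescaled to the length of x, so that both squares in
      \<open>pol\<close> agree.\<close>
    define y where "y = (norm x / norm (A x)) *\<^sub>R A x"
    have "inner (A x) y = norm x * norm (A x)"
      using False by (simp add: y_def dot_square_norm power2_eq_square)
    moreover have "norm y = norm x"
      using False by (simp add: y_def)
    ultimately have "norm x * norm (A x) \<le> norm x * (c * norm x)"
      using pol[of y] by (simp add: power2_eq_square mult_ac)
    then show ?thesis using x by simp
  qed
qed

text \<open>This is T^2 \<le> c T for 0 \<le> T \<le> c, without a square root: the form is
  nonnegative at x - t T x, and t = 1/c is optimal for the resulting quadratic in t. It turns bounds
  on forms into bounds on norms, for the positivity of polynomials as well as for monotone strong
  limits.\<close>

lemma positive_norm_power2_le:
  assumes T: "positive_op T" and le: "\<And>x. inner (T x) x \<le> c * (norm x)\<^sup>2"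
  shows "(norm (T x))\<^sup>2 \<le> c * inner (T x) x"
proof -
  have sT: "selfadj T" and nn: "\<And>x. 0 \<le> inner (T x) x"
    using T by (auto simp: positive_op_iff)
  define a b where "a = inner (T x) x" and "b = (norm (T x))\<^sup>2"
  have b: "b = inner (T x) (T x)" by (simp add: b_def power2_norm_eq_inner)
  have key: "0 \<le> a - 2 * t * b + t\<^sup>2 * (c * b)" for t
  proof -
    have "0 \<le> inner (T (x - t *\<^sub>R T x)) (x - t *\<^sub>R T x)" by (rule nn)
    also have "\<dots> = a - 2 * t * b + t\<^sup>2 * inner (T (T x)) (T x)"
      using selfadjD[OF sT, of "T x" x]
      by (simp add: a_def b blinfun.diff_right blinfun.scaleR_right inner_diff_left
          inner_diff_right power2_eq_square algebra_simps)
    also have "\<dots> \<le> a - 2 * t * b + t\<^sup>2 * (c * b)"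
      using le[of "T x"] by (intro add_left_mono mult_left_mono) (auto simp: b_def)
    finally show ?thesis .
  qed
  have "b \<le> c * a"
  proof (cases "b = 0")
    case True
    have "0 \<le> c * (norm x)\<^sup>2" using le[of x] nn[of x] by linarith
    then have "0 \<le> c \<or> x = 0" by (auto simp: zero_le_mult_iff)
    then show ?thesis using True nn[of x] by (auto simp: a_def)
  next
    case False
    then have b0: "b > 0" by (simp add: b_def)
    have "0 \<le> c * b"
      using le[of "T x"] nn[of "T x"] by (simp add: b_def)
    then have c0: "c \<ge> 0" using b0 by (simp add: zero_le_mult_iff)
    show ?thesis
    proof (cases "c = 0")
      case True
      \<comment> \<open>For c = 0 the bound in \<open>key\<close> is affine in t, and this t gives
        it the impossible value -1.\<close>
      have "0 \<le> a - 2 * ((a + 1) / (2 * b)) * b" using key[of "(a + 1) / (2 * b)"] True by simp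
      then show ?thesis using b0 by (simp add: field_simps)
    next
      case False
      have "0 \<le> a - 2 * (1 / c) * b + (1 / c)\<^sup>2 * (c * b)" by (rule key)
      then show ?thesis using False c0 by (simp add: field_simps power2_eq_square)
    qed
  qed
  then show ?thesis by (simp add: a_def b_def)
qed

section \<open>Polynomials of an operator\<close>

lemma poly_op_0 [simp]: "poly_op 0 A = 0"
  by (simp add: poly_op_def)

text \<open>Horner form of the definition, on which the inductions over polynomials rest.\<close>

lemma poly_op_pCons: "poly_op (pCons a p) A x = a *\<^sub>R x + A (poly_op p A x)"
proof (cases "p = 0")
  case True
  then show ?thesis by (simp add: poly_op_def blinfun.scaleR_left)
next
  case False
  then have "poly_op (pCons a p) A =
    a *\<^sub>R id_blinfun + (\<Sum>i\<le>degree p. coeff p i *\<^sub>R (A o\<^sub>L ((o\<^sub>L) A ^^ i) id_blinfun))"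
    unfolding poly_op_def by (simp add: sum.atMost_Suc_shift del: sum.atMost_Suc)
  then show ?thesis
    by (simp add: poly_op_def blinfun.add_left blinfun.scaleR_left blinfun.sum_left
        blinfun.sum_right blinfun.scaleR_right)
qed

lemma poly_op_const: "poly_op [:c:] A = c *\<^sub>R id_blinfun"
  by (rule blinfun_eqI) (simp add: poly_op_pCons blinfun.scaleR_left)

lemma poly_op_add: "poly_op (p + q) A = poly_op p A + poly_op q A"
proof (induction p q rule: poly_induct2)
  case 0
  then show ?case by simp
next
  case (pCons a p b q)
  then show ?case
    by (intro blinfun_eqI) (simp add: poly_op_pCons blinfun.add_left blinfun.add_right algebra_simps)
qed

lemma poly_op_smult: "poly_op (smult c p) A = c *\<^sub>R poly_op p A"
proof (induction p)
  case 0
  then show ?case by simp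
next
  case (pCons a p)
  then show ?case
    by (intro blinfun_eqI)
       (simp add: poly_op_pCons blinfun.scaleR_left blinfun.scaleR_right algebra_simps)
qed

lemma poly_op_diff: "poly_op (p - q) A = poly_op p A - poly_op q A"
  using poly_op_add[of p "- q" A] poly_op_smult[of "-1" q A] by simp

lemma poly_op_mult: "poly_op (p * q) A = poly_op p A o\<^sub>L poly_op q A"
proof (induction p)
  case 0
  then show ?case by (intro blinfun_eqI) simp
next
  case (pCons a p)
  then show ?case
    by (intro blinfun_eqI)
       (simp add: poly_op_pCons poly_op_add poly_op_smult blinfun.add_left blinfun.scaleR_left)
qed

lemma poly_op_pcompose: "poly_op (pcompose p q) A = poly_op p (poly_op q A)"
proof (induction p)
  case 0
  then show ?case by simp
next
  case (pCons a p)
  then show ?case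
    by (intro blinfun_eqI)
       (simp add: pcompose_pCons poly_op_add poly_op_mult poly_op_const blinfun.add_left
          blinfun.scaleR_left poly_op_pCons)
qed

lemma poly_op_X: "poly_op [:0, 1:] A = A"
  by (rule blinfun_eqI) (simp add: poly_op_pCons)

lemma poly_op_intertwine:
  fixes A :: "'a::complex_inner \<Rightarrow>\<^sub>L 'a" and B :: "'b::complex_inner \<Rightarrow>\<^sub>L 'b"
    and W :: "'b \<Rightarrow> 'a"
  assumes "\<And>x. A (W x) = W (B x)" and "bounded_linear W"
  shows "poly_op p A (W x) = W (poly_op p B x)"
proof (induction p)
  case 0
  then show ?case using assms(2) by (simp add: linear_simps)
next
  case (pCons a p)
  then show ?case
    using assms(2) by (simp add: poly_op_pCons assms(1) linear_simps)
qed

lemma poly_op_commute: "poly_op p A (poly_op q A x) = poly_op q A (poly_op p A x)"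
  by (metis blinfun_apply_blinfun_compose mult.commute poly_op_mult)

lemma selfadj_poly_op:
  assumes "selfadj A"
  shows "selfadj (poly_op p A)"
proof (induction p)
  case 0
  then show ?case by (simp add: selfadj_zero)
next
  case (pCons a p)
  have "A (poly_op p A x) = poly_op p A (A x)" for x
    using poly_op_commute[of "[:0,1:]" A p x] by (simp add: poly_op_X)
  then show ?case
    using pCons.IH assms
    by (simp add: selfadj_def B_H_def poly_op_pCons inner_add_left inner_add_right
        scaleC_add_right scaleC_scaleR)
qed

lemma poly_op_eigen:
  fixes A :: "'a::complex_inner \<Rightarrow>\<^sub>L 'a"
  assumes "A x = u *\<^sub>R x"
  shows "poly_op p A x = poly p u *\<^sub>R x"
  by (induction p) (simp_all add: poly_op_pCons blinfun.scaleR_right assms algebra_simps)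

section \<open>Positivity of polynomials of an operator, by real factorization\<close>

text \<open>Stands in for invertibility: it is immediate for each factor of a polynomial and stable
  under composition.\<close>

definition bounded_below :: "('h::real_normed_vector \<Rightarrow>\<^sub>L 'h) \<Rightarrow> bool" where
  "bounded_below T \<longleftrightarrow> (\<exists>c>0. \<forall>x. c * norm x \<le> norm (T x))"

lemma bounded_below_comp:
  assumes "bounded_below S" "bounded_below T"
  shows "bounded_below (S o\<^sub>L T)"
proof -
  obtain c d where "c > 0" "\<And>x. c * norm x \<le> norm (S x)" "d > 0" "\<And>x. d * norm x \<le> norm (T x)"
    using assms by (auto simp: bounded_below_def)
  then have "c * d > 0" "\<And>x. c * d * norm x \<le> norm (S (T x))"
    by (auto simp: mult.assoc intro: order_trans[OF mult_left_mono[OF _ less_imp_le]])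
  then show ?thesis unfolding bounded_below_def by (metis blinfun_apply_blinfun_compose)
qed

lemma bounded_below_inner:
  fixes T :: "'a::real_inner \<Rightarrow>\<^sub>L 'a"
  assumes "c > 0" and "\<And>x. c * (norm x)\<^sup>2 \<le> \<bar>inner (T x) x\<bar>"
  shows "bounded_below T"
proof -
  have "c * norm x \<le> norm (T x)" for x
  proof (cases "x = 0")
    case False
    have "c * norm x * norm x \<le> norm (T x) * norm x"
      using assms(2)[of x] Cauchy_Schwarz_ineq2[of "T x" x] by (simp add: power2_eq_square mult.assoc)
    then show ?thesis using False by simp
  qed simp
  then show ?thesis using assms(1) by (auto simp: bounded_below_def)
qed

lemma map_poly_complex_of_real_add:
  "map_poly complex_of_real (p + q) = map_poly complex_of_real p + map_poly complex_of_real q"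
  by (rule poly_eqI) (simp add: coeff_map_poly)

lemma map_poly_complex_of_real_mult:
  "map_poly complex_of_real (p * q) = map_poly complex_of_real p * map_poly complex_of_real q"
  by (induction p)
     (simp_all add: map_poly_complex_of_real_add map_poly_pCons map_poly_smult)

text \<open>The quadratic is the minimal polynomial of z over the reals: the remainder has degree at
  most 1, and such a real polynomial with a nonreal root vanishes.\<close>

lemma nonreal_root_factor:
  fixes p :: "real poly"
  assumes root: "poly (map_poly complex_of_real p) z = 0" and z: "Im z \<noteq> 0"
  shows "[:(Re z)\<^sup>2 + (Im z)\<^sup>2, - 2 * Re z, 1:] dvd p"
proof -
  define q where "q = [:(Re z)\<^sup>2 + (Im z)\<^sup>2, - 2 * Re z, 1:]"
  define r where "r = p mod q"
  have "degree r < 2"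
    using degree_mod_less'[of q p] by (cases "r = 0") (auto simp: r_def q_def)
  then obtain c d where r: "r = [:d, c:]"
    by (metis One_nat_def degree_eq_zeroE less_2_cases pCons_cases degree_pCons_eq_if
        nat.inject pCons_0_0 zero_neq_one)
  have qz: "poly (map_poly complex_of_real q) z = 0"
    by (simp add: q_def complex_eq_iff map_poly_pCons power2_eq_square algebra_simps)
  have "poly (map_poly complex_of_real p) z =
      poly (map_poly complex_of_real (p div q)) z * poly (map_poly complex_of_real q) z
      + poly (map_poly complex_of_real r) z"
    unfolding r_def
    by (metis div_mult_mod_eq map_poly_complex_of_real_add map_poly_complex_of_real_mult poly_add poly_mult)
  then have "of_real d + z * of_real c = 0"
    using root qz by (simp add: r map_poly_pCons)
  then have "c = 0 \<and> d = 0"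
    using z by (auto simp: complex_eq_iff)
  then have "p mod q = 0" using r by (simp add: r_def)
  then show ?thesis unfolding q_def[symmetric] by (simp add: mod_eq_0_iff_dvd)
qed

text \<open>Half of the spectral mapping theorem. Over the reals q splits into linear factors with
  roots outside [m, b] and quadratics without real roots, and each factor gives an operator that is
  bounded below. The condition \<open>q \<noteq> 0\<close> does not follow from the root condition
  when [m, b] is empty.\<close>

lemma bounded_below_poly_op:
  fixes A :: "'h::complex_inner \<Rightarrow>\<^sub>L 'h"
  assumes A: "selfadj A"
    and lb: "\<And>x. m * (norm x)\<^sup>2 \<le> inner (A x) x" and ub: "\<And>x. inner (A x) x \<le> b * (norm x)\<^sup>2"
    and q: "\<And>t. m \<le> t \<Longrightarrow> t \<le> b \<Longrightarrow> poly q t \<noteq> 0" and q0: "q \<noteq> 0"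
  shows "bounded_below (poly_op q A)"
  using q q0
proof (induction "degree q" arbitrary: q rule: less_induct)
  case less
  show ?case
  proof (cases "degree q = 0")
    case True
    then obtain c where c: "q = [:c:]" by (metis degree_eq_zeroE)
    with less.prems have "c \<noteq> 0" by auto
    then show ?thesis
      unfolding bounded_below_def c poly_op_const
      by (intro exI[of _ "\<bar>c\<bar>"]) (auto simp: blinfun.scaleR_left)
  next
    case False
    have "\<not> constant (poly (map_poly complex_of_real q))"
      using False by (simp add: constant_degree degree_map_poly)
    then obtain z where z: "poly (map_poly complex_of_real q) z = 0"
      using fundamental_theorem_of_algebra by blast
    obtain s where s: "s dvd q" "degree s > 0" "bounded_below (poly_op s A)"
    proof (cases "Im z = 0")
      case True
      then have zr: "z = of_real (Re z)" by (simp add: complex_eq_iff)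
      then have root: "poly q (Re z) = 0"
      proof -
        have "poly (map_poly complex_of_real q) (of_real t) = of_real (poly q t)" for t
          by (induction q) (simp_all add: map_poly_pCons)
        then show ?thesis using z zr by (metis of_real_eq_0_iff)
      qed
      then have "Re z < m \<or> Re z > b" using less.prems(1)[of "Re z"] by force
      have Ax: "inner (poly_op [:- Re z, 1:] A x) x = inner (A x) x - Re z * (norm x)\<^sup>2" for x
        by (simp add: poly_op_pCons inner_diff_left power2_norm_eq_inner)
      from \<open>Re z < m \<or> Re z > b\<close> have "bounded_below (poly_op [:- Re z, 1:] A)"
      proof
        assume "Re z < m"
        then show ?thesis
          by (intro bounded_below_inner[of "m - Re z"])
             (use lb Ax in \<open>auto simp: left_diff_distrib intro: order_trans[OF _ abs_ge_self]\<close>)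
      next
        assume "Re z > b"
        then show ?thesis
          by (intro bounded_below_inner[of "Re z - b"])
             (use ub Ax in \<open>auto simp: left_diff_distrib intro: order_trans[OF _ abs_ge_minus_self]\<close>)
      qed
      moreover have "[:- Re z, 1:] dvd q" using root by (simp add: poly_eq_0_iff_dvd)
      ultimately show ?thesis using that[of "[:- Re z, 1:]"] by simp
    next
      case False
      define s where "s = [:(Re z)\<^sup>2 + (Im z)\<^sup>2, - 2 * Re z, 1:]"
      \<comment> \<open>Completing the square: s is (t - Re z)^2 + (Im z)^2.\<close>
      have "inner (poly_op s A x) x = (norm (A x - Re z *\<^sub>R x))\<^sup>2 + (Im z)\<^sup>2 * (norm x)\<^sup>2" for x
        using selfadjD[OF A, of "A x" x] unfolding power2_norm_eq_inner
        by (simp add: s_def poly_op_pCons inner_add_left inner_diff_left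
            inner_diff_right inner_add_right blinfun.add_right blinfun.diff_right
            blinfun.scaleR_right inner_commute[of x "A x"] power2_eq_square algebra_simps)
      then have "bounded_below (poly_op s A)"
        using False by (intro bounded_below_inner[of "(Im z)\<^sup>2"]) auto
      moreover have "s dvd q" unfolding s_def by (rule nonreal_root_factor[OF z False])
      ultimately show ?thesis using that[of s] by (simp add: s_def)
    qed
    then obtain r where r: "q = s * r" by auto
    with less.prems have r0: "r \<noteq> 0" "s \<noteq> 0" by auto
    have "bounded_below (poly_op r A)"
    proof (rule less.hyps[OF _ _ r0(1)])
      show "degree r < degree q" using r r0 s(2) by (simp add: degree_mult_eq)
      show "poly r t \<noteq> 0" if "m \<le> t" "t \<le> b" for t
        using less.prems(1)[OF that] r by auto
    qed
    then show ?thesis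
      unfolding r poly_op_mult by (rule bounded_below_comp[OF s(3)])
  qed
qed

text \<open>If the infimum \<mu> of the form of p(A) over unit vectors were negative, p - \<mu>
  would have no zero on [m, b], so p(A) - \<mu> would be positive and bounded below. Then its form
  is bounded away from 0 on unit vectors, against the choice of \<mu>.\<close>

lemma poly_op_nonneg:
  fixes A :: "'h::complex_inner \<Rightarrow>\<^sub>L 'h"
  assumes A: "selfadj A"
    and lb: "\<And>x. m * (norm x)\<^sup>2 \<le> inner (A x) x" and ub: "\<And>x. inner (A x) x \<le> b * (norm x)\<^sup>2"
    and p: "\<And>t. m \<le> t \<Longrightarrow> t \<le> b \<Longrightarrow> 0 \<le> poly p t"
  shows "0 \<le> inner (poly_op p A x) x"
proof (rule ccontr)
  assume neg: "\<not> ?thesis"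
  define T where "T = poly_op p A"
  have T: "selfadj T" by (simp add: T_def selfadj_poly_op A)
  define S where "S = {inner (T y) y |y. norm y = 1}"
  have bdd: "bdd_below S"
  proof (rule bdd_belowI[of _ "- norm T"])
    fix s assume "s \<in> S"
    then obtain y where "s = inner (T y) y" "norm y = 1" by (auto simp: S_def)
    then show "- norm T \<le> s"
      using abs_inner_blinfun_le[of T y] by (simp add: abs_le_iff)
  qed
  have x0: "x \<noteq> 0" using neg by auto
  define x' where "x' = (1 / norm x) *\<^sub>R x"
  have x': "norm x' = 1" "inner (T x') x' < 0"
    using x0 neg by (auto simp: x'_def T_def blinfun.scaleR_right divide_less_0_iff mult_less_0_iff
      zero_less_mult_iff)
  define \<mu> where "\<mu> = Inf S"
  have "\<mu> \<le> inner (T x') x'"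
    unfolding \<mu>_def by (rule cInf_lower[OF _ bdd]) (use x' in \<open>auto simp: S_def\<close>)
  then have \<mu>: "\<mu> < 0" using x' by simp
  define q where "q = p - [:\<mu>:]"
  have "poly q t \<noteq> 0" if "m \<le> t" "t \<le> b" for t
    using p[OF that] \<mu> by (simp add: q_def)
  \<comment> \<open>For q = 0 the polynomial p would be the negative constant \<mu>, so [m, b] would
    be empty; the unit vector x' excludes this.\<close>
  moreover have "q \<noteq> 0"
  proof
    assume "q = 0"
    then have "p = [:\<mu>:]" by (simp add: q_def)
    have "b < m" using p[of m] \<mu> \<open>p = [:\<mu>:]\<close> by force
    moreover have "m \<le> b" using lb[of x'] ub[of x'] x' by simp
    ultimately show False by simp
  qed
  ultimately have "bounded_below (poly_op q A)"
    by (rule bounded_below_poly_op[OF A lb ub])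
  moreover have Q: "poly_op q A = T - \<mu> *\<^sub>R id_blinfun"
    by (simp add: q_def poly_op_diff poly_op_const T_def)
  ultimately obtain c where c: "c > 0" "\<And>y. c * norm y \<le> norm ((T - \<mu> *\<^sub>R id_blinfun) y)"
    by (auto simp: bounded_below_def)
  have low: "\<mu> * (norm y)\<^sup>2 \<le> inner (T y) y" for y
  proof (cases "y = 0")
    case False
    then have "inner (T ((1 / norm y) *\<^sub>R y)) ((1 / norm y) *\<^sub>R y) \<in> S"
      unfolding S_def by (intro CollectI exI[of _ "(1 / norm y) *\<^sub>R y"]) simp
    from cInf_lower[OF this bdd] show ?thesis
      using False by (simp add: \<mu>_def blinfun.scaleR_right field_simps power2_eq_square)
  qed simp
  define R where "R = T - \<mu> *\<^sub>R id_blinfun"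
  have Rx: "inner (R y) y = inner (T y) y - \<mu> * (norm y)\<^sup>2" for y
    by (simp add: R_def blinfun.diff_left blinfun.scaleR_left inner_diff_left power2_norm_eq_inner)
  have R: "positive_op R"
    unfolding positive_op_iff using low Rx
    by (auto simp: R_def selfadj_diff selfadj_scaleR selfadj_id T)
  define d where "d = norm R + 1"
  have d: "d > 0" by (simp add: d_def add_nonneg_pos)
  have "inner (R y) y \<le> d * (norm y)\<^sup>2" for y
    using abs_inner_blinfun_le[of R y] by (auto simp: d_def distrib_right abs_le_iff intro: add_increasing2)
  from positive_norm_power2_le[OF R this]
  have up: "(norm (R y))\<^sup>2 \<le> d * inner (R y) y" for y .
  \<comment> \<open>A lower bound on \<open>norm (R y)\<close> becomes one on the form of R through
    \<open>up\<close>.\<close>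
  have low2: "c\<^sup>2 / d \<le> inner (R y) y" if "norm y = 1" for y
  proof -
    have "c\<^sup>2 \<le> (norm (R y))\<^sup>2"
      using c(2)[of y] that c(1) by (intro power_mono) (auto simp: R_def)
    then show ?thesis using up[of y] d by (simp add: field_simps)
  qed
  have "\<mu> + c\<^sup>2 / d \<le> \<mu>"
    unfolding \<mu>_def
  proof (rule cInf_greatest)
    show "S \<noteq> {}" using x' by (auto simp: S_def)
    fix s assume "s \<in> S"
    then obtain y where y: "s = inner (T y) y" "norm y = 1" by (auto simp: S_def)
    then show "Inf S + c\<^sup>2 / d \<le> s"
      using low2[of y] Rx[of y] by (simp add: \<mu>_def)
  qed
  then show False using c d by (simp add: divide_le_0_iff)
qed

section \<open>Continuous functional calculus\<close>

lemma uniform_poly_approx: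
  fixes f :: "real \<Rightarrow> real"
  assumes "continuous_on {0..} f"
  obtains p :: "nat \<Rightarrow> real poly"
  where "uniform_limit {0..b} (\<lambda>k t. poly (p k) t) f sequentially"
proof -
  have "continuous_on {0..b} f" by (rule continuous_on_subset[OF assms]) auto
  note Stone = Stone_Weierstrass_real_polynomial_function[OF compact_Icc this]
  have "\<exists>p. \<forall>t\<in>{0..b}. \<bar>f t - poly p t\<bar> < inverse (real (Suc k))" for k
  proof -
    obtain g where g: "real_polynomial_function g"
      "\<And>t. t \<in> {0..b} \<Longrightarrow> \<bar>f t - g t\<bar> < inverse (real (Suc k))"
      using Stone[of "inverse (real (Suc k))"]
      by auto
    obtain c n where "g = (\<lambda>x. \<Sum>i\<le>n. c i * x ^ i)"
      using real_polynomial_function_imp_sum[OF g(1)] by blast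
    then have "g t = poly (\<Sum>i\<le>n. monom (c i) i) t" for t
      by (simp add: poly_sum poly_monom)
    then show ?thesis using g(2) by metis
  qed
  then obtain p where p: "\<And>k t. t \<in> {0..b} \<Longrightarrow> \<bar>f t - poly (p k) t\<bar> < inverse (real (Suc k))"
    by metis
  have "uniform_limit {0..b} (\<lambda>k t. poly (p k) t) f sequentially"
  proof (rule uniform_limitI)
    fix e :: real assume "e > 0"
    then obtain N where N: "inverse (real (Suc N)) < e" using reals_Archimedean by blast
    show "\<forall>\<^sub>F k in sequentially. \<forall>t\<in>{0..b}. dist (poly (p k) t) (f t) < e"
    proof (rule eventually_sequentiallyI[of N], intro ballI)
      fix k t assume "N \<le> k" "t \<in> {0..b}"
      then have "inverse (real (Suc k)) \<le> inverse (real (Suc N))" by (simp add: field_simps)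
      then show "dist (poly (p k) t) (f t) < e"
        using p[OF \<open>t \<in> {0..b}\<close>, of k] N unfolding dist_real_def by linarith
    qed
  qed
  then show ?thesis by (rule that)
qed

lemma positive_op_bounds:
  assumes "positive_op A"
  shows "0 * (norm x)\<^sup>2 \<le> inner (A x) x" and "norm A \<le> b \<Longrightarrow> inner (A x) x \<le> b * (norm x)\<^sup>2"
proof -
  show "0 * (norm x)\<^sup>2 \<le> inner (A x) x" using assms by (simp add: positive_op_iff)
  assume "norm A \<le> b"
  then have "norm A * (norm x)\<^sup>2 \<le> b * (norm x)\<^sup>2" by (rule mult_right_mono) simp
  then show "inner (A x) x \<le> b * (norm x)\<^sup>2"
    using abs_inner_blinfun_le[of A x] by linarith
qed

text \<open>Both e - p and e + p give positive operators. The interval [0, b] may exceed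
  [0, \<open>norm A\<close>], so that operators of different norms can share their approximating
  polynomials.\<close>

lemma norm_poly_op_le:
  assumes A: "positive_op A" and b: "norm A \<le> b"
    and p: "\<And>t. 0 \<le> t \<Longrightarrow> t \<le> b \<Longrightarrow> \<bar>poly p t\<bar> \<le> e"
  shows "norm (poly_op p A) \<le> e"
proof -
  have b0: "0 \<le> b" using b norm_ge_zero[of A] by linarith
  have e: "0 \<le> e" using p[of 0] b0 by linarith
  note sA = positive_selfadj[OF A]
  note bnd = positive_op_bounds(1)[OF A] positive_op_bounds(2)[OF A b]
  have "\<bar>inner (poly_op p A x) x\<bar> \<le> e * (norm x)\<^sup>2" for x
  proof -
    have "0 \<le> inner (poly_op ([:e:] - p) A x) x" "0 \<le> inner (poly_op ([:e:] + p) A x) x"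
      using p by (auto intro!: poly_op_nonneg[OF sA bnd] simp: abs_le_iff)
        (metis add.commute add_le_cancel_right diff_minus_eq_add le_diff_eq add_0)
    then show ?thesis
      unfolding poly_op_diff poly_op_add poly_op_const blinfun.diff_left blinfun.add_left
        inner_diff_left inner_add_left
      by (simp add: abs_le_iff blinfun.scaleR_left power2_norm_eq_inner)
  qed
  then show ?thesis
    by (rule norm_selfadj_le[OF selfadj_poly_op[OF sA] e])
qed

text \<open>Discharges the definite description in \<open>fun_op\<close>: a limit exists by
  completeness and the preceding norm estimate, and it does not depend on the polynomials
  chosen.\<close>

lemma fun_op_tendsto:
  fixes A :: "'h::complex_hilbert \<Rightarrow>\<^sub>L 'h"
  assumes A: "positive_op A" and b: "norm A \<le> b" and f: "continuous_on {0..} f"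
    and p: "uniform_limit {0..b} (\<lambda>k t. poly (p k) t) f sequentially"
  shows "(\<lambda>k. poly_op (p k) A) \<longlonglongrightarrow> fun_op f A"
proof -
  \<comment> \<open>Two approximating sequences differ by polynomials tending to 0 uniformly, so
    their operators differ by a null sequence in norm.\<close>
  have close: "(\<lambda>k. poly_op (p k) A) \<longlonglongrightarrow> T"
    if p: "uniform_limit {0..norm A} (\<lambda>k t. poly (p k) t) f sequentially"
      and q: "uniform_limit {0..norm A} (\<lambda>k t. poly (q k) t) f sequentially"
      and T: "(\<lambda>k. poly_op (q k) A) \<longlonglongrightarrow> T" for p q T
  proof -
    have "uniform_limit {0..norm A} (\<lambda>k t. poly (p k - q k) t) (\<lambda>t. 0) sequentially"
      using uniform_limit_minus[OF p q] by simp
    then have "(\<lambda>k. poly_op (p k - q k) A) \<longlonglongrightarrow> 0"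
    proof (intro tendstoI)
      fix e :: real
      assume u: "uniform_limit {0..norm A} (\<lambda>k t. poly (p k - q k) t) (\<lambda>t. 0) sequentially"
        and e: "0 < e"
      have "\<forall>\<^sub>F k in sequentially. \<forall>t\<in>{0..norm A}. dist (poly (p k - q k) t) 0 < e / 2"
        by (rule uniform_limitD[OF u]) (use e in simp)
      then show "\<forall>\<^sub>F k in sequentially. dist (poly_op (p k - q k) A) 0 < e"
      proof eventually_elim
        case (elim k)
        have "norm (poly_op (p k - q k) A) \<le> e / 2"
          by (rule norm_poly_op_le[OF A order_refl]) (use elim in \<open>auto simp: less_imp_le\<close>)
        then show ?case using e by simp
      qed
    qed
    from tendsto_add[OF this T] show ?thesis by (simp add: poly_op_diff)
  qed
  obtain q where q: "uniform_limit {0..norm A} (\<lambda>k t. poly (q k) t) f sequentially"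
    using uniform_poly_approx[OF f] .
  have "Cauchy (\<lambda>k. poly_op (q k) A)"
  proof (rule metric_CauchyI)
    fix e :: real assume e: "0 < e"
    obtain N where N: "\<And>k t. k \<ge> N \<Longrightarrow> 0 \<le> t \<Longrightarrow> t \<le> norm A \<Longrightarrow> dist (poly (q k) t) (f t) < e / 4"
      using uniform_limitD[OF q, of "e / 4"] e unfolding eventually_sequentially
      by (metis atLeastAtMost_iff zero_less_divide_iff zero_less_numeral)
    have ineq: "\<bar>poly (q m - q n) t\<bar> \<le> e / 2"
      if "dist (poly (q m) t) (f t) < e / 4" "dist (poly (q n) t) (f t) < e / 4" for m n t
      using that unfolding dist_real_def poly_diff by linarith
    have "dist (poly_op (q m) A) (poly_op (q n) A) < e" if "m \<ge> N" "n \<ge> N" for m n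
    proof -
      have "norm (poly_op (q m - q n) A) \<le> e / 2"
        by (rule norm_poly_op_le[OF A order_refl])
           (rule ineq[OF N[OF that(1)] N[OF that(2)]])
      then show ?thesis using e by (simp add: dist_norm poly_op_diff)
    qed
    then show "\<exists>M. \<forall>m\<ge>M. \<forall>n\<ge>M. dist (poly_op (q m) A) (poly_op (q n) A) < e" by blast
  qed
  then obtain T where T: "(\<lambda>k. poly_op (q k) A) \<longlonglongrightarrow> T"
    by (auto simp: Cauchy_convergent_iff convergent_def)
  have "fun_op f A = T"
    unfolding fun_op_def
  proof (rule the_equality)
    show "\<forall>p. uniform_limit {0..norm A} (\<lambda>k t. poly (p k) t) f sequentially \<longrightarrow>
      (\<lambda>k. poly_op (p k) A) \<longlonglongrightarrow> T"
      using close q T by blast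
    show "S = T" if "\<forall>p. uniform_limit {0..norm A} (\<lambda>k t. poly (p k) t) f sequentially \<longrightarrow>
      (\<lambda>k. poly_op (p k) A) \<longlonglongrightarrow> S" for S
      using that q T LIMSEQ_unique by blast
  qed
  moreover have "uniform_limit {0..norm A} (\<lambda>k t. poly (p k) t) f sequentially"
    by (rule uniform_limit_on_subset[OF p]) (use b in auto)
  ultimately show ?thesis using close q T by blast
qed

text \<open>An error bound for a single polynomial: it allows f to be traded for one fixed p in the
  positivity, strong limit and transfer arguments.\<close>

lemma fun_op_approx:
  fixes A :: "'h::complex_hilbert \<Rightarrow>\<^sub>L 'h"
  assumes A: "positive_op A" and b: "norm A \<le> b" and f: "continuous_on {0..} f"
    and p: "\<And>t. 0 \<le> t \<Longrightarrow> t \<le> b \<Longrightarrow> \<bar>poly p t - f t\<bar> \<le> e"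
  shows "norm (poly_op p A - fun_op f A) \<le> e"
proof (rule field_le_epsilon)
  fix d :: real assume d: "0 < d"
  have b0: "0 \<le> b" using b norm_ge_zero[of A] by linarith
  obtain q where q: "uniform_limit {0..b} (\<lambda>k t. poly (q k) t) f sequentially"
    using uniform_poly_approx[OF f] .
  have lim: "(\<lambda>k. norm (poly_op (p - q k) A)) \<longlonglongrightarrow> norm (poly_op p A - fun_op f A)"
    unfolding poly_op_diff by (intro tendsto_intros fun_op_tendsto[OF A b f q])
  have "\<forall>\<^sub>F k in sequentially. \<forall>t\<in>{0..b}. dist (poly (q k) t) (f t) < d"
    by (rule uniform_limitD[OF q d])
  then have "\<forall>\<^sub>F k in sequentially. norm (poly_op (p - q k) A) \<le> e + d"
  proof eventually_elim
    case (elim k)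
    show ?case
    proof (rule norm_poly_op_le[OF A b])
      fix t assume t: "0 \<le> t" "t \<le> b"
      then have "dist (poly (q k) t) (f t) < d" using elim by simp
      then show "\<bar>poly (p - q k) t\<bar> \<le> e + d"
        using p[OF t] unfolding dist_real_def poly_diff by linarith
    qed
  qed
  then show "norm (poly_op p A - fun_op f A) \<le> e + d"
    by (intro tendsto_upperbound[OF lim]) auto
qed

lemma poly_approx:
  fixes f :: "real \<Rightarrow> real"
  assumes f: "continuous_on {0..} f" and e: "0 < e"
  obtains p where "\<And>t. 0 \<le> t \<Longrightarrow> t \<le> b \<Longrightarrow> \<bar>poly p t - f t\<bar> \<le> e"
proof -
  obtain q where q: "uniform_limit {0..b} (\<lambda>k t. poly (q k) t) f sequentially"
    using uniform_poly_approx[OF f] .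
  from uniform_limitD[OF q e] obtain k where "\<forall>t\<in>{0..b}. dist (poly (q k) t) (f t) < e"
    by (auto simp: eventually_sequentially)
  then show ?thesis by (intro that[of "q k"]) (auto simp: dist_real_def less_imp_le)
qed

lemma selfadj_limit:
  assumes T: "\<And>k. selfadj (T k)" and lim: "sot_tendsto T S"
  shows "selfadj S"
proof -
  have lim: "(\<lambda>k. T k x) \<longlonglongrightarrow> S x" for x using lim by (simp add: sot_tendsto_def)
  have "S (c *\<^sub>C x) = c *\<^sub>C S x" for c x
  proof (rule LIMSEQ_unique[OF lim])
    have "(\<lambda>k. c *\<^sub>C T k x) \<longlonglongrightarrow> c *\<^sub>C S x"
      by (rule bounded_linear.tendsto[OF bounded_linear_scaleC lim])
    moreover have "c *\<^sub>C T k x = T k (c *\<^sub>C x)" for k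
      using T[of k] by (simp add: selfadj_def B_HD)
    ultimately show "(\<lambda>k. T k (c *\<^sub>C x)) \<longlonglongrightarrow> c *\<^sub>C S x" by simp
  qed
  moreover have "inner (S x) y = inner x (S y)" for x y
  proof (rule LIMSEQ_unique)
    show "(\<lambda>k. inner (T k x) y) \<longlonglongrightarrow> inner (S x) y" by (intro tendsto_intros lim)
    show "(\<lambda>k. inner (T k x) y) \<longlonglongrightarrow> inner x (S y)"
      unfolding selfadjD[OF T] by (intro tendsto_intros lim)
  qed
  ultimately show ?thesis by (simp add: selfadj_def B_H_def)
qed

lemma tendsto_imp_sot_tendsto: "T \<longlonglongrightarrow> S \<Longrightarrow> sot_tendsto T S"
  unfolding sot_tendsto_def by (intro allI tendsto_intros)

lemma selfadj_fun_op:
  fixes A :: "'h::complex_hilbert \<Rightarrow>\<^sub>L 'h"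
  assumes A: "positive_op A" and f: "continuous_on {0..} f"
  shows "selfadj (fun_op f A)"
proof -
  obtain q where q: "uniform_limit {0..norm A} (\<lambda>k t. poly (q k) t) f sequentially"
    using uniform_poly_approx[OF f] .
  show ?thesis
    by (rule selfadj_limit[OF _ tendsto_imp_sot_tendsto[OF fun_op_tendsto[OF A order_refl f q]]])
       (intro selfadj_poly_op positive_selfadj A)
qed

text \<open>The lower bound m of the form makes values of f below m irrelevant. This is how
  invertibility of an operator is exploited later.\<close>

lemma fun_op_nonneg:
  fixes A :: "'h::complex_hilbert \<Rightarrow>\<^sub>L 'h"
  assumes A: "positive_op A" and f: "continuous_on {0..} f"
    and m: "\<And>x. m * (norm x)\<^sup>2 \<le> inner (A x) x"
    and nn: "\<And>t. 0 \<le> t \<Longrightarrow> m \<le> t \<Longrightarrow> t \<le> norm A \<Longrightarrow> 0 \<le> f t"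
  shows "0 \<le> inner (fun_op f A x) x"
proof (rule field_le_epsilon)
  fix d :: real assume d: "0 < d"
  define n where "n = (norm x)\<^sup>2 + 1"
  have n: "0 < n" by (simp add: n_def add_nonneg_pos)
  \<comment> \<open>Two errors of size e (norm x)^2 occur, one from shifting p to make it
    nonnegative and one from replacing p by f; together they are at most d.\<close>
  define e where "e = d / (2 * n)"
  have e: "0 < e" using d n by (simp add: e_def)
  obtain p where p: "\<And>t. 0 \<le> t \<Longrightarrow> t \<le> norm A \<Longrightarrow> \<bar>poly p t - f t\<bar> \<le> e"
    by (rule poly_approx[OF f e, where b = "norm A"]) blast
  have "0 \<le> inner (poly_op (p + [:e:]) A x) x"
  proof (rule poly_op_nonneg[OF positive_selfadj[OF A] _ positive_op_bounds(2)[OF A order_refl]])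
    show "max 0 m * (norm x)\<^sup>2 \<le> inner (A x) x" for x
      using m[of x] positive_op_bounds(1)[OF A, of x] by (simp add: max_def)
    show "0 \<le> poly (p + [:e:]) t" if "max 0 m \<le> t" "t \<le> norm A" for t
      using p[of t] nn[of t] that by (simp add: abs_le_iff)
  qed
  then have 1: "0 \<le> inner (poly_op p A x) x + e * (norm x)\<^sup>2"
    by (simp add: poly_op_add poly_op_const blinfun.add_left blinfun.scaleR_left inner_add_left
        power2_norm_eq_inner)
  have "norm (poly_op p A - fun_op f A) * (norm x)\<^sup>2 \<le> e * (norm x)\<^sup>2"
    by (intro mult_right_mono fun_op_approx[OF A order_refl f p]) auto
  then have 2: "inner (poly_op p A x) x \<le> inner (fun_op f A x) x + e * (norm x)\<^sup>2"
    using abs_inner_blinfun_le[of "poly_op p A - fun_op f A" x]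
    by (simp add: blinfun.diff_left inner_diff_left)
  have "2 * e * (norm x)\<^sup>2 \<le> 2 * e * n" using e by (simp add: n_def)
  also have "\<dots> = d" using n by (simp add: e_def)
  finally show "0 \<le> inner (fun_op f A x) x + d" using 1 2 by linarith
qed

section \<open>Algebraic and order rules of the functional calculus\<close>

lemma fun_op_diff:
  fixes A :: "'h::complex_hilbert \<Rightarrow>\<^sub>L 'h"
  assumes A: "positive_op A" and f: "continuous_on {0..} f" and g: "continuous_on {0..} g"
  shows "fun_op (\<lambda>t. f t - g t) A = fun_op f A - fun_op g A"
proof -
  obtain p where p: "uniform_limit {0..norm A} (\<lambda>k t. poly (p k) t) f sequentially"
    using uniform_poly_approx[OF f] .
  obtain q where q: "uniform_limit {0..norm A} (\<lambda>k t. poly (q k) t) g sequentially"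
    using uniform_poly_approx[OF g] .
  have "(\<lambda>k. poly_op (p k - q k) A) \<longlonglongrightarrow> fun_op (\<lambda>t. f t - g t) A"
    by (rule fun_op_tendsto[OF A order_refl])
       (use uniform_limit_minus[OF p q] in \<open>auto intro!: continuous_intros f g\<close>)
  moreover have "(\<lambda>k. poly_op (p k - q k) A) \<longlonglongrightarrow> fun_op f A - fun_op g A"
    unfolding poly_op_diff
    by (intro tendsto_intros fun_op_tendsto[OF A order_refl] p q f g)
  ultimately show ?thesis by (rule LIMSEQ_unique)
qed

lemma fun_op_mult:
  fixes A :: "'h::complex_hilbert \<Rightarrow>\<^sub>L 'h"
  assumes A: "positive_op A" and f: "continuous_on {0..} f" and g: "continuous_on {0..} g"
  shows "fun_op (\<lambda>t. f t * g t) A = fun_op f A o\<^sub>L fun_op g A"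
proof -
  obtain p where p: "uniform_limit {0..norm A} (\<lambda>k t. poly (p k) t) f sequentially"
    using uniform_poly_approx[OF f] .
  obtain q where q: "uniform_limit {0..norm A} (\<lambda>k t. poly (q k) t) g sequentially"
    using uniform_poly_approx[OF g] .
  have bdd: "bounded (h ` {0..norm A})" if "continuous_on {0..} h" for h :: "real \<Rightarrow> real"
    by (intro compact_imp_bounded compact_continuous_image continuous_on_subset[OF that]) auto
  have "uniform_limit {0..norm A} (\<lambda>k t. poly (p k * q k) t) (\<lambda>t. f t * g t) sequentially"
    using bounded_bilinear.bounded_uniform_limit[OF bounded_bilinear_mult p q bdd[OF g] bdd[OF f]]
    by simp
  then have "(\<lambda>k. poly_op (p k * q k) A) \<longlonglongrightarrow> fun_op (\<lambda>t. f t * g t) A"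
    by (intro fun_op_tendsto[OF A order_refl] continuous_intros f g)
  moreover have "(\<lambda>k. poly_op (p k * q k) A) \<longlonglongrightarrow> (fun_op f A o\<^sub>L fun_op g A)"
    unfolding poly_op_mult
    by (intro bounded_bilinear.tendsto[OF bounded_bilinear_blinfun_compose]
        fun_op_tendsto[OF A order_refl] p q f g)
  ultimately show ?thesis by (rule LIMSEQ_unique)
qed

lemma fun_op_poly:
  fixes A :: "'h::complex_hilbert \<Rightarrow>\<^sub>L 'h"
  assumes A: "positive_op A"
  shows "fun_op (poly p) A = poly_op p A"
proof -
  have "norm (poly_op p A - fun_op (poly p) A) \<le> 0"
    by (rule fun_op_approx[OF A order_refl]) (auto intro!: continuous_intros)
  then show ?thesis by simp
qed

lemma fun_op_const:
  fixes A :: "'h::complex_hilbert \<Rightarrow>\<^sub>L 'h"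
  assumes A: "positive_op A"
  shows "fun_op (\<lambda>t. c) A = c *\<^sub>R id_blinfun"
  proof -
  have "poly [:c:] = (\<lambda>t. c)" by auto
  then show ?thesis using fun_op_poly[OF A, of "[:c:]"] by (simp only: poly_op_const)
qed

lemma fun_op_ident:
  fixes A :: "'h::complex_hilbert \<Rightarrow>\<^sub>L 'h"
  assumes A: "positive_op A"
  shows "fun_op (\<lambda>t. t) A = A"
proof -
  have "poly [:0, 1:] = (\<lambda>t::real. t)" by auto
  then show ?thesis using fun_op_poly[OF A, of "[:0, 1:]"] by (simp only: poly_op_X)
qed

lemma fun_op_cmult:
  fixes A :: "'h::complex_hilbert \<Rightarrow>\<^sub>L 'h"
  assumes A: "positive_op A" and f: "continuous_on {0..} f"
  shows "fun_op (\<lambda>t. c * f t) A = c *\<^sub>R fun_op f A"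
  by (simp add: fun_op_mult[OF A continuous_on_const f] fun_op_const[OF A] blinfun_eqI
      blinfun.scaleR_left)

lemma fun_op_mono:
  fixes A :: "'h::complex_hilbert \<Rightarrow>\<^sub>L 'h"
  assumes A: "positive_op A" and f: "continuous_on {0..} f" and g: "continuous_on {0..} g"
    and m: "\<And>x. m * (norm x)\<^sup>2 \<le> inner (A x) x"
    and le: "\<And>t. 0 \<le> t \<Longrightarrow> m \<le> t \<Longrightarrow> t \<le> norm A \<Longrightarrow> f t \<le> g t"
  shows "fun_op f A \<sqsubseteq> fun_op g A"
proof -
  have "0 \<le> inner (fun_op (\<lambda>t. g t - f t) A x) x" for x
    by (rule fun_op_nonneg[OF A _ m]) (use le in \<open>auto intro!: continuous_intros f g\<close>)
  then have "inner (fun_op f A x) x \<le> inner (fun_op g A x) x" for x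
    by (simp add: fun_op_diff[OF A g f] blinfun.diff_left inner_diff_left)
  then show ?thesis by (simp add: loewner_le_iff selfadj_fun_op A f g)
qed

lemma loewner_le_antisym:
  assumes "A \<sqsubseteq> B" "B \<sqsubseteq> A"
  shows "A = B"
proof -
  have "norm (B - A) \<le> 0"
  proof (rule norm_selfadj_le)
    show "selfadj (B - A)" using assms(1) by (simp add: loewner_le_def positive_op_iff)
    show "\<bar>inner ((B - A) x) x\<bar> \<le> 0 * (norm x)\<^sup>2" for x
      using loewner_leD[OF assms(1), of x] loewner_leD[OF assms(2), of x]
      by (simp add: blinfun.diff_left inner_diff_left)
  qed simp
  then show ?thesis by simp
qed

lemma fun_op_cong:
  fixes A :: "'h::complex_hilbert \<Rightarrow>\<^sub>L 'h"
  assumes A: "positive_op A" and f: "continuous_on {0..} f" and g: "continuous_on {0..} g"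
    and m: "\<And>x. m * (norm x)\<^sup>2 \<le> inner (A x) x"
    and eq: "\<And>t. 0 \<le> t \<Longrightarrow> m \<le> t \<Longrightarrow> t \<le> norm A \<Longrightarrow> f t = g t"
  shows "fun_op f A = fun_op g A"
  by (rule loewner_le_antisym; rule fun_op_mono[OF A _ _ m]) (use f g eq in auto)

lemma positive_op_scaleR: "positive_op A \<Longrightarrow> 0 \<le> s \<Longrightarrow> positive_op (s *\<^sub>R A)"
  by (simp add: positive_op_iff selfadj_scaleR blinfun.scaleR_left)

lemma fun_op_scaleR:
  fixes A :: "'h::complex_hilbert \<Rightarrow>\<^sub>L 'h"
  assumes A: "positive_op A" and f: "continuous_on {0..} f" and s: "0 \<le> s"
  shows "fun_op f (s *\<^sub>R A) = fun_op (\<lambda>t. f (s * t)) A"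
proof -
  obtain p where p: "uniform_limit {0..s * norm A} (\<lambda>k t. poly (p k) t) f sequentially"
    using uniform_poly_approx[OF f] .
  have sA: "poly_op [:0, s:] A = s *\<^sub>R A"
    using poly_op_smult[of s "[:0, 1:]" A] by (simp add: poly_op_X)
  have "uniform_limit {0..norm A} (\<lambda>k t. poly (p k \<circ>\<^sub>p [:0, s:]) t) (\<lambda>t. f (s * t)) sequentially"
  proof -
    have "(\<lambda>t. s * t) \<in> {0..norm A} \<rightarrow> {0..s * norm A}"
      using s by (simp add: mult_left_mono)
    from uniform_limit_compose'[OF p this] show ?thesis
      by (simp add: poly_pcompose mult.commute)
  qed
  then have "(\<lambda>k. poly_op (p k \<circ>\<^sub>p [:0, s:]) A) \<longlonglongrightarrow> fun_op (\<lambda>t. f (s * t)) A"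
    by (intro fun_op_tendsto[OF A order_refl] continuous_on_compose2[OF f] continuous_intros)
       (use s in auto)
  moreover have "(\<lambda>k. poly_op (p k \<circ>\<^sub>p [:0, s:]) A) \<longlonglongrightarrow> fun_op f (s *\<^sub>R A)"
    unfolding poly_op_pcompose sA
    by (rule fun_op_tendsto[OF _ _ f p]) (use A s in \<open>auto simp: positive_op_scaleR\<close>)
  ultimately show ?thesis by (rule LIMSEQ_unique[rotated])
qed

text \<open>The two spaces may differ: with W an embedding whose range is invariant under A, f(A) is
  computed on that range from the operator B on the other space. The number b majorizes both norms,
  so one polynomial sequence serves both sides.\<close>

lemma fun_op_intertwine:
  fixes A :: "'a::complex_hilbert \<Rightarrow>\<^sub>L 'a" and B :: "'b::complex_hilbert \<Rightarrow>\<^sub>L 'b"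
    and W :: "'b \<Rightarrow> 'a"
  assumes A: "positive_op A" and B: "positive_op B" and f: "continuous_on {0..} f"
    and AW: "\<And>x. A (W x) = W (B x)" and W: "bounded_linear W"
  shows "fun_op f A (W x) = W (fun_op f B x)"
proof -
  define b where "b = max (norm A) (norm B)"
  obtain p where p: "uniform_limit {0..b} (\<lambda>k t. poly (p k) t) f sequentially"
    using uniform_poly_approx[OF f] .
  have "(\<lambda>k. poly_op (p k) A (W x)) \<longlonglongrightarrow> fun_op f A (W x)"
    by (intro tendsto_intros fun_op_tendsto[OF A _ f p]) (simp add: b_def)
  moreover have "(\<lambda>k. W (poly_op (p k) B x)) \<longlonglongrightarrow> W (fun_op f B x)"
    by (intro bounded_linear.tendsto[OF W] tendsto_intros fun_op_tendsto[OF B _ f p])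
       (simp add: b_def)
  ultimately show ?thesis
    unfolding poly_op_intertwine[OF AW W] by (rule LIMSEQ_unique)
qed

lemma fun_op_eigen:
  fixes A :: "'h::complex_hilbert \<Rightarrow>\<^sub>L 'h"
  assumes A: "positive_op A" and f: "continuous_on {0..} f"
    and x: "A x = u *\<^sub>R x" and u: "0 \<le> u"
  shows "fun_op f A x = f u *\<^sub>R x"
proof -
  \<comment> \<open>For x = 0 the number u need not lie in [0, \<open>norm A\<close>]; the interval
    is enlarged to contain it.\<close>
  define b where "b = max (norm A) u"
  obtain p where p: "uniform_limit {0..b} (\<lambda>k t. poly (p k) t) f sequentially"
    using uniform_poly_approx[OF f] .
  have "(\<lambda>k. poly_op (p k) A x) \<longlonglongrightarrow> fun_op f A x"
    by (intro tendsto_intros fun_op_tendsto[OF A _ f p]) (simp add: b_def)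
  moreover have "(\<lambda>k. poly (p k) u *\<^sub>R x) \<longlonglongrightarrow> f u *\<^sub>R x"
    by (intro tendsto_intros tendsto_uniform_limitI[OF p]) (use u in \<open>auto simp: b_def\<close>)
  ultimately show ?thesis
    unfolding poly_op_eigen[OF x] by (rule LIMSEQ_unique)
qed

section \<open>Continuity in the strong operator topology\<close>

lemma sot_tendsto_apply:
  assumes T: "\<And>k. norm (T k) \<le> b" and lim: "sot_tendsto T S" and y: "y \<longlonglongrightarrow> z"
  shows "(\<lambda>k. T k (y k)) \<longlonglongrightarrow> S z"
proof -
  have "(\<lambda>k. T k (y k - z)) \<longlonglongrightarrow> 0"
  proof (rule Lim_null_comparison)
    show "\<forall>\<^sub>F k in sequentially. norm (T k (y k - z)) \<le> b * norm (y k - z)"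
      by (intro always_eventually allI order_trans[OF norm_blinfun] mult_right_mono T) simp
    show "(\<lambda>k. b * norm (y k - z)) \<longlonglongrightarrow> 0"
      by (intro tendsto_mult_right_zero tendsto_norm_zero LIM_zero y)
  qed
  moreover have "(\<lambda>k. T k z) \<longlonglongrightarrow> S z" using lim by (simp add: sot_tendsto_def)
  ultimately have "(\<lambda>k. T k (y k - z) + T k z) \<longlonglongrightarrow> 0 + S z" by (rule tendsto_add)
  then show ?thesis by (simp add: blinfun.diff_right)
qed

text \<open>A bound is asked of the left factors only: they act on moving vectors, the right factors
  on a fixed one.\<close>

lemma sot_tendsto_compose:
  assumes "\<And>k. norm (T k) \<le> b" "sot_tendsto T S" "sot_tendsto T' S'"
  shows "sot_tendsto (\<lambda>k. T k o\<^sub>L T' k) (S o\<^sub>L S')"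
  unfolding sot_tendsto_def blinfun_apply_blinfun_compose
  by (intro allI sot_tendsto_apply[OF assms(1,2)]) (use assms(3) in \<open>simp add: sot_tendsto_def\<close>)

lemma sot_tendsto_poly_op:
  assumes T: "\<And>k. norm (T k) \<le> b" and lim: "sot_tendsto T S"
  shows "(\<lambda>k. poly_op p (T k) x) \<longlonglongrightarrow> poly_op p S x"
proof (induction p)
  case 0
  then show ?case by simp
next
  case (pCons a p)
  then show ?case
    unfolding poly_op_pCons by (intro tendsto_add tendsto_const sot_tendsto_apply[OF T lim])
qed

text \<open>One polynomial uniformly close to f on an interval majorizing all norms transfers the
  convergence from polynomials to f.\<close>

lemma sot_tendsto_fun_op:
  fixes S :: "'h::complex_hilbert \<Rightarrow>\<^sub>L 'h"
  assumes f: "continuous_on {0..} f" and T: "\<And>k. positive_op (T k)" "\<And>k. norm (T k) \<le> b"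
    and S: "positive_op S" and lim: "sot_tendsto T S"
  shows "sot_tendsto (\<lambda>k. fun_op f (T k)) (fun_op f S)"
  unfolding sot_tendsto_def
proof (intro allI tendstoI)
  fix x :: 'h and e :: real assume e: "0 < e"
  define c where "c = max b (norm S)"
  define n where "n = norm x + 1"
  have n: "0 < n" by (simp add: n_def add_nonneg_pos)
  define d where "d = e / (4 * n)"
  have d: "0 < d" using e n by (simp add: d_def)
  have "4 * (d * n) = e" using n by (simp add: d_def)
  then have dx: "4 * (d * norm x) < e" using d by (simp add: n_def distrib_left)
  obtain p where p: "\<And>t. 0 \<le> t \<Longrightarrow> t \<le> c \<Longrightarrow> \<bar>poly p t - f t\<bar> \<le> d"
    by (rule poly_approx[OF f d, where b = c]) blast
  have approx: "dist (fun_op f A x) (poly_op p A x) \<le> d * norm x"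
    if "positive_op A" "norm A \<le> c" for A :: "'h \<Rightarrow>\<^sub>L 'h"
  proof -
    have "norm ((poly_op p A - fun_op f A) x) \<le> norm (poly_op p A - fun_op f A) * norm x"
      by (rule norm_blinfun)
    also have "\<dots> \<le> d * norm x"
      by (intro mult_right_mono fun_op_approx[OF that f p]) auto
    finally show ?thesis by (simp add: dist_norm norm_minus_commute blinfun.diff_left)
  qed
  have "\<forall>\<^sub>F k in sequentially. dist (poly_op p (T k) x) (poly_op p S x) < e / 2"
    using sot_tendsto_poly_op[OF T(2) lim] e by (intro tendstoD) auto
  then show "\<forall>\<^sub>F k in sequentially. dist (fun_op f (T k) x) (fun_op f S x) < e"
  proof eventually_elim
    case (elim k)
    have "norm (T k) \<le> c" "norm S \<le> c" using T(2)[of k] by (auto simp: c_def)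
    with elim approx[OF T(1), of k] approx[OF S] dx
      dist_triangle[of "fun_op f (T k) x" "fun_op f S x" "poly_op p (T k) x"]
      dist_triangle[of "poly_op p (T k) x" "fun_op f S x" "poly_op p S x"]
    show ?case by (simp add: dist_commute)
  qed
qed

section \<open>Positive invertible operators\<close>

lemma positive_op_selfadjI: "selfadj A \<Longrightarrow> (\<And>x. 0 \<le> inner (A x) x) \<Longrightarrow> positive_op A"
  by (simp add: positive_op_iff)

lemma positive_op_lower_bound:
  fixes A :: "'h::complex_inner \<Rightarrow>\<^sub>L 'h"
  assumes "selfadj A" "0 \<le> d" "\<And>x. d * (norm x)\<^sup>2 \<le> inner (A x) x"
  shows "positive_op A"
proof (rule positive_op_selfadjI[OF assms(1)])
  fix x :: 'h
  have "0 \<le> d * (norm x)\<^sup>2" using assms(2) by simp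
  also have "\<dots> \<le> inner (A x) x" by (rule assms(3))
  finally show "0 \<le> inner (A x) x" .
qed

text \<open>The inverse is found as g(A). Cutting the reciprocal off at d makes it continuous at 0
  and leaves it unchanged from d on, where alone it matters by the lower bound.\<close>

lemma inverse_op_exists:
  fixes A :: "'h::complex_hilbert \<Rightarrow>\<^sub>L 'h"
  assumes A: "selfadj A" and d: "0 < d" and lb: "\<And>x. d * (norm x)\<^sup>2 \<le> inner (A x) x"
  shows "\<exists>B. is_inverse_op A B"
proof -
  have pA: "positive_op A" using positive_op_lower_bound[OF A less_imp_le[OF d] lb] .
  define g :: "real \<Rightarrow> real" where "g = (\<lambda>t. 1 / max t d)"
  have g: "continuous_on {0..} g"
    unfolding g_def using d by (intro continuous_intros) auto
  have one: "fun_op (\<lambda>t. t * g t) A = id_blinfun" "fun_op (\<lambda>t. g t * t) A = id_blinfun"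
  proof -
    have eq: "fun_op h A = id_blinfun" if "continuous_on {0..} h" "\<And>t. d \<le> t \<Longrightarrow> h t = 1" for h
      using fun_op_cong[OF pA that(1) continuous_on_const lb that(2)] fun_op_const[OF pA, of 1]
      by simp
    show "fun_op (\<lambda>t. t * g t) A = id_blinfun" "fun_op (\<lambda>t. g t * t) A = id_blinfun"
      by (rule eq, intro continuous_on_mult continuous_on_id g, use d in \<open>simp add: g_def\<close>)+
  qed
  have "A o\<^sub>L fun_op g A = id_blinfun" "fun_op g A o\<^sub>L A = id_blinfun"
    using one fun_op_mult[OF pA continuous_on_id g] fun_op_mult[OF pA g continuous_on_id]
    by (simp_all add: fun_op_ident[OF pA])
  moreover have "fun_op g A \<in> B_H"
    using selfadj_fun_op[OF pA g] by (simp add: selfadj_def)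
  ultimately show ?thesis by (auto simp: is_inverse_op_def)
qed

text \<open>Together with \<open>PP_lower_bound\<close> this characterizes \<open>PP\<close> by a
  positive lower bound of the form, the shape in which invertibility is mostly handled
  below.\<close>

lemma PP_I:
  fixes A :: "'h::complex_hilbert \<Rightarrow>\<^sub>L 'h"
  assumes "selfadj A" "0 < d" "\<And>x. d * (norm x)\<^sup>2 \<le> inner (A x) x"
  shows "A \<in> PP"
  using inverse_op_exists[OF assms] positive_op_lower_bound[OF assms(1) _ assms(3)] assms(2)
  by (simp add: PP_def)

lemma PP_positive: "A \<in> PP \<Longrightarrow> positive_op A"
  by (simp add: PP_def)

lemma PP_selfadj: "A \<in> PP \<Longrightarrow> selfadj A"
  by (simp add: PP_def positive_selfadj)

lemma is_inverse_op_unique: "is_inverse_op A B \<Longrightarrow> is_inverse_op A C \<Longrightarrow> B = C"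
  unfolding is_inverse_op_def
  by (intro blinfun_eqI) (metis blinfun_apply_blinfun_compose blinfun_apply_id_blinfun)

lemma inverse_op_eqI: "is_inverse_op A B \<Longrightarrow> inverse_op A = B"
  unfolding inverse_op_def by (rule the_equality) (auto intro: is_inverse_op_unique)

lemma is_inverse_op_inverse_op: "A \<in> PP \<Longrightarrow> is_inverse_op A (inverse_op A)"
  using inverse_op_eqI by (auto simp: PP_def)

lemma inverse_op_right [simp]: "A \<in> PP \<Longrightarrow> A (inverse_op A x) = x"
  using is_inverse_op_inverse_op[of A] unfolding is_inverse_op_def
  by (metis blinfun_apply_blinfun_compose blinfun_apply_id_blinfun)

lemma inverse_op_left [simp]: "A \<in> PP \<Longrightarrow> inverse_op A (A x) = x"
  using is_inverse_op_inverse_op[of A] unfolding is_inverse_op_def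
  by (metis blinfun_apply_blinfun_compose blinfun_apply_id_blinfun)

lemma selfadj_inverse_op:
  assumes "A \<in> PP"
  shows "selfadj (inverse_op A)"
proof -
  have "inner (inverse_op A x) y = inner x (inverse_op A y)" for x y
    using selfadjD[OF PP_selfadj[OF assms], of "inverse_op A x" "inverse_op A y"] assms by simp
  then show ?thesis
    using is_inverse_op_inverse_op[OF assms] by (simp add: selfadj_def is_inverse_op_def)
qed

lemma PP_lower_bound:
  assumes "A \<in> PP"
  obtains d where "0 < d" "\<And>x. d * (norm x)\<^sup>2 \<le> inner (A x) x"
proof -
  define B where "B = inverse_op A"
  \<comment> \<open>From |x| \<le> |B| |A x| and |A x|^2 \<le> (|A| + 1) <A x, x>; the summands 1
    make K positive.\<close>
  define K where "K = ((norm B)\<^sup>2 + 1) * (norm A + 1)"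
  have K: "0 < K" by (simp add: K_def add_nonneg_pos)
  have "(norm x)\<^sup>2 \<le> K * inner (A x) x" for x
  proof -
    have "norm x = norm (B (A x))" using assms by (simp add: B_def)
    also have "\<dots> \<le> norm B * norm (A x)" by (rule norm_blinfun)
    finally have "(norm x)\<^sup>2 \<le> (norm B * norm (A x))\<^sup>2" by (rule power_mono) simp
    also have "\<dots> \<le> ((norm B)\<^sup>2 + 1) * (norm (A x))\<^sup>2"
      by (simp add: power_mult_distrib distrib_right)
    also have "(norm (A x))\<^sup>2 \<le> (norm A + 1) * inner (A x) x"
      by (rule positive_norm_power2_le[OF PP_positive[OF assms]
            positive_op_bounds(2)[OF PP_positive[OF assms]]]) simp
    finally show ?thesis by (simp add: K_def mult_left_mono mult.assoc)
  qed
  then show ?thesis using K by (intro that[of "1 / K"]) (auto simp: field_simps)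
qed

lemma PP_scaleR:
  fixes A :: "'h::complex_hilbert \<Rightarrow>\<^sub>L 'h"
  assumes "A \<in> PP" "0 < c"
  shows "c *\<^sub>R A \<in> PP"
proof -
  obtain d where "0 < d" "\<And>x. d * (norm x)\<^sup>2 \<le> inner (A x) x" by (rule PP_lower_bound[OF assms(1)]) blast
  then show ?thesis
    using assms by (intro PP_I[of _ "c * d"])
      (auto simp: PP_selfadj selfadj_scaleR blinfun.scaleR_left mult.assoc)
qed

lemma PP_id: "(id_blinfun :: 'h::complex_hilbert \<Rightarrow>\<^sub>L 'h) \<in> PP"
  by (rule PP_I[of _ 1]) (auto simp: selfadj_id power2_norm_eq_inner)

lemma PP_mono:
  fixes A :: "'h::complex_hilbert \<Rightarrow>\<^sub>L 'h"
  assumes "A \<in> PP" "A \<sqsubseteq> B"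
  shows "B \<in> PP"
proof -
  obtain d where d: "0 < d" "\<And>x. d * (norm x)\<^sup>2 \<le> inner (A x) x" by (rule PP_lower_bound[OF assms(1)]) blast
  \<comment> \<open>The order relation only speaks of B - A, so self-adjointness of B has to be
    recovered.\<close>
  have "selfadj ((B - A) + A)"
    using assms by (intro selfadj_add) (auto simp: loewner_le_def positive_op_iff PP_selfadj)
  then have "selfadj B" by simp
  then show ?thesis
    using d(1) order_trans[OF d(2) loewner_leD[OF assms(2)]] by (rule PP_I)
qed

lemma inverse_op_scaleR:
  fixes A :: "'h::complex_hilbert \<Rightarrow>\<^sub>L 'h"
  assumes "A \<in> PP" "0 < c"
  shows "inverse_op (c *\<^sub>R A) = (1 / c) *\<^sub>R inverse_op A"
proof (rule inverse_op_eqI)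
  show "is_inverse_op (c *\<^sub>R A) ((1 / c) *\<^sub>R inverse_op A)"
    unfolding is_inverse_op_def
    using assms is_inverse_op_inverse_op[OF assms(1)]
    by (auto intro!: blinfun_eqI B_H_scaleR simp: is_inverse_op_def[of A] blinfun.scaleR_left
        blinfun.scaleR_right)
qed

text \<open>A left inverse R bounds S from below, and hence the form of the conjugate. In the
  applications S is \<open>sqrt_op X\<close> or its inverse.\<close>

lemma PP_conj:
  fixes A S R :: "'h::complex_hilbert \<Rightarrow>\<^sub>L 'h"
  assumes A: "A \<in> PP" and S: "selfadj S" and R: "\<And>x. R (S x) = x"
  shows "S o\<^sub>L A o\<^sub>L S \<in> PP"
proof -
  obtain d where d: "0 < d" "\<And>x. d * (norm x)\<^sup>2 \<le> inner (A x) x" by (rule PP_lower_bound[OF A]) blast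
  define K where "K = (norm R)\<^sup>2 + 1"
  have K: "0 < K" by (simp add: K_def add_nonneg_pos)
  show ?thesis
  proof (rule PP_I[of _ "d / K"])
    show "selfadj (S o\<^sub>L A o\<^sub>L S)" by (rule selfadj_conj[OF S PP_selfadj[OF A]])
    show "0 < d / K" using d K by simp
    fix x
    have "norm x \<le> norm R * norm (S x)" using norm_blinfun[of R "S x"] by (simp add: R)
    then have "(norm x)\<^sup>2 \<le> (norm R * norm (S x))\<^sup>2" by (rule power_mono) simp
    also have "\<dots> \<le> K * (norm (S x))\<^sup>2"
      by (simp add: K_def power_mult_distrib distrib_right)
    finally have "d / K * (norm x)\<^sup>2 \<le> d / K * (K * (norm (S x))\<^sup>2)"
      using d K by (intro mult_left_mono) auto
    also have "\<dots> = d * (norm (S x))\<^sup>2" using K by simp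
    also have "\<dots> \<le> inner (A (S x)) (S x)" by (rule d)
    finally show "d / K * (norm x)\<^sup>2 \<le> inner ((S o\<^sub>L A o\<^sub>L S) x) x"
      using selfadjD[OF S, of "A (S x)" x] by simp
  qed
qed

section \<open>Square roots\<close>

lemma continuous_on_sqrt_nonneg: "continuous_on {0..} sqrt"
  by (intro continuous_intros)

lemma positive_sqrt_op:
  fixes A :: "'h::complex_hilbert \<Rightarrow>\<^sub>L 'h"
  assumes "positive_op A"
  shows "positive_op (sqrt_op A)"
  using fun_op_nonneg[OF assms continuous_on_sqrt_nonneg positive_op_bounds(1)[OF assms]]
  by (simp add: positive_op_iff selfadj_fun_op[OF assms continuous_on_sqrt_nonneg])

lemma sqrt_op_square:
  fixes A :: "'h::complex_hilbert \<Rightarrow>\<^sub>L 'h"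
  assumes A: "positive_op A"
  shows "sqrt_op A (sqrt_op A x) = A x"
proof -
  have "fun_op (\<lambda>t. sqrt t * sqrt t) A = fun_op (\<lambda>t. t) A"
    by (rule fun_op_cong[OF A _ _ positive_op_bounds(1)[OF A]]) (auto intro!: continuous_intros)
  then show ?thesis
    by (metis A blinfun_apply_blinfun_compose continuous_on_sqrt_nonneg fun_op_ident fun_op_mult)
qed

lemma sqrt_op_lower_bound:
  fixes A :: "'h::complex_hilbert \<Rightarrow>\<^sub>L 'h"
  assumes A: "positive_op A" and lb: "\<And>x. d * (norm x)\<^sup>2 \<le> inner (A x) x"
  shows "sqrt d * (norm x)\<^sup>2 \<le> inner (sqrt_op A x) x"
proof -
  have "fun_op (\<lambda>t. sqrt d) A \<sqsubseteq> sqrt_op A"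
    by (rule fun_op_mono[OF A _ _ lb]) (auto intro!: continuous_intros)
  from loewner_leD[OF this, of x] show ?thesis
    by (simp add: fun_op_const[OF A] blinfun.scaleR_left power2_norm_eq_inner)
qed

lemma sqrt_op_PP:
  fixes A :: "'h::complex_hilbert \<Rightarrow>\<^sub>L 'h"
  assumes A: "A \<in> PP"
  shows "sqrt_op A \<in> PP"
proof -
  obtain d where d: "0 < d" "\<And>x. d * (norm x)\<^sup>2 \<le> inner (A x) x" by (rule PP_lower_bound[OF A]) blast
  note pA = PP_positive[OF A]
  show ?thesis
    by (rule PP_I[OF positive_selfadj[OF positive_sqrt_op[OF pA]] _ sqrt_op_lower_bound[OF pA d(2)]])
       (use d in simp)
qed

lemma sqrt_op_scaleR:
  fixes A :: "'h::complex_hilbert \<Rightarrow>\<^sub>L 'h"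
  assumes A: "positive_op A" and c: "0 \<le> c"
  shows "sqrt_op (c *\<^sub>R A) = sqrt c *\<^sub>R sqrt_op A"
  using fun_op_cmult[OF A continuous_on_sqrt_nonneg, of "sqrt c"]
  by (simp add: fun_op_scaleR[OF A continuous_on_sqrt_nonneg c] real_sqrt_mult)

lemma inverse_sqrt_op_conj:
  fixes A :: "'h::complex_hilbert \<Rightarrow>\<^sub>L 'h"
  assumes "X \<in> PP" "A \<in> PP"
  shows "inverse_op (sqrt_op X) o\<^sub>L A o\<^sub>L inverse_op (sqrt_op X) \<in> PP"
  using sqrt_op_PP[OF assms(1)] assms(2)
  by (intro PP_conj[of _ _ "sqrt_op X"]) (simp_all add: selfadj_inverse_op)

section \<open>Operator means\<close>

lemma conj_mono:
  assumes "selfadj S" "A \<sqsubseteq> B"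
  shows "S o\<^sub>L A o\<^sub>L S \<sqsubseteq> S o\<^sub>L B o\<^sub>L S"
proof -
  have eq: "(S o\<^sub>L B o\<^sub>L S) - (S o\<^sub>L A o\<^sub>L S) = S o\<^sub>L (B - A) o\<^sub>L S"
    by (rule blinfun_eqI) (simp add: blinfun.diff_left blinfun.diff_right)
  have "selfadj (B - A)" using assms by (simp add: loewner_le_def positive_op_iff)
  then have "selfadj (S o\<^sub>L (B - A) o\<^sub>L S)" by (rule selfadj_conj[OF assms(1)])
  moreover have "0 \<le> inner ((S o\<^sub>L (B - A) o\<^sub>L S) x) x" for x
    using loewner_leD[OF assms(2), of "S x"] selfadjD[OF assms(1), of "(B - A) (S x)" x]
    by (simp add: blinfun.diff_left inner_diff_left)
  ultimately show ?thesis unfolding loewner_le_def eq by (simp add: positive_op_iff)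
qed

text \<open>The scalar leaves both outer factors X^(1/2) and enters X^(-1/2) A X^(-1/2) as 1/c.
  Comparing (cX) \<sigma> A with c (X \<sigma> A) thus amounts to comparing f(t/c) with f(t) on one
  and the same operator.\<close>

lemma op_mean_scaleR:
  fixes A :: "'h::complex_hilbert \<Rightarrow>\<^sub>L 'h"
  assumes f: "continuous_on {0..} f" and X: "X \<in> PP" and A: "A \<in> PP" and c: "0 < c"
  shows "op_mean f (c *\<^sub>R X) A = c *\<^sub>R (sqrt_op X o\<^sub>L
     fun_op (\<lambda>t. f (1 / c * t)) (inverse_op (sqrt_op X) o\<^sub>L A o\<^sub>L inverse_op (sqrt_op X)) o\<^sub>L sqrt_op X)"
proof -
  define D where "D = inverse_op (sqrt_op X) o\<^sub>L A o\<^sub>L inverse_op (sqrt_op X)"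
  have D: "D \<in> PP" unfolding D_def by (rule inverse_sqrt_op_conj[OF X A])
  have s: "sqrt_op (c *\<^sub>R X) = sqrt c *\<^sub>R sqrt_op X"
    using c by (simp add: sqrt_op_scaleR PP_positive X)
  have "inverse_op (sqrt_op (c *\<^sub>R X)) = (1 / sqrt c) *\<^sub>R inverse_op (sqrt_op X)"
    unfolding s using c by (intro inverse_op_scaleR sqrt_op_PP X) simp
  then have "inverse_op (sqrt_op (c *\<^sub>R X)) o\<^sub>L A o\<^sub>L inverse_op (sqrt_op (c *\<^sub>R X)) = (1 / c) *\<^sub>R D"
    using c by (intro blinfun_eqI)
      (simp add: D_def blinfun.scaleR_left blinfun.scaleR_right less_imp_le)
  then have "op_mean f (c *\<^sub>R X) A =
      (sqrt c *\<^sub>R sqrt_op X) o\<^sub>L fun_op (\<lambda>t. f (1 / c * t)) D o\<^sub>L (sqrt c *\<^sub>R sqrt_op X)"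
    unfolding op_mean_def using fun_op_scaleR[OF PP_positive[OF D] f, of "1 / c"] c s by simp
  also have "\<dots> = c *\<^sub>R (sqrt_op X o\<^sub>L fun_op (\<lambda>t. f (1 / c * t)) D o\<^sub>L sqrt_op X)"
    using c by (intro blinfun_eqI) (simp add: blinfun.scaleR_left blinfun.scaleR_right)
  finally show ?thesis by (simp add: D_def)
qed

section \<open>Embedding finitely many vectors into the sequence space\<close>

lemma cinner_add_right: "cinner x (y + z) = cinner x y + cinner x z" for x y z :: "'a::complex_inner"
  by (metis cinner_add_left cinner_commute complex_cnj_add)

lemma cinner_scaleC_right: "cinner x (a *\<^sub>C y) = cnj a * cinner x y" for x y :: "'a::complex_inner"
  by (metis cinner_commute cinner_scaleC_left complex_cnj_mult)

lemma cinner_zero_left [simp]: "cinner 0 y = 0" for y :: "'a::complex_inner"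
  using cinner_add_left[of 0 0 y] by simp

lemma cinner_sum_left: "cinner (\<Sum>i\<in>I. f i) y = (\<Sum>i\<in>I. cinner (f i) y)"
  for y :: "'a::complex_inner"
  by (induction I rule: infinite_finite_induct) (simp_all add: cinner_add_left)

lemma cinner_diff_left: "cinner (x - y) z = cinner x z - cinner y z" for x y z :: "'a::complex_inner"
  using cinner_add_left[of "x - y" y z] by simp

lemma cinner_self: "cinner x x = complex_of_real ((norm x)\<^sup>2)" for x :: "'a::complex_inner"
proof -
  have "inner x (\<i> *\<^sub>C x) = 0"
    using inner_scaleC_i[of x x] by (simp add: inner_commute)
  then show ?thesis by (simp add: cinner_eq complex_eq_iff power2_norm_eq_inner)
qed

lemma bounded_linear_cinner_left: "bounded_linear (\<lambda>x. cinner x (y :: 'a::complex_inner))"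
proof -
  have "bounded_linear (\<lambda>x. complex_of_real (inner x y) + \<i> * complex_of_real (inner x (\<i> *\<^sub>C y)))"
    by (intro bounded_linear_add bounded_linear_mult_const bounded_linear_const_mult
        bounded_linear_compose[OF bounded_linear_of_real] bounded_linear_inner_left)
  also have "(\<lambda>x. complex_of_real (inner x y) + \<i> * complex_of_real (inner x (\<i> *\<^sub>C y))) =
      (\<lambda>x. cinner x y)"
    by (auto simp: cinner_eq complex_eq_iff)
  finally show ?thesis .
qed

lemma bounded_linear_cinner_scaleC:
  fixes a :: "'a::complex_inner" and b :: "'b::complex_inner"
  shows "bounded_linear (\<lambda>x. cinner x a *\<^sub>C b)"
proof (rule bounded_linear_intro)
  fix x y :: 'a and r
  interpret bounded_linear "\<lambda>x. cinner x a" by (rule bounded_linear_cinner_left)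
  show "cinner (x + y) a *\<^sub>C b = cinner x a *\<^sub>C b + cinner y a *\<^sub>C b"
    by (simp add: add scaleC_add_left)
  show "cinner (r *\<^sub>R x) a *\<^sub>C b = r *\<^sub>R cinner x a *\<^sub>C b"
    by (simp add: scale scaleR_conv_of_real scaleC_of_real flip: scaleC_scaleC)
  have "cmod (cinner x a) \<le> norm x * onorm (\<lambda>x. cinner x a)"
    using onorm[OF bounded_linear_cinner_left, of x a] by (simp add: mult.commute)
  then show "norm (cinner x a *\<^sub>C b) \<le> norm x * (onorm (\<lambda>x. cinner x a) * norm b)"
    by (simp add: norm_scaleC mult_right_mono flip: mult.assoc)
qed

lemma scaleC_sum: "c *\<^sub>C (\<Sum>i\<in>I. g i) = (\<Sum>i\<in>I. c *\<^sub>C (g i :: 'a::complex_inner))"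
  by (rule linear_sum[OF bounded_linear.linear[OF bounded_linear_scaleC]])

text \<open>Gram-Schmidt by induction over F. Spanning is expressed by the Fourier expansion, the
  form in which the embedding below needs it.\<close>

lemma orthonormal_spanning:
  fixes F :: "'a::complex_inner set"
  assumes "finite F"
  obtains d :: nat and e where
    "\<And>i j. i < d \<Longrightarrow> j < d \<Longrightarrow> cinner (e i) (e j) = (if i = j then 1 else 0)"
    "\<And>v. v \<in> F \<Longrightarrow> v = (\<Sum>i<d. cinner v (e i) *\<^sub>C e i)"
proof -
  have "\<exists>(d :: nat) e. (\<forall>i<d. \<forall>j<d. cinner (e i) (e j) = (if i = j then 1 else 0)) \<and>
    (\<forall>v\<in>F. v = (\<Sum>i<d. cinner v (e i) *\<^sub>C e i))"
    using assms
  proof (induction F)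
    case empty
    then show ?case by (intro exI[of _ 0]) simp
  next
    case (insert v F)
    then obtain d :: nat and e where
      "\<forall>i<d. \<forall>j<d. cinner (e i) (e j) = (if i = j then 1 else 0)"
      "\<forall>v\<in>F. v = (\<Sum>i<d. cinner v (e i) *\<^sub>C e i)"
      by blast
    note on = this(1)[rule_format] and sp = this(2)[rule_format]
    \<comment> \<open>The component of v orthogonal to the system so far; if it vanishes, the system
      need not grow.\<close>
    define w where "w = v - (\<Sum>i<d. cinner v (e i) *\<^sub>C e i)"
    have we: "cinner w (e j) = 0" if "j < d" for j
      using that by (simp add: w_def cinner_diff_left cinner_sum_left cinner_scaleC_left on
          if_distrib[of "\<lambda>x. _ * x"] cong: if_cong)
    then have ew: "cinner (e j) w = 0" if "j < d" for j
      using that by (metis cinner_commute complex_cnj_zero)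
    show ?case
    proof (cases "w = 0")
      case True
      then show ?thesis
        using on sp by (intro exI[of _ d] exI[of _ e]) (auto simp: w_def)
    next
      case False
      define u where "u = complex_of_real (1 / norm w) *\<^sub>C w"
      define e' where "e' = e(d := u)"
      have uu: "cinner u u = 1"
        using False by (simp add: cinner_self u_def norm_scaleC norm_divide)
      have eu: "cinner (e j) u = 0" "cinner u (e j) = 0" if "j < d" for j
        using that by (simp_all add: u_def cinner_scaleC_left cinner_scaleC_right we ew)
      have "cinner (e' i) (e' j) = (if i = j then 1 else 0)" if "i < Suc d" "j < Suc d" for i j
        using that on eu uu by (auto simp: e'_def less_Suc_eq)
      moreover have "y = (\<Sum>i<Suc d. cinner y (e' i) *\<^sub>C e' i)" if "y \<in> insert v F" for y
      proof -
        have S: "(\<Sum>i<Suc d. cinner y (e' i) *\<^sub>C e' i) =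
            (\<Sum>i<d. cinner y (e i) *\<^sub>C e i) + cinner y u *\<^sub>C u"
          by (simp add: e'_def)
        show ?thesis
        proof (cases "y \<in> F")
          case True
          have "cinner y u = 0"
            by (subst sp[OF True]) (simp add: cinner_sum_left cinner_scaleC_left eu)
          then show ?thesis
            unfolding S using sp[OF True] scaleC_of_real[of 0 u] by simp
        next
          case False
          then have y: "y = w + (\<Sum>i<d. cinner v (e i) *\<^sub>C e i)" "y = v"
            using that by (auto simp: w_def)
          have "cinner y u = cinner w u"
            by (subst y(1)) (simp add: cinner_add_left cinner_sum_left cinner_scaleC_left eu)
          also have "\<dots> = complex_of_real (norm w)"
            using \<open>w \<noteq> 0\<close> by (simp add: u_def cinner_scaleC_right cinner_self power2_eq_square)
          finally have "cinner y u *\<^sub>C u = w"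
            using \<open>w \<noteq> 0\<close> by (simp add: u_def scaleC_scaleC)
          then show ?thesis unfolding S using y by (metis add.commute)
        qed
      qed
      ultimately show ?thesis by blast
    qed
  qed
  then show ?thesis using that by blast
qed

definition ell2_unit :: "nat \<Rightarrow> ell2" where
  "ell2_unit i = Abs_ell2 (\<lambda>j. if j = i then 1 else 0)"

lemma ell2_nth_unit: "ell2_nth (ell2_unit i) j = (if j = i then 1 else 0)"
proof -
  have "summable (\<lambda>j. (cmod (if j = i then 1 else 0))\<^sup>2)"
    by (rule summable_finite[of "{i}"]) auto
  then show ?thesis by (simp add: ell2_unit_def Abs_ell2_inverse)
qed

lemma cinner_ell2_unit: "cinner x (ell2_unit i) = ell2_nth x i"
proof -
  have "(\<Sum>j. ell2_nth x j * cnj (ell2_nth (ell2_unit i) j)) =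
      (\<Sum>j\<in>{i}. ell2_nth x j * cnj (ell2_nth (ell2_unit i) j))"
    by (rule suminf_finite) (auto simp: ell2_nth_unit)
  then show ?thesis by (simp add: cinner_ell2.rep_eq ell2_nth_unit)
qed

text \<open>\<open>V\<close> is a partial isometry with adjoint \<open>V'\<close>, whose initial space contains \<open>F\<close>.\<close>

lemma ell2_embedding:
  fixes F :: "'a::complex_inner set"
  assumes "finite F"
  obtains V :: "'a \<Rightarrow> ell2" and V' :: "ell2 \<Rightarrow> 'a" where
    "bounded_linear V" "bounded_linear V'"
    "\<And>c x. V (c *\<^sub>C x) = c *\<^sub>C V x" "\<And>c x. V' (c *\<^sub>C x) = c *\<^sub>C V' x"
    "\<And>x y. inner (V x) y = inner x (V' y)"
    "\<And>x. norm (V x) \<le> norm x" "\<And>y. norm (V' y) \<le> norm y"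
    "\<And>v. v \<in> F \<Longrightarrow> V' (V v) = v"
proof -
  obtain d :: nat and e where
    on: "\<And>i j. i < d \<Longrightarrow> j < d \<Longrightarrow> cinner (e i) (e j) = (if i = j then 1 else 0)" and
    sp: "\<And>v. v \<in> F \<Longrightarrow> v = (\<Sum>i<d. cinner v (e i) *\<^sub>C e i)"
    using orthonormal_spanning[OF assms] by blast
  define V where "V x = (\<Sum>i<d. cinner x (e i) *\<^sub>C ell2_unit i)" for x
  define V' where "V' y = (\<Sum>i<d. ell2_nth y i *\<^sub>C e i)" for y
  have linV: "bounded_linear V" "bounded_linear V'"
    unfolding V_def[abs_def] V'_def[abs_def] cinner_ell2_unit[symmetric]
    by (intro bounded_linear_sum bounded_linear_cinner_scaleC)+
  have sc: "V (c *\<^sub>C x) = c *\<^sub>C V x" "V' (c *\<^sub>C y) = c *\<^sub>C V' y" for c x y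
    by (simp_all add: V_def V'_def scaleC_sum cinner_scaleC_left scaleC_ell2.rep_eq scaleC_scaleC)
  have adj: "inner (V x) y = inner x (V' y)" for x y
  proof -
    have "inner (V x) y = (\<Sum>i<d. Re (cinner x (e i) * cnj (ell2_nth y i)))"
      unfolding V_def inner_eq_Re_cinner cinner_sum_left cinner_scaleC_left Re_sum
      by (simp add: cinner_commute[of "ell2_unit _" y] cinner_ell2_unit)
    also have "\<dots> = inner x (V' y)"
      unfolding V'_def inner_sum_right
      by (simp add: inner_eq_Re_cinner cinner_scaleC_right mult.commute)
    finally show ?thesis .
  qed
  have id: "V' (V v) = (\<Sum>i<d. cinner v (e i) *\<^sub>C e i)" for v
  proof -
    have "cinner (V v) (ell2_unit i) = cinner v (e i)" if "i < d" for i
      using that unfolding V_def cinner_sum_left cinner_scaleC_left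
      by (simp add: cinner_ell2_unit ell2_nth_unit
          if_distrib[of "\<lambda>x. _ * x"] cong: if_cong)
    then have "ell2_nth (V v) i = cinner v (e i)" if "i < d" for i
      using that by (simp add: cinner_ell2_unit)
    then show ?thesis by (simp add: V'_def)
  qed
  have ide: "V' (V (e i)) = e i" if "i < d" for i
  proof -
    have "V' (V (e i)) = (\<Sum>j<d. if j = i then e i else 0)"
      unfolding id using that on
      by (intro sum.cong) (auto simp: scaleC_of_real[of 0, simplified])
    then show ?thesis using that by simp
  qed
  \<comment> \<open>Hence V V' is a projection, and Cauchy-Schwarz makes V' a contraction.\<close>
  have proj: "V' (V (V' y)) = V' y" for y
    using ide by (simp add: V'_def[of y] linear_sum[OF bounded_linear.linear[OF linV(1)]]
        linear_sum[OF bounded_linear.linear[OF linV(2)]] sc)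
  have nV': "norm (V' y) \<le> norm y" for y
  proof -
    have sq: "(norm (V (V' y)))\<^sup>2 = (norm (V' y))\<^sup>2"
      by (simp add: power2_norm_eq_inner adj proj)
    then have "norm (V (V' y)) = norm (V' y)" by simp
    moreover have "(norm (V' y))\<^sup>2 = inner (V (V' y)) y"
      by (simp add: adj power2_norm_eq_inner)
    ultimately have "(norm (V' y))\<^sup>2 \<le> norm (V' y) * norm y"
      using Cauchy_Schwarz_ineq2[of "V (V' y)" y] by simp
    then show ?thesis by (cases "V' y = 0") (auto simp: power2_eq_square)
  qed
  have nV: "norm (V x) \<le> norm x" for x
  proof -
    have "(norm (V x))\<^sup>2 = inner x (V' (V x))"
      by (simp add: adj power2_norm_eq_inner)
    also have "\<dots> \<le> norm x * norm (V' (V x))"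
      using Cauchy_Schwarz_ineq2[of x "V' (V x)"] by simp
    also have "\<dots> \<le> norm x * norm (V x)" by (intro mult_left_mono nV') simp
    finally show ?thesis by (cases "V x = 0") (auto simp: power2_eq_square)
  qed
  show ?thesis
    by (rule that[OF linV sc adj nV nV']) (use id sp in metis)
qed

section \<open>Operator monotonicity on arbitrary Hilbert spaces\<close>

lemma operator_monotone_continuous: "operator_monotone f \<Longrightarrow> continuous_on {0..} f"
  by (simp add: operator_monotone_def)

text \<open>The operators are compressed to C T = V T V' on the sequence space, which preserves
  order and positivity and does not increase norms. Powers of C T follow those of T at x only up to
  the degree of p, so p is fixed before the embedding is chosen.\<close>

lemma operator_monotone_transfer:
  fixes A B :: "'h::complex_hilbert \<Rightarrow>\<^sub>L 'h"
  assumes mono: "operator_monotone f" and A: "positive_op A" and B: "positive_op B" and AB: "A \<sqsubseteq> B"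
  shows "fun_op f A \<sqsubseteq> fun_op f B"
proof -
  note f = operator_monotone_continuous[OF mono]
  have "inner (fun_op f A x) x \<le> inner (fun_op f B x) x" for x
  proof (rule field_le_epsilon)
    fix e :: real assume e: "0 < e"
    define n where "n = (norm x)\<^sup>2 + 1"
    have n: "0 < n" by (simp add: n_def add_nonneg_pos)
    \<comment> \<open>Four errors occur: f is replaced by p at A, at B and at both
      compressions.\<close>
    define \<delta> where "\<delta> = e / (4 * n)"
    have d: "0 < \<delta>" using e n by (simp add: \<delta>_def)
    have "4 * (\<delta> * n) = e" using n by (simp add: \<delta>_def)
    then have dx: "4 * (\<delta> * (norm x)\<^sup>2) \<le> e" using d by (simp add: n_def distrib_left)
    define b where "b = max (norm A) (norm B)"
    obtain p where p: "\<And>t. 0 \<le> t \<Longrightarrow> t \<le> b \<Longrightarrow> \<bar>poly p t - f t\<bar> \<le> \<delta>"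
      by (rule poly_approx[OF f d, where b = b]) blast
    have approx: "\<bar>inner (poly_op p T y) y - inner (fun_op f T y) y\<bar> \<le> \<delta> * (norm y)\<^sup>2"
      if "positive_op T" "norm T \<le> b" for T :: "'b::complex_hilbert \<Rightarrow>\<^sub>L 'b" and y
    proof -
      have "\<bar>inner ((poly_op p T - fun_op f T) y) y\<bar> \<le> norm (poly_op p T - fun_op f T) * (norm y)\<^sup>2"
        by (rule abs_inner_blinfun_le)
      also have "\<dots> \<le> \<delta> * (norm y)\<^sup>2"
        by (intro mult_right_mono fun_op_approx[OF that f p]) auto
      finally show ?thesis by (simp add: blinfun.diff_left inner_diff_left)
    qed
    \<comment> \<open>The vectors through which p(A) x and p(B) x are computed; the power 0 puts x
      itself into F.\<close>
    define F where "F = (\<lambda>k. ((o\<^sub>L) A ^^ k) id_blinfun x) ` {..degree p} \<union>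
      (\<lambda>k. ((o\<^sub>L) B ^^ k) id_blinfun x) ` {..degree p}"
    have "finite F" by (simp add: F_def)
    then obtain V :: "'h \<Rightarrow> ell2" and V' where V: "bounded_linear V" "bounded_linear V'"
      and sc: "\<And>c x. V (c *\<^sub>C x) = c *\<^sub>C V x" "\<And>c x. V' (c *\<^sub>C x) = c *\<^sub>C V' x"
      and adj: "\<And>x y. inner (V x) y = inner x (V' y)"
      and nV: "\<And>x. norm (V x) \<le> norm x" "\<And>y. norm (V' y) \<le> norm y"
      and id: "\<And>v. v \<in> F \<Longrightarrow> V' (V v) = v"
      using ell2_embedding[OF \<open>finite F\<close>] by blast
    define C where "C T = Blinfun (\<lambda>y. V (blinfun_apply T (V' y)))" for T :: "'h \<Rightarrow>\<^sub>L 'h"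
    have C: "C T y = V (T (V' y))" for T y
      unfolding C_def by (subst bounded_linear_Blinfun_apply)
        (auto intro!: bounded_linear_compose[OF V(1)] bounded_linear_compose[OF _ V(2)]
          blinfun.bounded_linear_right)
    have selfC: "selfadj (C T)" if "selfadj T" for T
      using that by (auto simp: selfadj_def B_H_def C sc adj inner_commute)
        (metis adj inner_commute)
    have posC: "positive_op (C T)" if "positive_op T" for T
      using that selfC by (simp add: positive_op_iff C adj)
    have normC: "norm (C T) \<le> norm T" for T
    proof (rule norm_blinfun_bound)
      fix y
      have "norm (C T y) \<le> norm (T (V' y))" unfolding C by (rule nV)
      also have "\<dots> \<le> norm T * norm (V' y)" by (rule norm_blinfun)
      also have "\<dots> \<le> norm T * norm y" by (intro mult_left_mono nV) simp
      finally show "norm (C T y) \<le> norm T * norm y" .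
    qed simp
    have polyC: "inner (poly_op p (C T) (V x)) (V x) = inner (poly_op p T x) x"
      if "\<And>k. k \<le> degree p \<Longrightarrow> ((o\<^sub>L) T ^^ k) id_blinfun x \<in> F" for T
    proof -
      \<comment> \<open>V' V fixes T^k x, which lies in F, so V T V' sends its image to V T^(k+1)
        x.\<close>
      have pow: "((o\<^sub>L) (C T) ^^ k) id_blinfun (V x) = V (((o\<^sub>L) T ^^ k) id_blinfun x)"
        if "k \<le> degree p" for k
        using that
      proof (induction k)
        case (Suc k)
        then show ?case using id[OF \<open>\<And>k. k \<le> degree p \<Longrightarrow> _ k \<in> F\<close>[of k]] by (simp add: C)
      qed simp
      have "poly_op p (C T) (V x) = V (poly_op p T x)"
        by (simp add: poly_op_def blinfun.sum_left blinfun.scaleR_left pow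
            linear_sum[OF bounded_linear.linear[OF V(1)]] linear_simps[OF V(1)])
      moreover have "V' (V x) = x"
        using id that[of 0] by simp
      ultimately show ?thesis by (simp add: adj)
    qed
    have "C A \<sqsubseteq> C B"
      using loewner_leD[OF AB]
      by (simp add: loewner_le_iff selfC positive_selfadj A B C adj)
    then have "fun_op f (C A) \<sqsubseteq> fun_op f (C B)"
      using mono posC[OF A] posC[OF B] unfolding operator_monotone_def by blast
    from loewner_leD[OF this, of "V x"]
    have main: "inner (fun_op f (C A) (V x)) (V x) \<le> inner (fun_op f (C B) (V x)) (V x)" .
    have "\<delta> * (norm (V x))\<^sup>2 \<le> \<delta> * (norm x)\<^sup>2"
      using d nV by (intro mult_left_mono power_mono) auto
    moreover have "norm A \<le> b" "norm B \<le> b" "norm (C A) \<le> b" "norm (C B) \<le> b"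
      using normC[of A] normC[of B] by (auto simp: b_def)
    moreover have "inner (poly_op p (C A) (V x)) (V x) = inner (poly_op p A x) x"
      "inner (poly_op p (C B) (V x)) (V x) = inner (poly_op p B x) x"
      by (rule polyC; simp add: F_def)+
    ultimately show "inner (fun_op f A x) x \<le> inner (fun_op f B x) x + e"
      using main dx approx[OF A, of x] approx[OF B, of x] approx[OF posC[OF A], of "V x"]
        approx[OF posC[OF B], of "V x"]
      by (simp add: abs_le_iff)
  qed
  then show ?thesis by (simp add: loewner_le_iff selfadj_fun_op A B f)
qed

section \<open>Monotonicity of operator means\<close>

instantiation prod :: (complex_inner, complex_inner) complex_inner
begin

definition scaleC_prod :: "complex \<Rightarrow> 'a \<times> 'b \<Rightarrow> 'a \<times> 'b" where
  "a *\<^sub>C x = (a *\<^sub>C fst x, a *\<^sub>C snd x)"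
definition cinner_prod :: "'a \<times> 'b \<Rightarrow> 'a \<times> 'b \<Rightarrow> complex" where
  "cinner x y = cinner (fst x) (fst y) + cinner (snd x) (snd y)"

instance
proof
  fix x y z :: "'a \<times> 'b" and a b :: complex and r :: real
  show "a *\<^sub>C (x + y) = a *\<^sub>C x + a *\<^sub>C y" "(a + b) *\<^sub>C x = a *\<^sub>C x + b *\<^sub>C x"
    "a *\<^sub>C b *\<^sub>C x = (a * b) *\<^sub>C x" "complex_of_real r *\<^sub>C x = r *\<^sub>R x"
    by (simp_all add: scaleC_prod_def scaleC_add_right scaleC_add_left scaleC_scaleC
        scaleC_of_real scaleR_prod_def)
  show "cinner x y = cnj (cinner y x)"
    by (simp add: cinner_prod_def flip: cinner_commute)
  show "cinner (x + y) z = cinner x z + cinner y z" "cinner (a *\<^sub>C x) y = a * cinner x y"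
    by (simp_all add: cinner_prod_def scaleC_prod_def cinner_add_left cinner_scaleC_left
        distrib_left)
  show "inner x y = Re (cinner x y)"
    by (simp add: cinner_prod_def inner_prod_def inner_eq_Re_cinner)
qed

end

instance prod :: (complex_hilbert, complex_hilbert) complex_hilbert ..

text \<open>Hansen's inequality, in the form of a compression. With \<open>P = W W'\<close> one has
  \<open>T \<le> (1 + \<epsilon>) P T P + (1 + 1/\<epsilon>) \<parallel>T\<parallel> (1 - P)\<close>, and the range of \<open>W\<close> reduces the right-hand side.\<close>

lemma operator_monotone_compression:
  fixes T :: "'k::complex_hilbert \<Rightarrow>\<^sub>L 'k" and B :: "'h::complex_hilbert \<Rightarrow>\<^sub>L 'h"
    and W :: "'h \<Rightarrow> 'k" and W' :: "'k \<Rightarrow> 'h"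
  assumes mono: "operator_monotone f" and T: "positive_op T" and B: "selfadj B"
    and W: "bounded_linear W" "bounded_linear W'"
    and sc: "\<And>c x. W (c *\<^sub>C x) = c *\<^sub>C W x" "\<And>c x. W' (c *\<^sub>C x) = c *\<^sub>C W' x"
    and adj: "\<And>x y. inner (W x) y = inner x (W' y)"
    and isom: "\<And>x. W' (W x) = x" and TB: "\<And>x. W' (T (W x)) = B x"
  shows "inner (fun_op f T (W x)) (W x) \<le> inner (fun_op f B x) x"
proof -
  note f = operator_monotone_continuous[OF mono]
  have BT: "inner (B x) y = inner (T (W x)) (W y)" for x y
    by (metis TB adj inner_commute)
  have pB: "positive_op B"
    using B T by (simp add: positive_op_iff BT)
  define \<epsilon> where "\<epsilon> k = inverse (real (Suc k))" for k
  have e: "0 < \<epsilon> k" for k by (simp add: \<epsilon>_def)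
  \<comment> \<open>K grows without bound as \<epsilon> tends to 0, which is harmless: the block it
    multiplies is not seen from the range of W.\<close>
  define K where "K k = (1 + 1 / \<epsilon> k) * norm T" for k
  have le: "inner (fun_op f T (W x)) (W x) \<le> inner (fun_op f ((1 + \<epsilon> k) *\<^sub>R B) x) x" for k
  proof -
    define S where "S = Blinfun (\<lambda>y. (1 + \<epsilon> k) *\<^sub>R W (B (W' y)) + K k *\<^sub>R (y - W (W' y)))"
    have S: "S y = (1 + \<epsilon> k) *\<^sub>R W (B (W' y)) + K k *\<^sub>R (y - W (W' y))" for y
      unfolding S_def
      by (subst bounded_linear_Blinfun_apply)
         (auto intro!: bounded_linear_add bounded_linear_sub bounded_linear_ident
           bounded_linear_compose[OF bounded_linear_scaleR_right]
           bounded_linear_compose[OF W(1)] bounded_linear_compose[OF blinfun.bounded_linear_right] W(2))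
    have selfS: "selfadj S"
      using B unfolding selfadj_def B_H_def
      by (auto simp: S sc scaleC_add_right scaleC_diff_right scaleC_scaleR inner_add_left
          inner_add_right inner_diff_left inner_diff_right adj)
         (metis adj inner_commute)
    have TS: "inner (T y) y \<le> inner (S y) y" for y
    proof -
      define u where "u = W (W' y)"
      define v where "v = y - u"
      have y: "y = u + v" by (simp add: v_def)
      \<comment> \<open>Positivity at this vector is Young's inequality for the cross term, with
        weight \<epsilon>.\<close>
      have "0 \<le> inner (T (\<epsilon> k *\<^sub>R u - v)) (\<epsilon> k *\<^sub>R u - v)"
        using T by (simp add: positive_op_iff)
      also have "\<dots> = (\<epsilon> k)\<^sup>2 * inner (T u) u - 2 * \<epsilon> k * inner (T u) v + inner (T v) v"
        using selfadj_commute[OF positive_selfadj[OF T], of u v]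
        by (simp add: blinfun.diff_right blinfun.scaleR_right inner_diff_left inner_diff_right
            power2_eq_square algebra_simps)
      finally have "2 * inner (T u) v \<le> \<epsilon> k * inner (T u) u + inner (T v) v / \<epsilon> k"
        using e[of k] by (simp add: field_simps power2_eq_square)
      then have "inner (T y) y \<le> (1 + \<epsilon> k) * inner (T u) u + (1 + 1 / \<epsilon> k) * inner (T v) v"
        using selfadj_commute[OF positive_selfadj[OF T], of u v]
        by (simp add: y blinfun.add_right inner_add_left inner_add_right algebra_simps)
      also have "inner (T v) v \<le> norm T * (norm v)\<^sup>2"
        using abs_inner_blinfun_le[of T v] by simp
      also have "(norm v)\<^sup>2 = inner v y"
        by (simp add: power2_norm_eq_inner v_def u_def inner_diff_left inner_diff_right adj isom)
           (metis adj inner_commute)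
      also have "inner (T u) u = inner (W (B (W' y))) y"
        by (simp add: u_def adj BT)
      finally show ?thesis
        using e[of k]
        by (simp add: S inner_add_left mult_left_mono K_def v_def u_def mult.assoc)
    qed
    have pS: "positive_op S"
      using selfS TS T by (auto simp: positive_op_iff intro: order_trans)
    have "T \<sqsubseteq> S"
      using TS by (simp add: loewner_le_iff positive_selfadj T selfS)
    then have "fun_op f T \<sqsubseteq> fun_op f S"
      by (rule operator_monotone_transfer[OF mono T pS])
    then have "inner (fun_op f T (W x)) (W x) \<le> inner (fun_op f S (W x)) (W x)"
      by (rule loewner_leD)
    \<comment> \<open>S maps W z to W ((1 + \<epsilon>) B z), so f(S) acts on the range of W through
      the scaled B.\<close>
    also have "fun_op f S (W x) = W (fun_op f ((1 + \<epsilon> k) *\<^sub>R B) x)"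
    proof (rule fun_op_intertwine[OF pS positive_op_scaleR[OF pB] f _ W(1)])
      show "S (W z) = W (((1 + \<epsilon> k) *\<^sub>R B) z)" for z
        by (simp add: S isom blinfun.scaleR_left linear_simps[OF W(1)])
    qed (use e[of k] in simp)
    also have "inner \<dots> (W x) = inner (fun_op f ((1 + \<epsilon> k) *\<^sub>R B) x) x"
      by (simp add: adj isom)
    finally show ?thesis .
  qed
  have e0: "\<epsilon> \<longlonglongrightarrow> 0"
    unfolding \<epsilon>_def[abs_def] by (rule LIMSEQ_inverse_real_of_nat)
  \<comment> \<open>The factor 1 + \<epsilon> is removed by continuity of the functional
    calculus.\<close>
  have "sot_tendsto (\<lambda>k. fun_op f ((1 + \<epsilon> k) *\<^sub>R B)) (fun_op f B)"
  proof (rule sot_tendsto_fun_op[OF f _ _ pB, where b = "2 * norm B"])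
    show "positive_op ((1 + \<epsilon> k) *\<^sub>R B)" for k
      using e[of k] by (intro positive_op_scaleR[OF pB]) simp
    have "\<epsilon> k \<le> 1" for k by (simp add: \<epsilon>_def field_simps)
    then show "norm ((1 + \<epsilon> k) *\<^sub>R B) \<le> 2 * norm B" for k
      using e[of k] by (auto intro!: mult_right_mono)
    have "(\<lambda>k. (1 + \<epsilon> k) *\<^sub>R B) \<longlonglongrightarrow> (1 + 0) *\<^sub>R B"
      by (intro tendsto_intros e0)
    then show "sot_tendsto (\<lambda>k. (1 + \<epsilon> k) *\<^sub>R B) B"
      by (intro tendsto_imp_sot_tendsto) simp
  qed
  then have "(\<lambda>k. inner (fun_op f ((1 + \<epsilon> k) *\<^sub>R B) x) x) \<longlonglongrightarrow> inner (fun_op f B x) x"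
    unfolding sot_tendsto_def by (intro tendsto_inner tendsto_const) auto
  then show ?thesis
    by (rule LIMSEQ_le_const) (use le in auto)
qed

lemma inner_op_mean:
  fixes X :: "'h::complex_hilbert \<Rightarrow>\<^sub>L 'h"
  assumes "X \<in> PP"
  shows "inner (op_mean f X A z) z =
    inner (fun_op f (inverse_op (sqrt_op X) o\<^sub>L A o\<^sub>L inverse_op (sqrt_op X)) (sqrt_op X z)) (sqrt_op X z)"
  using selfadjD[OF PP_selfadj[OF sqrt_op_PP[OF assms]]] by (simp add: op_mean_def)

lemma selfadj_op_mean:
  fixes X :: "'h::complex_hilbert \<Rightarrow>\<^sub>L 'h"
  assumes "continuous_on {0..} f" "X \<in> PP" "A \<in> PP"
  shows "selfadj (op_mean f X A)"
  unfolding op_mean_def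
  by (intro selfadj_conj PP_selfadj[OF sqrt_op_PP] selfadj_fun_op PP_positive[OF inverse_sqrt_op_conj]
      assms)

text \<open>Since X + (Y - X) = Y, the column W = (X^(1/2) Y^(-1/2), (Y - X)^(1/2) Y^(-1/2)) is an
  isometry. It compresses T = D \<oplus> 0 to E, where D and E are A conjugated by X^(-1/2) and
  Y^(-1/2). The compression inequality at Y^(1/2) z is the claim, up to the nonnegative contribution
  of the zero block.\<close>

lemma op_mean_mono_left:
  fixes X Y A :: "'h::complex_hilbert \<Rightarrow>\<^sub>L 'h"
  assumes mono: "operator_monotone f" and f0: "0 \<le> f 0"
    and X: "X \<in> PP" and Y: "Y \<in> PP" and A: "A \<in> PP" and XY: "X \<sqsubseteq> Y"
  shows "op_mean f X A \<sqsubseteq> op_mean f Y A"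
proof -
  note f = operator_monotone_continuous[OF mono]
  define sX sY sR where "sX = sqrt_op X" and "sY = sqrt_op Y" and "sR = sqrt_op (Y - X)"
  define D where "D = inverse_op sX o\<^sub>L A o\<^sub>L inverse_op sX"
  define E where "E = inverse_op sY o\<^sub>L A o\<^sub>L inverse_op sY"
  have R: "positive_op (Y - X)" using XY by (simp add: loewner_le_def)
  have sX: "sX \<in> PP" and sY: "sY \<in> PP" and sR: "positive_op sR"
    unfolding sX_def sY_def sR_def by (intro sqrt_op_PP X Y positive_sqrt_op R)+
  have D: "D \<in> PP" and E: "E \<in> PP"
    unfolding D_def E_def sX_def sY_def by (intro inverse_sqrt_op_conj X Y A)+
  have sym: "inner (sX a) b = inner a (sX b)" "inner (sR a) b = inner a (sR b)"
    "inner (inverse_op sY a) b = inner a (inverse_op sY b)" for a b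
    by (rule selfadjD PP_selfadj sX positive_selfadj sR selfadj_inverse_op sY)+
  have BH: "sX (c *\<^sub>C a) = c *\<^sub>C sX a" "sR (c *\<^sub>C a) = c *\<^sub>C sR a" "D (c *\<^sub>C a) = c *\<^sub>C D a"
    "inverse_op sY (c *\<^sub>C a) = c *\<^sub>C inverse_op sY a" for c a
    using PP_selfadj[OF sX] positive_selfadj[OF sR] PP_selfadj[OF D] selfadj_inverse_op[OF sY]
    by (auto simp: selfadj_def B_HD)
  define W where "W y = (sX (inverse_op sY y), sR (inverse_op sY y))" for y
  define W' where "W' z = inverse_op sY (sX (fst z) + sR (snd z))" for z
  define T where "T = Blinfun (\<lambda>z :: 'h \<times> 'h. (D (fst z), 0 :: 'h))"
  have T: "T z = (D (fst z), 0)" for z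
    unfolding T_def
    by (subst bounded_linear_Blinfun_apply)
       (auto intro!: bounded_linear_Pair bounded_linear_zero
         bounded_linear_compose[OF blinfun.bounded_linear_right bounded_linear_fst])
  have pT: "positive_op T"
    using PP_positive[OF D]
    by (auto simp: positive_op_iff selfadj_def B_H_def T scaleC_prod_def inner_prod_def)
  have sq: "sX (sX x) + sR (sR x) = sY (sY x)" for x
    by (simp add: sX_def sY_def sR_def sqrt_op_square PP_positive X Y R blinfun.diff_left)
  have W: "inner (fun_op f T (W y)) (W y) \<le> inner (fun_op f E y) y" for y
  proof (rule operator_monotone_compression[OF mono pT PP_selfadj[OF E], of W W'])
    show "bounded_linear W" unfolding W_def[abs_def]
      by (intro bounded_linear_Pair bounded_linear_compose[OF blinfun.bounded_linear_right]
          blinfun.bounded_linear_right)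
    show "bounded_linear W'" unfolding W'_def[abs_def]
      by (intro bounded_linear_compose[OF blinfun.bounded_linear_right] bounded_linear_add
          bounded_linear_fst bounded_linear_snd)
    show "W (c *\<^sub>C x) = c *\<^sub>C W x" "W' (c *\<^sub>C z) = c *\<^sub>C W' z" for c x z
      by (simp_all add: W_def W'_def scaleC_prod_def BH flip: scaleC_add_right)
    show "inner (W x) z = inner x (W' z)" for x z
      by (simp add: W_def W'_def inner_prod_def sym inner_add_right blinfun.add_right)
    show "W' (W x) = x" for x
      using sY by (simp add: W_def W'_def sq)
    show "W' (T (W x)) = E x" for x
      using sX by (simp add: W_def W'_def T D_def E_def)
  qed
  \<comment> \<open>f(T) = f(D) \<oplus> f(0) I, and the second block contributes f(0) (norm b)^2,
    which is dropped.\<close>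
  have fT: "inner (fun_op f D a) a \<le> inner (fun_op f T (a, b)) (a, b)" for a b
  proof -
    have "fun_op f T (a, 0) = (fun_op f D a, 0)"
      by (rule fun_op_intertwine[OF pT PP_positive[OF D] f, of "\<lambda>a. (a, 0)"])
         (auto simp: T intro!: bounded_linear_Pair bounded_linear_ident bounded_linear_zero)
    moreover have "fun_op f T (0, b) = f 0 *\<^sub>R (0, b)"
      by (rule fun_op_eigen[OF pT f]) (simp_all add: T zero_prod_def)
    ultimately have "fun_op f T ((a, 0) + (0, b)) = (fun_op f D a, f 0 *\<^sub>R b)"
      unfolding blinfun.add_right by simp
    then show ?thesis using f0 by simp
  qed
  have "inner (op_mean f X A z) z \<le> inner (op_mean f Y A z) z" for z
  proof -
    have "W (sY z) = (sX z, sR z)" using sY by (simp add: W_def)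
    then have "inner (fun_op f D (sX z)) (sX z) \<le> inner (fun_op f E (sY z)) (sY z)"
      using fT[of "sX z" "sR z"] W[of "sY z"] by simp
    then show ?thesis
      unfolding inner_op_mean[OF X] inner_op_mean[OF Y] by (simp add: sX_def sY_def D_def E_def)
  qed
  then show ?thesis
    by (simp add: loewner_le_iff selfadj_op_mean f X Y A)
qed

section \<open>Strict monotonicity of representing functions\<close>

lemma two_level_operator:
  fixes p q :: "'a::complex_inner"
  assumes on: "cinner p p = 1" "cinner q q = 1" "cinner p q = 0" and uv: "0 \<le> u" "0 \<le> v"
  obtains T :: "'a \<Rightarrow>\<^sub>L 'a" where "positive_op T" "T p = u *\<^sub>R p" "T q = v *\<^sub>R q"
    "\<And>y. inner (T y) y = u * (cmod (cinner y p))\<^sup>2 + v * (cmod (cinner y q))\<^sup>2"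
proof -
  define T where "T = Blinfun (\<lambda>y. u *\<^sub>R cinner y p *\<^sub>C p + v *\<^sub>R cinner y q *\<^sub>C q)"
  have T: "T y = u *\<^sub>R cinner y p *\<^sub>C p + v *\<^sub>R cinner y q *\<^sub>C q" for y
    unfolding T_def
    by (subst bounded_linear_Blinfun_apply)
       (auto intro!: bounded_linear_add bounded_linear_cinner_scaleC
         bounded_linear_compose[OF bounded_linear_scaleR_right])
  have form: "inner (T y) z = u * Re (cinner y p * cnj (cinner z p))
      + v * Re (cinner y q * cnj (cinner z q))" for y z
    unfolding T inner_add_left inner_scaleR_left
    unfolding inner_eq_Re_cinner cinner_scaleC_left
    by (simp add: cinner_commute[of p z] cinner_commute[of q z])
  have sym: "inner (T y) z = inner y (T z)" for y z
    by (subst inner_commute[of y "T z"]) (simp add: form mult.commute)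
  have sq: "inner (T y) y = u * (cmod (cinner y p))\<^sup>2 + v * (cmod (cinner y q))\<^sup>2" for y
    by (simp only: form complex_norm_square[symmetric] Re_complex_of_real)
  have "T \<in> B_H"
    by (simp add: B_H_def T cinner_scaleC_left scaleC_add_right scaleC_scaleR scaleC_scaleC)
  then have "positive_op T"
    using sym sq uv by (simp add: positive_op_iff selfadj_def)
  moreover have "cinner q p = 0"
    using on(3) by (metis cinner_commute complex_cnj_zero)
  ultimately show ?thesis
    using on sq by (intro that[of T]) (simp_all add: T)
qed

text \<open>The right-hand sides are the diagonal entries, less the modulus of the off-diagonal
  entry, of an operator with eigenvalues \<kappa>, \<mu> in a basis rotated by \<theta>. They tend
  to \<kappa> and \<mu> as \<theta> tends to 0, so a small positive angle works; it is taken below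
  pi to have s \<noteq> 0.\<close>

lemma rotated_levels_dominate:
  fixes u v \<kappa> \<mu> :: real
  assumes "u < \<kappa>" "v < \<mu>"
  obtains c s :: real where "c\<^sup>2 + s\<^sup>2 = 1" "s \<noteq> 0"
    "u \<le> \<kappa> * c\<^sup>2 + \<mu> * s\<^sup>2 - \<bar>c * s * (\<kappa> - \<mu>)\<bar>" "v \<le> \<kappa> * s\<^sup>2 + \<mu> * c\<^sup>2 - \<bar>c * s * (\<kappa> - \<mu>)\<bar>"
proof -
  have "((\<lambda>\<theta>. \<kappa> * (cos \<theta>)\<^sup>2 + \<mu> * (sin \<theta>)\<^sup>2 - \<bar>cos \<theta> * sin \<theta> * (\<kappa> - \<mu>)\<bar>) \<longlongrightarrow> \<kappa>) (at_right 0)"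
    by (auto intro!: tendsto_eq_intros)
  then have 1: "\<forall>\<^sub>F \<theta> in at_right 0. u < \<kappa> * (cos \<theta>)\<^sup>2 + \<mu> * (sin \<theta>)\<^sup>2 - \<bar>cos \<theta> * sin \<theta> * (\<kappa> - \<mu>)\<bar>"
    using assms(1) by (rule order_tendstoD)
  have "((\<lambda>\<theta>. \<kappa> * (sin \<theta>)\<^sup>2 + \<mu> * (cos \<theta>)\<^sup>2 - \<bar>cos \<theta> * sin \<theta> * (\<kappa> - \<mu>)\<bar>) \<longlongrightarrow> \<mu>) (at_right 0)"
    by (auto intro!: tendsto_eq_intros)
  then have 2: "\<forall>\<^sub>F \<theta> in at_right 0. v < \<kappa> * (sin \<theta>)\<^sup>2 + \<mu> * (cos \<theta>)\<^sup>2 - \<bar>cos \<theta> * sin \<theta> * (\<kappa> - \<mu>)\<bar>"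
    using assms(2) by (rule order_tendstoD)
  have 3: "\<forall>\<^sub>F \<theta> :: real in at_right 0. 0 < \<theta> \<and> \<theta> < pi"
    unfolding eventually_at_right_field using pi_gt_zero by blast
  obtain \<theta> where t: "0 < \<theta>" "\<theta> < pi"
    "u < \<kappa> * (cos \<theta>)\<^sup>2 + \<mu> * (sin \<theta>)\<^sup>2 - \<bar>cos \<theta> * sin \<theta> * (\<kappa> - \<mu>)\<bar>"
    "v < \<kappa> * (sin \<theta>)\<^sup>2 + \<mu> * (cos \<theta>)\<^sup>2 - \<bar>cos \<theta> * sin \<theta> * (\<kappa> - \<mu>)\<bar>"
    using eventually_happens'[OF _ eventually_conj[OF 1 eventually_conj[OF 2 3]]] by auto
  then show ?thesis
    using sin_gt_zero[of \<theta>] by (intro that[of "cos \<theta>" "sin \<theta>"]) auto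
qed

text \<open>Comparison of an operator with eigenvalues \<open>u, v\<close> and one with eigenvalues \<open>\<kappa>, \<mu>\<close> whose
  eigenvectors are slightly rotated against those of the first.\<close>

lemma operator_monotone_two_level:
  assumes mono: "operator_monotone f" and uv: "0 \<le> u" "u < \<kappa>" "0 \<le> v" "v < \<mu>"
  obtains c s :: real where "c\<^sup>2 + s\<^sup>2 = 1" "s \<noteq> 0"
    "f v \<le> s\<^sup>2 * f \<kappa> + c\<^sup>2 * f \<mu>" "c\<^sup>2 * f u + s\<^sup>2 * f v \<le> f \<kappa>"
proof -
  note f = operator_monotone_continuous[OF mono]
  obtain c s :: real where cs: "c\<^sup>2 + s\<^sup>2 = 1" "s \<noteq> 0"
    "u \<le> \<kappa> * c\<^sup>2 + \<mu> * s\<^sup>2 - \<bar>c * s * (\<kappa> - \<mu>)\<bar>" "v \<le> \<kappa> * s\<^sup>2 + \<mu> * c\<^sup>2 - \<bar>c * s * (\<kappa> - \<mu>)\<bar>"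
    using rotated_levels_dominate[OF uv(2,4)] by blast
  define p q where "p = ell2_unit 0" and "q = ell2_unit 1"
  define p' q' where "p' = c *\<^sub>R p + s *\<^sub>R q" and "q' = c *\<^sub>R q - s *\<^sub>R p"
  have on: "cinner p p = 1" "cinner q q = 1" "cinner p q = 0" "cinner q p = 0"
    by (simp_all add: p_def q_def cinner_ell2_unit ell2_nth_unit)
  have on_real: "inner p p = 1" "inner q q = 1" "inner p q = 0" "inner q p = 0"
    by (simp_all add: inner_eq_Re_cinner on)
  have right: "cinner y p' = c * cinner y p + s * cinner y q"
    "cinner y q' = c * cinner y q - s * cinner y p" for y
  proof -
    have "q' = complex_of_real c *\<^sub>C q + complex_of_real (- s) *\<^sub>C p"
      unfolding scaleC_of_real by (simp add: q'_def)
    then show "cinner y q' = c * cinner y q - s * cinner y p"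
      by (simp only: cinner_add_right cinner_scaleC_right) simp
    show "cinner y p' = c * cinner y p + s * cinner y q"
      unfolding p'_def scaleC_of_real[symmetric] cinner_add_right cinner_scaleC_right by simp
  qed
  have left: "cinner p' y = c * cinner p y + s * cinner q y"
    "cinner q' y = c * cinner q y - s * cinner p y" for y
    by (subst (1 2 3) cinner_commute, simp add: right)+
  have cs': "complex_of_real c * complex_of_real c + complex_of_real s * complex_of_real s = 1"
    using cs(1) by (simp add: power2_eq_square flip: of_real_mult of_real_add)
  have on': "cinner p' p' = 1" "cinner q' q' = 1" "cinner p' q' = 0"
    using cs' by (simp_all add: right left on)
  obtain A :: "ell2 \<Rightarrow>\<^sub>L ell2" where A: "positive_op A" "A p = u *\<^sub>R p" "A q = v *\<^sub>R q"
    "\<And>y. inner (A y) y = u * (cmod (cinner y p))\<^sup>2 + v * (cmod (cinner y q))\<^sup>2"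
    using two_level_operator[OF on(1-3) uv(1,3)] by blast
  have km: "0 \<le> \<kappa>" "0 \<le> \<mu>" using uv by auto
  obtain B :: "ell2 \<Rightarrow>\<^sub>L ell2" where B: "positive_op B" "B p' = \<kappa> *\<^sub>R p'" "B q' = \<mu> *\<^sub>R q'"
    "\<And>y. inner (B y) y = \<kappa> * (cmod (cinner y p'))\<^sup>2 + \<mu> * (cmod (cinner y q'))\<^sup>2"
    using two_level_operator[OF on' km] by blast
  have AB: "inner (A y) y \<le> inner (B y) y" for y
  proof -
    define a b where "a = cinner y p" and "b = cinner y q"
    \<comment> \<open>Twice the real part of a times the conjugate of b.\<close>
    define R where "R = 2 * (Re a * Re b + Im a * Im b)"
    define x where "x = (cmod a)\<^sup>2"
    define z where "z = (cmod b)\<^sup>2"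
    have R: "\<bar>R\<bar> \<le> x + z"
      using zero_le_power2[of "Re a - Re b"] zero_le_power2[of "Im a - Im b"]
        zero_le_power2[of "Re a + Re b"] zero_le_power2[of "Im a + Im b"]
      unfolding R_def x_def z_def cmod_power2 power2_sum power2_diff by (simp add: abs_le_iff)
    have e1: "(cmod (c * a + s * b))\<^sup>2 = c\<^sup>2 * x + s\<^sup>2 * z + c * s * R"
      unfolding x_def z_def R_def cmod_power2 by (simp add: power2_eq_square algebra_simps)
    have e2: "(cmod (c * b - s * a))\<^sup>2 = c\<^sup>2 * z + s\<^sup>2 * x - c * s * R"
      unfolding x_def z_def R_def cmod_power2 by (simp add: power2_eq_square algebra_simps)
    \<comment> \<open>Diagonal dominance: the off-diagonal term is absorbed by the room left on the
      diagonal in the choice of c and s.\<close>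
    have "\<bar>c * s * (\<kappa> - \<mu>) * R\<bar> \<le> \<bar>c * s * (\<kappa> - \<mu>)\<bar> * (x + z)"
      unfolding abs_mult[of _ R] by (intro mult_left_mono R) simp
    then have "- (\<bar>c * s * (\<kappa> - \<mu>)\<bar> * (x + z)) \<le> c * s * (\<kappa> - \<mu>) * R" by linarith
    moreover have "u * x \<le> (\<kappa> * c\<^sup>2 + \<mu> * s\<^sup>2 - \<bar>c * s * (\<kappa> - \<mu>)\<bar>) * x"
      by (rule mult_right_mono[OF cs(3)]) (simp add: x_def)
    moreover have "v * z \<le> (\<kappa> * s\<^sup>2 + \<mu> * c\<^sup>2 - \<bar>c * s * (\<kappa> - \<mu>)\<bar>) * z"
      by (rule mult_right_mono[OF cs(4)]) (simp add: z_def)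
    ultimately have "u * x + v * z \<le> \<kappa> * (c\<^sup>2 * x + s\<^sup>2 * z + c * s * R)
        + \<mu> * (c\<^sup>2 * z + s\<^sup>2 * x - c * s * R)"
      by (simp add: algebra_simps)
    then show ?thesis
      unfolding A(4) B(4) right a_def[symmetric] b_def[symmetric] e1 e2
      by (simp add: x_def z_def)
  qed
  have "A \<sqsubseteq> B"
    using AB by (simp add: loewner_le_iff positive_selfadj A B)
  then have le: "inner (fun_op f A y) y \<le> inner (fun_op f B y) y" for y
    using mono A(1) B(1) loewner_leD unfolding operator_monotone_def by blast
  have fA: "fun_op f A p = f u *\<^sub>R p" "fun_op f A q = f v *\<^sub>R q"
    by (rule fun_op_eigen[OF A(1) f] A uv)+
  have fB: "fun_op f B p' = f \<kappa> *\<^sub>R p'" "fun_op f B q' = f \<mu> *\<^sub>R q'"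
    by (rule fun_op_eigen[OF B(1) f] B km)+
  \<comment> \<open>The test vectors are q, an eigenvector of A, and p', an eigenvector of B; each
    makes one side of the inequality a single value of f.\<close>
  have "s *\<^sub>R p' + c *\<^sub>R q' = (c\<^sup>2 + s\<^sup>2) *\<^sub>R q"
    by (simp add: p'_def q'_def algebra_simps power2_eq_square)
  then have q: "q = s *\<^sub>R p' + c *\<^sub>R q'" by (simp add: cs(1))
  have iq: "inner p' q = s" "inner q' q = c"
    by (simp_all add: p'_def q'_def inner_add_left inner_diff_left on_real)
  have fBq: "fun_op f B q = (s * f \<kappa>) *\<^sub>R p' + (c * f \<mu>) *\<^sub>R q'"
    by (subst q) (simp add: blinfun.add_right blinfun.scaleR_right fB)
  have "inner (fun_op f B q) q = s\<^sup>2 * f \<kappa> + c\<^sup>2 * f \<mu>"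
    by (simp add: fBq inner_add_left iq power2_eq_square)
  then have 1: "f v \<le> s\<^sup>2 * f \<kappa> + c\<^sup>2 * f \<mu>"
    using le[of q] by (simp add: fA on_real)
  have "inner p' p' = 1" by (simp add: inner_eq_Re_cinner on')
  then have "inner (fun_op f B p') p' = f \<kappa>"
    by (simp add: fB)
  moreover have "inner (fun_op f A p') p' = c\<^sup>2 * f u + s\<^sup>2 * f v"
    by (simp add: p'_def blinfun.add_right blinfun.scaleR_right fA inner_add_left inner_add_right
        on_real power2_eq_square)
  ultimately have 2: "c\<^sup>2 * f u + s\<^sup>2 * f v \<le> f \<kappa>"
    using le[of p'] by simp
  show ?thesis by (rule that[OF cs(1,2) 1 2])
qed

lemma operator_monotone_imp_mono:
  assumes mono: "operator_monotone f" and st: "0 \<le> s" "s \<le> t"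
  shows "f s \<le> f t"
proof -
  note f = operator_monotone_continuous[OF mono]
  define I :: "ell2 \<Rightarrow>\<^sub>L ell2" where "I = id_blinfun"
  have I: "positive_op (r *\<^sub>R I)" if "0 \<le> r" for r
    using that by (intro positive_op_scaleR) (auto simp: I_def positive_op_iff selfadj_id)
  have "s *\<^sub>R I \<sqsubseteq> t *\<^sub>R I"
    using st by (simp add: loewner_le_iff I_def selfadj_scaleR selfadj_id blinfun.scaleR_left
        mult_right_mono)
  then have "fun_op f (s *\<^sub>R I) \<sqsubseteq> fun_op f (t *\<^sub>R I)"
    using mono I[of s] I[of t] st unfolding operator_monotone_def by auto
  from loewner_leD[OF this, of "ell2_unit 0"] show ?thesis
    using fun_op_eigen[OF I f, of s "ell2_unit 0" s] fun_op_eigen[OF I f, of t "ell2_unit 0" t] st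
    by (simp add: I_def blinfun.scaleR_left inner_eq_Re_cinner[of "ell2_unit 0"]
        cinner_ell2_unit ell2_nth_unit)
qed

text \<open>One pair of levels is a < b, and t belongs to the other pair. As f(a) = f(b), the terms
  with weight c^2 combine with the opposite side, leaving f(t) and f(a) both weighted by s^2
  \<noteq> 0.\<close>

lemma operator_monotone_eq_imp_const:
  assumes mono: "operator_monotone f" and ab: "0 \<le> a" "a < b" "f a = f b" and t: "0 < t"
  shows "f t = f a"
proof (rule antisym)
  show "f t \<le> f a"
  proof -
    \<comment> \<open>Levels u = a, \<kappa> = b, v = t; for \<mu> = t + 1 any number above t would
      do.\<close>
    obtain c s where cs: "c\<^sup>2 + s\<^sup>2 = (1::real)" "s \<noteq> 0" "c\<^sup>2 * f a + s\<^sup>2 * f t \<le> f b"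
      using operator_monotone_two_level[OF mono ab(1,2) less_imp_le[OF t] less_add_one] by blast
    have "c\<^sup>2 = 1 - s\<^sup>2" using cs(1) by simp
    with cs(3) ab have "s\<^sup>2 * f t \<le> s\<^sup>2 * f a" by (simp add: algebra_simps)
    then show ?thesis using cs(2) by simp
  qed
  show "f a \<le> f t"
  proof -
    \<comment> \<open>Levels u = 0, \<kappa> = t, v = a, \<mu> = b; this is where t > 0
      enters.\<close>
    obtain c s where cs: "c\<^sup>2 + s\<^sup>2 = (1::real)" "s \<noteq> 0" "f a \<le> s\<^sup>2 * f t + c\<^sup>2 * f b"
      using operator_monotone_two_level[OF mono order_refl t ab(1,2)] by blast
    have "c\<^sup>2 = 1 - s\<^sup>2" using cs(1) by simp
    with cs(3) ab have "s\<^sup>2 * f a \<le> s\<^sup>2 * f t" by (simp add: algebra_simps)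
    then show ?thesis using cs(2) by simp
  qed
qed

lemma representing_function_strict_mono:
  assumes rep: "representing_function f" and nontriv: "\<not> is_left_trivial f"
    and ab: "0 \<le> a" "a < b"
  shows "f a < f b"
proof (rule ccontr)
  assume "\<not> f a < f b"
  have mono: "operator_monotone f" and f1: "f 1 = 1"
    using rep by (auto simp: representing_function_def)
  have "f a = f b"
    using operator_monotone_imp_mono[OF mono, of a b] ab \<open>\<not> f a < f b\<close> by simp
  note const = operator_monotone_eq_imp_const[OF mono ab this]
  have pos: "f t = 1" if "0 < t" for t
    using const[OF that] const[of 1] f1 by simp
  \<comment> \<open>Constancy was obtained for positive arguments; the value at 0 follows by
    continuity.\<close>
  have "(\<lambda>k. f (inverse (real (Suc k)))) \<longlonglongrightarrow> f 0"
    by (rule continuous_on_tendsto_compose[OF operator_monotone_continuous[OF mono]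
          LIMSEQ_inverse_real_of_nat]) auto
  then have "f 0 = 1"
    using pos by (simp add: LIMSEQ_const_iff)
  then have "is_left_trivial f"
    unfolding is_left_trivial_def using pos by (metis order_le_less)
  then show False using nontriv by simp
qed

section \<open>Fixed points\<close>

lemma loewner_le_scaleR_mono: "A \<sqsubseteq> B \<Longrightarrow> 0 \<le> c \<Longrightarrow> c *\<^sub>R A \<sqsubseteq> c *\<^sub>R B"
  using positive_op_scaleR[of "B - A" c] by (simp add: loewner_le_def flip: scaleR_diff_right)

lemma loewner_le_scaleR_left_mono: "positive_op A \<Longrightarrow> c \<le> d \<Longrightarrow> c *\<^sub>R A \<sqsubseteq> d *\<^sub>R A"
  using positive_op_scaleR[of A "d - c"] by (simp add: loewner_le_def flip: scaleR_diff_left)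

context
  fixes f :: "real \<Rightarrow> real"
  assumes rep: "representing_function f" and nontriv: "\<not> is_left_trivial f"
begin

lemma representing_mono: "operator_monotone f"
  using rep by (simp add: representing_function_def)

lemma representing_continuous: "continuous_on {0..} f"
  by (rule operator_monotone_continuous[OF representing_mono])

lemma representing_pos: "0 < t \<Longrightarrow> 0 < f t"
  using representing_function_strict_mono[OF rep nontriv, of 0 t] rep
  by (force simp: representing_function_def)

lemma op_mean_PP:
  fixes X A :: "'h::complex_hilbert \<Rightarrow>\<^sub>L 'h"
  assumes X: "X \<in> PP" and A: "A \<in> PP"
  shows "op_mean f X A \<in> PP"
proof -
  define D where "D = inverse_op (sqrt_op X) o\<^sub>L A o\<^sub>L inverse_op (sqrt_op X)"
  have D: "D \<in> PP" unfolding D_def by (rule inverse_sqrt_op_conj[OF X A])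
  obtain d where d: "0 < d" "\<And>x. d * (norm x)\<^sup>2 \<le> inner (D x) x"
    by (rule PP_lower_bound[OF D]) blast
  have "fun_op (\<lambda>t. f d) D \<sqsubseteq> fun_op f D"
    by (rule fun_op_mono[OF PP_positive[OF D] continuous_on_const representing_continuous d(2)])
       (use d operator_monotone_imp_mono[OF representing_mono] in auto)
  then have "f d *\<^sub>R id_blinfun \<sqsubseteq> fun_op f D"
    by (simp add: fun_op_const PP_positive D)
  then have "fun_op f D \<in> PP"
    by (rule PP_mono[OF PP_scaleR[OF PP_id representing_pos[OF d(1)]]])
  then show ?thesis
    unfolding op_mean_def D_def[symmetric]
    using sqrt_op_PP[OF X] by (intro PP_conj[of _ _ "inverse_op (sqrt_op X)"]) (auto simp: PP_selfadj)
qed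

text \<open>The ratio f(t/\<alpha>)/f(t) is continuous and, by strict monotonicity, below 1; its
  maximum over a compact interval away from 0 gives a uniform r.\<close>

lemma representing_ratio:
  assumes "0 < d" "1 < \<alpha>"
  obtains r where "0 < r" "r < 1" "\<And>t. d \<le> t \<Longrightarrow> t \<le> b \<Longrightarrow> f (1 / \<alpha> * t) \<le> r * f t"
proof -
  define h where "h t = f (1 / \<alpha> * t) / f t" for t
  have "f t \<noteq> 0" if "d \<le> t" for t
    using representing_pos[of t] assms(1) that by simp
  \<comment> \<open>\<open>max d b\<close> keeps the interval nonempty when b < d.\<close>
  then have "continuous_on {d..max d b} h"
    unfolding h_def using assms
    by (intro continuous_on_divide continuous_on_compose2[OF representing_continuous]
        continuous_on_subset[OF representing_continuous] continuous_intros) auto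
  then obtain s where s: "s \<in> {d..max d b}" "\<And>t. t \<in> {d..max d b} \<Longrightarrow> h t \<le> h s"
    using continuous_attains_sup[of "{d..max d b}" h] by auto
  have "1 / \<alpha> * s < s" using s(1) assms by (simp add: field_simps)
  then have "f (1 / \<alpha> * s) < f s"
    using s(1) assms by (intro representing_function_strict_mono[OF rep nontriv]) auto
  then have "h s < 1"
    using representing_pos[of s] s(1) assms by (simp add: h_def)
  \<comment> \<open>The maximum with 1/2 makes positivity of r immediate.\<close>
  moreover have "f (1 / \<alpha> * t) \<le> max (h s) (1 / 2) * f t" if "d \<le> t" "t \<le> b" for t
  proof -
    have "h t \<le> max (h s) (1 / 2)" using s(2)[of t] that by simp
    then show ?thesis
      using representing_pos[of t] that assms by (simp add: h_def divide_le_eq)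
  qed
  ultimately show ?thesis by (intro that[of "max (h s) (1 / 2)"]) auto
qed

text \<open>The scalar inequality \<alpha> f(t/\<alpha>) \<le> \<alpha> r f(t) is applied to D and
  conjugated by X^(1/2).\<close>

lemma op_mean_scale_strict:
  fixes X A :: "'h::complex_hilbert \<Rightarrow>\<^sub>L 'h"
  assumes X: "X \<in> PP" and A: "A \<in> PP" and \<alpha>: "1 < \<alpha>"
  shows "\<exists>r. 0 < r \<and> r < 1 \<and> op_mean f (\<alpha> *\<^sub>R X) A \<sqsubseteq> (\<alpha> * r) *\<^sub>R op_mean f X A"
proof -
  define D where "D = inverse_op (sqrt_op X) o\<^sub>L A o\<^sub>L inverse_op (sqrt_op X)"
  have D: "D \<in> PP" unfolding D_def by (rule inverse_sqrt_op_conj[OF X A])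
  obtain d where d: "0 < d" "\<And>x. d * (norm x)\<^sup>2 \<le> inner (D x) x"
    by (rule PP_lower_bound[OF D]) blast
  obtain r where r: "0 < r" "r < 1" "\<And>t. d \<le> t \<Longrightarrow> t \<le> norm D \<Longrightarrow> f (1 / \<alpha> * t) \<le> r * f t"
    by (rule representing_ratio[OF d(1) \<alpha>, of "norm D"]) blast
  have c: "continuous_on {0..} (\<lambda>t. f (1 / \<alpha> * t))"
    using \<alpha> by (intro continuous_on_compose2[OF representing_continuous] continuous_intros) auto
  have "fun_op (\<lambda>t. f (1 / \<alpha> * t)) D \<sqsubseteq> fun_op (\<lambda>t. r * f t) D"
    by (rule fun_op_mono[OF PP_positive[OF D] c _ d(2)])
       (use r in \<open>auto intro!: continuous_intros representing_continuous\<close>)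
  then have "sqrt_op X o\<^sub>L fun_op (\<lambda>t. f (1 / \<alpha> * t)) D o\<^sub>L sqrt_op X \<sqsubseteq>
      sqrt_op X o\<^sub>L fun_op (\<lambda>t. r * f t) D o\<^sub>L sqrt_op X"
    by (rule conj_mono[OF PP_selfadj[OF sqrt_op_PP[OF X]]])
  also have "sqrt_op X o\<^sub>L fun_op (\<lambda>t. r * f t) D o\<^sub>L sqrt_op X = r *\<^sub>R op_mean f X A"
    unfolding op_mean_def D_def[symmetric] fun_op_cmult[OF PP_positive[OF D] representing_continuous]
    by (rule blinfun_eqI) (simp add: blinfun.scaleR_left blinfun.scaleR_right)
  finally have "\<alpha> *\<^sub>R (sqrt_op X o\<^sub>L fun_op (\<lambda>t. f (1 / \<alpha> * t)) D o\<^sub>L sqrt_op X) \<sqsubseteq> \<alpha> *\<^sub>R r *\<^sub>R op_mean f X A"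
    using \<alpha> by (intro loewner_le_scaleR_mono) simp_all
  then show ?thesis
    using r op_mean_scaleR[OF representing_continuous X A, of \<alpha>] \<alpha> by (auto simp: D_def)
qed

lemma op_mean_scaleR_id:
  fixes A :: "'h::complex_hilbert \<Rightarrow>\<^sub>L 'h"
  assumes A: "A \<in> PP" and c: "0 < c"
  shows "op_mean f (c *\<^sub>R id_blinfun) A = c *\<^sub>R fun_op (\<lambda>t. f (1 / c * t)) A"
proof -
  have pI: "positive_op (id_blinfun :: 'h \<Rightarrow>\<^sub>L 'h)" by (rule PP_positive[OF PP_id])
  have s: "sqrt_op (id_blinfun :: 'h \<Rightarrow>\<^sub>L 'h) = id_blinfun"
    using fun_op_eigen[OF pI continuous_on_sqrt_nonneg, of _ 1] by (intro blinfun_eqI) simp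
  have "is_inverse_op (id_blinfun :: 'h \<Rightarrow>\<^sub>L 'h) id_blinfun"
    by (simp add: is_inverse_op_def B_H_id blinfun_eqI)
  then have i: "inverse_op (id_blinfun :: 'h \<Rightarrow>\<^sub>L 'h) = id_blinfun" by (rule inverse_op_eqI)
  have id: "id_blinfun o\<^sub>L T o\<^sub>L id_blinfun = T" for T :: "'h \<Rightarrow>\<^sub>L 'h"
    by (rule blinfun_eqI) simp
  show ?thesis
    using op_mean_scaleR[OF representing_continuous PP_id A c] by (simp only: s i id)
qed

text \<open>Only arguments t/c \<le> 1 occur, where f \<le> f(1) = 1. This provides the
  supersolution from which the iteration starts; the next lemma is its dual and provides the
  subsolution.\<close>

lemma op_mean_scaleR_id_le:
  fixes A :: "'h::complex_hilbert \<Rightarrow>\<^sub>L 'h"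
  assumes A: "A \<in> PP" and c: "0 < c" and le: "norm A \<le> c"
  shows "op_mean f (c *\<^sub>R id_blinfun) A \<sqsubseteq> c *\<^sub>R id_blinfun"
proof -
  have "fun_op (\<lambda>t. f (1 / c * t)) A \<sqsubseteq> fun_op (\<lambda>t. 1) A"
  proof (rule fun_op_mono[OF PP_positive[OF A] _ _ positive_op_bounds(1)[OF PP_positive[OF A]]])
    show "continuous_on {0..} (\<lambda>t. f (1 / c * t))"
      using c by (intro continuous_on_compose2[OF representing_continuous] continuous_intros) auto
    show "f (1 / c * t) \<le> 1" if "0 \<le> t" "t \<le> norm A" for t
      using operator_monotone_imp_mono[OF representing_mono, of "1 / c * t" 1] that c le rep
      by (auto simp: representing_function_def)
  qed auto
  then show ?thesis
    using positive_op_scaleR[of _ c] c unfolding op_mean_scaleR_id[OF A c]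
    by (simp add: loewner_le_def fun_op_const[OF PP_positive[OF A]] flip: scaleR_diff_right)
qed

lemma op_mean_scaleR_id_ge:
  fixes A :: "'h::complex_hilbert \<Rightarrow>\<^sub>L 'h"
  assumes A: "A \<in> PP" and c: "0 < c" and lb: "\<And>x. c * (norm x)\<^sup>2 \<le> inner (A x) x"
  shows "c *\<^sub>R id_blinfun \<sqsubseteq> op_mean f (c *\<^sub>R id_blinfun) A"
proof -
  have "fun_op (\<lambda>t. 1) A \<sqsubseteq> fun_op (\<lambda>t. f (1 / c * t)) A"
  proof (rule fun_op_mono[OF PP_positive[OF A] _ _ lb])
    show "continuous_on {0..} (\<lambda>t. f (1 / c * t))"
      using c by (intro continuous_on_compose2[OF representing_continuous] continuous_intros) auto
    show "1 \<le> f (1 / c * t)" if "c \<le> t" for t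
      using operator_monotone_imp_mono[OF representing_mono, of 1 "1 / c * t"] that c rep
      by (auto simp: representing_function_def)
  qed auto
  then show ?thesis
    using positive_op_scaleR[of _ c] c unfolding op_mean_scaleR_id[OF A c]
    by (simp add: loewner_le_def fun_op_const[OF PP_positive[OF A]] flip: scaleR_diff_right)
qed

end

section \<open>Strong continuity of operator means\<close>

lemma norm_sqrt_op_le:
  fixes X :: "'h::complex_hilbert \<Rightarrow>\<^sub>L 'h"
  assumes X: "positive_op X" and b: "norm X \<le> b"
  shows "norm (sqrt_op X) \<le> sqrt b"
proof (rule norm_blinfun_bound)
  show "0 \<le> sqrt b" using b order_trans[OF norm_ge_zero] by simp
  fix x
  have "(norm (sqrt_op X x))\<^sup>2 = inner (X x) x"
    using selfadjD[OF positive_selfadj[OF positive_sqrt_op[OF X]], of "sqrt_op X x" x]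
    by (simp add: power2_norm_eq_inner sqrt_op_square X)
  also have "\<dots> \<le> b * (norm x)\<^sup>2" by (rule positive_op_bounds(2)[OF X b])
  finally have "sqrt ((norm (sqrt_op X x))\<^sup>2) \<le> sqrt (b * (norm x)\<^sup>2)" by (rule real_sqrt_le_mono)
  then show "norm (sqrt_op X x) \<le> sqrt b * norm x" by (simp add: real_sqrt_mult)
qed

lemma norm_inverse_op_le:
  assumes X: "X \<in> PP" and d: "0 < d" and lb: "\<And>x. d * (norm x)\<^sup>2 \<le> inner (X x) x"
  shows "norm (inverse_op X) \<le> 1 / d"
proof (rule norm_blinfun_bound)
  show "0 \<le> 1 / d" using d by simp
  fix x
  define y where "y = inverse_op X x"
  have "d * norm y * norm y \<le> norm (X y) * norm y"
    using lb[of y] Cauchy_Schwarz_ineq2[of "X y" y] by (simp add: power2_eq_square mult.assoc)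
  then have "d * norm y \<le> norm (X y)" by (cases "y = 0") auto
  moreover have "X y = x" using X by (simp add: y_def)
  ultimately show "norm (inverse_op X x) \<le> 1 / d * norm x"
    using d by (simp add: y_def field_simps)
qed

text \<open>Resolvent identity: X_k^(-1) x - L^(-1) x = X_k^(-1) (L - X_k) L^(-1) x, which tends to
  0 since the inverses are bounded.\<close>

lemma sot_tendsto_inverse_op:
  assumes X: "\<And>k. X k \<in> PP" and L: "L \<in> PP" and lim: "sot_tendsto X L"
    and b: "\<And>k. norm (inverse_op (X k)) \<le> b"
  shows "sot_tendsto (\<lambda>k. inverse_op (X k)) (inverse_op L)"
  unfolding sot_tendsto_def
proof
  fix x
  define y where "y = inverse_op L x"
  have eq: "inverse_op (X k) x - inverse_op L x = inverse_op (X k) (L y - X k y)" for k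
    using X[of k] L by (simp add: y_def blinfun.diff_right)
  have "(\<lambda>k. inverse_op (X k) x - inverse_op L x) \<longlonglongrightarrow> 0"
    unfolding eq
  proof (rule Lim_null_comparison)
    show "\<forall>\<^sub>F k in sequentially. norm (inverse_op (X k) (L y - X k y)) \<le> b * norm (L y - X k y)"
      by (intro always_eventually allI order_trans[OF norm_blinfun] mult_right_mono b) simp
    have "(\<lambda>k. b * norm (L y - X k y)) \<longlonglongrightarrow> b * norm (L y - L y)"
      by (intro tendsto_mult tendsto_norm tendsto_diff tendsto_const)
         (use lim in \<open>simp add: sot_tendsto_def\<close>)
    then show "(\<lambda>k. b * norm (L y - X k y)) \<longlonglongrightarrow> 0" by simp
  qed
  then show "(\<lambda>k. inverse_op (X k) x) \<longlonglongrightarrow> inverse_op L x" by (rule LIM_zero_cancel)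
qed

lemma norm_fun_op_le:
  fixes A :: "'h::complex_hilbert \<Rightarrow>\<^sub>L 'h"
  assumes "positive_op A" "norm A \<le> b" "continuous_on {0..} f"
    and "\<And>t. 0 \<le> t \<Longrightarrow> t \<le> b \<Longrightarrow> \<bar>f t\<bar> \<le> e"
  shows "norm (fun_op f A) \<le> e"
  using fun_op_approx[OF assms(1-3), of 0 e] assms(4) by simp

text \<open>The bound b controls X_k^(1/2) and d controls X_k^(-1/2). Hence the left factors in the
  product defining the mean stay bounded, and f is applied on a common interval [0, c].\<close>

lemma sot_tendsto_op_mean:
  fixes L A :: "'h::complex_hilbert \<Rightarrow>\<^sub>L 'h"
  assumes f: "continuous_on {0..} f" and X: "\<And>k. X k \<in> PP" and L: "L \<in> PP" and A: "A \<in> PP"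
    and lim: "sot_tendsto X L" and b: "\<And>k. norm (X k) \<le> b"
    and d: "0 < d" "\<And>k x. d * (norm x)\<^sup>2 \<le> inner (X k x) x"
  shows "sot_tendsto (\<lambda>k. op_mean f (X k) A) (op_mean f L A)"
proof -
  note pX = PP_positive[OF X]
  have S: "sot_tendsto (\<lambda>k. sqrt_op (X k)) (sqrt_op L)"
    by (rule sot_tendsto_fun_op[OF continuous_on_sqrt_nonneg pX b PP_positive[OF L] lim])
  have nS: "norm (sqrt_op (X k)) \<le> sqrt b" for k by (rule norm_sqrt_op_le[OF pX b])
  have nI: "norm (inverse_op (sqrt_op (X k))) \<le> 1 / sqrt d" for k
    by (rule norm_inverse_op_le[OF sqrt_op_PP[OF X] _ sqrt_op_lower_bound[OF pX d(2)]])
       (use d in simp)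
  have I: "sot_tendsto (\<lambda>k. inverse_op (sqrt_op (X k))) (inverse_op (sqrt_op L))"
    by (rule sot_tendsto_inverse_op[OF sqrt_op_PP[OF X] sqrt_op_PP[OF L] S nI])
  define D where "D k = inverse_op (sqrt_op (X k)) o\<^sub>L A o\<^sub>L inverse_op (sqrt_op (X k))" for k
  define E where "E = inverse_op (sqrt_op L) o\<^sub>L A o\<^sub>L inverse_op (sqrt_op L)"
  have nIA: "norm (inverse_op (sqrt_op (X k)) o\<^sub>L A) \<le> 1 / sqrt d * norm A" for k
    by (rule order_trans[OF norm_blinfun_compose]) (intro mult_right_mono nI norm_ge_zero)
  have nD: "norm (D k) \<le> 1 / sqrt d * norm A * (1 / sqrt d)" for k
    unfolding D_def using d
    by (intro order_trans[OF norm_blinfun_compose] mult_mono nI nIA) auto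
  define c where "c = 1 / sqrt d * norm A * (1 / sqrt d)"
  have "sot_tendsto (\<lambda>k. A) A" by (simp add: sot_tendsto_def)
  then have limD: "sot_tendsto D E"
    unfolding D_def[abs_def] E_def by (intro sot_tendsto_compose[OF nIA] sot_tendsto_compose[OF nI] I)
  have D: "D k \<in> PP" for k unfolding D_def by (rule inverse_sqrt_op_conj[OF X A])
  have E: "E \<in> PP" unfolding E_def by (rule inverse_sqrt_op_conj[OF L A])
  have fD: "sot_tendsto (\<lambda>k. fun_op f (D k)) (fun_op f E)"
    by (rule sot_tendsto_fun_op[OF f PP_positive[OF D] nD PP_positive[OF E] limD])
  have "bounded (f ` {0..c})"
    by (intro compact_imp_bounded compact_continuous_image continuous_on_subset[OF f]) auto
  then obtain K where K: "\<forall>t\<in>{0..c}. \<bar>f t\<bar> \<le> K"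
    by (auto simp: bounded_iff)
  have nf: "norm (fun_op f (D k)) \<le> K" for k
    by (rule norm_fun_op_le[OF PP_positive[OF D] nD f]) (use K in \<open>auto simp: c_def\<close>)
  have "0 \<le> b" using b[of 0] norm_ge_zero[of "X 0"] by linarith
  then have nSf: "norm (sqrt_op (X k) o\<^sub>L fun_op f (D k)) \<le> sqrt b * K" for k
    by (intro order_trans[OF norm_blinfun_compose] mult_mono nS nf) auto
  show ?thesis
    unfolding op_mean_def D_def[symmetric] E_def[symmetric]
    by (intro sot_tendsto_compose[OF nSf] sot_tendsto_compose[OF nS] S fD)
qed

section \<open>Monotone limits, comparison and iteration\<close>

text \<open>The scalar sequences <X_k x, x> converge, and T^2 \<le> c T for T = X_m - X_n turns the
  Cauchy property of the forms into that of the vectors X_k x.\<close>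

lemma decreasing_bounded_sot_limit:
  fixes X :: "nat \<Rightarrow> 'h::complex_hilbert \<Rightarrow>\<^sub>L 'h"
  assumes dec: "\<And>k. X (Suc k) \<sqsubseteq> X k" and X: "\<And>k. positive_op (X k)"
  obtains L where "sot_tendsto X L" "\<And>k. norm (X k) \<le> norm (X 0)"
proof -
  have mono: "inner (X n x) x \<le> inner (X m x) x" if "m \<le> n" for m n x
    using that by (induction rule: dec_induct) (auto intro: order_trans[OF loewner_leD[OF dec]])
  have nn: "0 \<le> inner (X k x) x" for k x using X by (simp add: positive_op_iff)
  have ub: "inner (X k x) x \<le> norm (X 0) * (norm x)\<^sup>2" for k x
    using mono[of 0 k x] abs_inner_blinfun_le[of "X 0" x] by simp
  have nX: "norm (X k) \<le> norm (X 0)" for k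
    using ub nn by (intro norm_selfadj_le positive_selfadj X) auto
  have "Cauchy (\<lambda>k. X k x)" for x
  proof -
    have "decseq (\<lambda>k. inner (X k x) x)" by (auto simp: decseq_def mono)
    then have "convergent (\<lambda>k. inner (X k x) x)"
      using decseq_convergent[of "\<lambda>k. inner (X k x) x" 0] nn by (metis convergentI)
    then have C: "Cauchy (\<lambda>k. inner (X k x) x)" by (rule convergent_Cauchy)
    have diff: "(norm (X m x - X n x))\<^sup>2 \<le> norm (X 0) * \<bar>inner (X m x) x - inner (X n x) x\<bar>" for m n
    proof (induction m n rule: linorder_wlog)
      case (le m n)
      have "positive_op (X m - X n)"
        using mono[OF le]
        by (intro positive_op_selfadjI[OF selfadj_diff[OF positive_selfadj[OF X] positive_selfadj[OF X]]])
           (simp add: blinfun.diff_left inner_diff_left)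
      moreover have "inner ((X m - X n) y) y \<le> norm (X 0) * (norm y)\<^sup>2" for y
        using ub[of m y] nn[of n y] by (simp add: blinfun.diff_left inner_diff_left)
      ultimately have "(norm ((X m - X n) x))\<^sup>2 \<le> norm (X 0) * inner ((X m - X n) x) x"
        by (rule positive_norm_power2_le)
      also have "\<dots> \<le> norm (X 0) * \<bar>inner (X m x) x - inner (X n x) x\<bar>"
        by (intro mult_left_mono) (auto simp: blinfun.diff_left inner_diff_left)
      finally show ?case by (simp add: blinfun.diff_left)
    next
      case (sym m n)
      then show ?case by (simp add: norm_minus_commute abs_minus_commute)
    qed
    show ?thesis
    proof (rule metric_CauchyI)
      fix e :: real assume e: "0 < e"
      define K where "K = norm (X 0) + 1"
      have K: "0 < K" by (simp add: K_def add_nonneg_pos)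
      obtain N where N: "\<And>m n. m \<ge> N \<Longrightarrow> n \<ge> N \<Longrightarrow>
          \<bar>inner (X m x) x - inner (X n x) x\<bar> < e\<^sup>2 / K"
        using metric_CauchyD[OF C, of "e\<^sup>2 / K"] e K by (auto simp: dist_real_def)
      have "dist (X m x) (X n x) < e" if "m \<ge> N" "n \<ge> N" for m n
      proof -
        have "(norm (X m x - X n x))\<^sup>2 \<le> K * \<bar>inner (X m x) x - inner (X n x) x\<bar>"
          by (rule order_trans[OF diff mult_right_mono]) (auto simp: K_def)
        also have "\<dots> < K * (e\<^sup>2 / K)" by (rule mult_strict_left_mono[OF N[OF that] K])
        finally have "(norm (X m x - X n x))\<^sup>2 < e\<^sup>2" using K by simp
        then show ?thesis using e by (simp add: dist_norm power_less_imp_less_base)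
      qed
      then show "\<exists>M. \<forall>m\<ge>M. \<forall>n\<ge>M. dist (X m x) (X n x) < e" by blast
    qed
  qed
  then have "\<forall>x. \<exists>l. (\<lambda>k. X k x) \<longlonglongrightarrow> l"
    by (simp add: Cauchy_convergent_iff convergent_def)
  then obtain l where l: "\<And>x. (\<lambda>k. X k x) \<longlonglongrightarrow> l x" by metis
  have "bounded_linear l"
  proof (rule bounded_linear_intro)
    show "l (x + y) = l x + l y" for x y
      using LIMSEQ_unique[OF l[of "x + y"]] tendsto_add[OF l[of x] l[of y]]
      by (simp add: blinfun.add_right)
    show "l (r *\<^sub>R x) = r *\<^sub>R l x" for r x
      using LIMSEQ_unique[OF l[of "r *\<^sub>R x"]] tendsto_scaleR[OF tendsto_const l[of x], of r]
      by (simp add: blinfun.scaleR_right)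
    show "norm (l x) \<le> norm x * norm (X 0)" for x
    proof (rule LIMSEQ_le_const2[OF tendsto_norm[OF l]])
      have "norm (X k x) \<le> norm x * norm (X 0)" for k
        using norm_blinfun[of "X k" x] mult_right_mono[OF nX[of k] norm_ge_zero[of x]]
        by (simp add: mult.commute)
      then show "\<exists>N. \<forall>n\<ge>N. norm (X n x) \<le> norm x * norm (X 0)" by blast
    qed
  qed
  then have "sot_tendsto X (Blinfun l)"
    using l by (simp add: sot_tendsto_def bounded_linear_Blinfun_apply)
  then show ?thesis using nX by (rule that)
qed

text \<open>The least \<open>\<alpha> \<ge> 1\<close> with \<open>X \<le> \<alpha>Y\<close> is attained, and cannot exceed 1 because \<open>G\<close> is strictly
  subhomogeneous.\<close>

lemma subsolution_le_supersolution:
  fixes G :: "('h::complex_hilbert \<Rightarrow>\<^sub>L 'h) \<Rightarrow> 'h \<Rightarrow>\<^sub>L 'h"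
  assumes mono: "\<And>X Y. X \<in> PP \<Longrightarrow> Y \<in> PP \<Longrightarrow> X \<sqsubseteq> Y \<Longrightarrow> G X \<sqsubseteq> G Y"
    and strict: "\<And>X \<alpha>. X \<in> PP \<Longrightarrow> 1 < \<alpha> \<Longrightarrow> \<exists>r. 0 < r \<and> r < 1 \<and> G (\<alpha> *\<^sub>R X) \<sqsubseteq> (\<alpha> * r) *\<^sub>R G X"
    and X: "X \<in> PP" "X \<sqsubseteq> G X" and Y: "Y \<in> PP" "G Y \<sqsubseteq> Y"
  shows "X \<sqsubseteq> Y"
proof -
  define S where "S = {\<alpha>. 1 \<le> \<alpha> \<and> X \<sqsubseteq> \<alpha> *\<^sub>R Y}"
  define \<beta> where "\<beta> = Inf S"
  have iff: "X \<sqsubseteq> \<alpha> *\<^sub>R Y \<longleftrightarrow> (\<forall>x. inner (X x) x \<le> \<alpha> * inner (Y x) x)" for \<alpha>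
    using X Y by (simp add: loewner_le_iff PP_selfadj selfadj_scaleR blinfun.scaleR_left)
  obtain d where d: "0 < d" "\<And>x. d * (norm x)\<^sup>2 \<le> inner (Y x) x"
    by (rule PP_lower_bound[OF Y(1)]) blast
  \<comment> \<open>X \<le> \<open>norm X\<close> I \<le> (\<open>norm X\<close> / d) Y, so S is not
    empty.\<close>
  define \<gamma> where "\<gamma> = max 1 (norm X / d)"
  have "inner (X x) x \<le> \<gamma> * inner (Y x) x" for x
  proof -
    have "inner (X x) x \<le> norm X * (norm x)\<^sup>2" using abs_inner_blinfun_le[of X x] by simp
    also have "\<dots> = norm X / d * (d * (norm x)\<^sup>2)" using d by simp
    also have "\<dots> \<le> \<gamma> * inner (Y x) x"
      using d by (intro mult_mono) (auto simp: \<gamma>_def)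
    finally show ?thesis .
  qed
  then have ne: "\<gamma> \<in> S" by (simp add: S_def iff \<gamma>_def)
  have bdd: "bdd_below S" by (intro bdd_belowI[of _ 1]) (simp add: S_def)
  have b1: "1 \<le> \<beta>" unfolding \<beta>_def using ne by (intro cInf_greatest) (auto simp: S_def)
  have Y0: "0 \<le> inner (Y x) x" for x using PP_positive[OF Y(1)] by (simp add: positive_op_iff)
  \<comment> \<open>The infimum is attained because the inequality is checked separately at each x,
    where the ratio of the two forms is a lower bound of S.\<close>
  have XY: "X \<sqsubseteq> \<beta> *\<^sub>R Y"
    unfolding iff
  proof
    fix x
    show "inner (X x) x \<le> \<beta> * inner (Y x) x"
    proof (cases "inner (Y x) x = 0")
      case True
      then show ?thesis using ne by (auto simp: S_def iff dest: spec[of _ x])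
    next
      case False
      then have pos: "0 < inner (Y x) x" using Y0[of x] by simp
      have "inner (X x) x / inner (Y x) x \<le> \<beta>"
        unfolding \<beta>_def using ne
        by (intro cInf_greatest) (auto simp: S_def iff divide_le_eq pos)
      then show ?thesis using pos by (simp add: divide_le_eq)
    qed
  qed
  have "\<beta> = 1"
  proof (rule ccontr)
    assume "\<beta> \<noteq> 1"
    then have "1 < \<beta>" using b1 by simp
    then obtain r where r: "0 < r" "r < 1" "G (\<beta> *\<^sub>R Y) \<sqsubseteq> (\<beta> * r) *\<^sub>R G Y"
      using strict[OF Y(1)] by blast
    have "G X \<sqsubseteq> G (\<beta> *\<^sub>R Y)"
      using X Y XY \<open>1 < \<beta>\<close> by (intro mono PP_scaleR) auto
    moreover have "(\<beta> * r) *\<^sub>R G Y \<sqsubseteq> (\<beta> * r) *\<^sub>R Y"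
      using Y(2) r \<open>1 < \<beta>\<close> by (intro loewner_le_scaleR_mono) auto
    \<comment> \<open>S contains only numbers from 1 on, while \<beta> r may fall below 1.\<close>
    moreover have "(\<beta> * r) *\<^sub>R Y \<sqsubseteq> max 1 (\<beta> * r) *\<^sub>R Y"
      by (intro loewner_le_scaleR_left_mono PP_positive Y) simp
    ultimately have "X \<sqsubseteq> max 1 (\<beta> * r) *\<^sub>R Y"
      using X(2) r(3) by (blast intro: loewner_le_trans)
    then have "\<beta> \<le> max 1 (\<beta> * r)"
      unfolding \<beta>_def by (intro cInf_lower bdd) (simp add: S_def)
    then show False using r \<open>1 < \<beta>\<close> by (simp add: le_max_iff_disj)
  qed
  then show ?thesis using XY by simp
qed

text \<open>The subsolution V bounds the iterates of U from below. This keeps their strong limit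
  invertible and supplies the d demanded by the continuity hypothesis; the norm of U supplies the
  b.\<close>

lemma decreasing_iteration_fixed_point:
  fixes G :: "('h::complex_hilbert \<Rightarrow>\<^sub>L 'h) \<Rightarrow> 'h \<Rightarrow>\<^sub>L 'h"
  assumes PP: "\<And>X. X \<in> PP \<Longrightarrow> G X \<in> PP"
    and mono: "\<And>X Y. X \<in> PP \<Longrightarrow> Y \<in> PP \<Longrightarrow> X \<sqsubseteq> Y \<Longrightarrow> G X \<sqsubseteq> G Y"
    and cont: "\<And>X L d b. (\<And>k. X k \<in> PP) \<Longrightarrow> L \<in> PP \<Longrightarrow> decreases_to X L \<Longrightarrow>
      (\<And>k. norm (X k) \<le> b) \<Longrightarrow> 0 < d \<Longrightarrow> (\<And>k x. d * (norm x)\<^sup>2 \<le> inner (X k x) x) \<Longrightarrow>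
      sot_tendsto (\<lambda>k. G (X k)) (G L)"
    and U: "U \<in> PP" "G U \<sqsubseteq> U" and V: "V \<in> PP" "V \<sqsubseteq> G V" and VU: "V \<sqsubseteq> U"
  shows "\<exists>X. X \<in> PP \<and> X = G X"
proof -
  define X where "X k = (G ^^ k) U" for k
  have XS: "X (Suc k) = G (X k)" and X0: "X 0 = U" for k by (simp_all add: X_def)
  have X: "X k \<in> PP" for k by (induction k) (auto simp: X0 XS U PP)
  have dec: "X (Suc k) \<sqsubseteq> X k" for k
    by (induction k) (auto simp: X0 XS U intro!: mono PP X[unfolded XS] X)
  have low: "V \<sqsubseteq> X k" for k
  proof (induction k)
    case (Suc k)
    have "G V \<sqsubseteq> G (X k)" by (rule mono[OF V(1) X Suc])
    then show ?case using V(2) by (auto simp: XS intro: loewner_le_trans)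
  qed (simp add: X0 VU)
  obtain d where d: "0 < d" "\<And>x. d * (norm x)\<^sup>2 \<le> inner (V x) x"
    by (rule PP_lower_bound[OF V(1)]) blast
  have dX: "d * (norm x)\<^sup>2 \<le> inner (X k x) x" for k x
    using d(2) loewner_leD[OF low] by (rule order_trans)
  obtain L where L: "sot_tendsto X L" "\<And>k. norm (X k) \<le> norm (X 0)"
    using decreasing_bounded_sot_limit[of X, OF dec PP_positive[OF X]] by blast
  have XL: "(\<lambda>k. X k x) \<longlonglongrightarrow> L x" for x using L(1) by (simp add: sot_tendsto_def)
  have LP: "L \<in> PP"
  proof (rule PP_I[OF selfadj_limit[OF PP_selfadj[OF X] L(1)] d(1)])
    fix x
    have "(\<lambda>k. inner (X k x) x) \<longlonglongrightarrow> inner (L x) x"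
      by (intro tendsto_inner XL tendsto_const)
    then show "d * (norm x)\<^sup>2 \<le> inner (L x) x"
      by (rule LIMSEQ_le_const) (use dX in auto)
  qed
  have "sot_tendsto (\<lambda>k. G (X k)) (G L)"
    using dec L by (intro cont[OF X LP _ L(2) d(1) dX]) (simp add: decreases_to_def)
  then have "(\<lambda>k. X (Suc k) x) \<longlonglongrightarrow> G L x" for x by (simp add: XS sot_tendsto_def)
  moreover have "(\<lambda>k. X (Suc k) x) \<longlonglongrightarrow> L x" for x by (rule LIMSEQ_Suc[OF XL])
  ultimately have "L = G L" by (metis LIMSEQ_unique blinfun_eqI)
  then show ?thesis using LP by blast
qed

theorem lemma4p4:
  fixes M :: "('n::finite \<Rightarrow> 'h::complex_hilbert \<Rightarrow>\<^sub>L 'h) \<Rightarrow> 'h \<Rightarrow>\<^sub>L 'h"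
    and f :: "'n \<Rightarrow> real \<Rightarrow> real"
    and A :: "'n \<Rightarrow> 'h \<Rightarrow>\<^sub>L 'h"
  assumes "CARD('n) \<ge> 2"
    and "maps_PP M"
    and "jointly_monotone M"
    and "homogeneous M"
    and "monotone_continuous M"
    and "normalized M"
    and "\<And>j. representing_function (f j)"
    and "\<And>j. \<not> is_left_trivial (f j)"
    and "\<And>j. A j \<in> PP"
  shows "(\<exists>!X\<^sub>0. X\<^sub>0 \<in> PP \<and> X\<^sub>0 = M (\<lambda>j. op_mean (f j) X\<^sub>0 (A j))) \<and>
    (\<forall>X\<^sub>0. X\<^sub>0 \<in> PP \<and> X\<^sub>0 = M (\<lambda>j. op_mean (f j) X\<^sub>0 (A j)) \<longrightarrow>
      (\<forall>Y\<in>PP. M (\<lambda>j. op_mean (f j) Y (A j)) \<sqsubseteq> Y \<longrightarrow> X\<^sub>0 \<sqsubseteq> Y) \<and>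
      (\<forall>Y\<in>PP. Y \<sqsubseteq> M (\<lambda>j. op_mean (f j) Y (A j)) \<longrightarrow> Y \<sqsubseteq> X\<^sub>0))"
proof -
  note rep = assms(7) and nontriv = assms(8) and A = assms(9)
  define G where "G X = M (\<lambda>j. op_mean (f j) X (A j))" for X
  have M_mono: "M B \<sqsubseteq> M C" if "\<And>j. B j \<in> PP" "\<And>j. C j \<in> PP" "\<And>j. B j \<sqsubseteq> C j" for B C
    using assms(3) that unfolding jointly_monotone_def by blast
  have M_hom: "M (\<lambda>j. c *\<^sub>R B j) = c *\<^sub>R M B" if "\<And>j. B j \<in> PP" "0 < c" for B c
    using assms(4) that unfolding homogeneous_def by blast
  \<comment> \<open>Homogeneity and normalization determine M at constant scalar tuples.\<close>
  have M_id: "M (\<lambda>_. c *\<^sub>R id_blinfun) = c *\<^sub>R id_blinfun" if "0 < c" for c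
    using M_hom[of "\<lambda>_. id_blinfun"] assms(6) that by (simp add: PP_id normalized_def)
  have mean_PP: "op_mean (f j) X (A j) \<in> PP" if "X \<in> PP" for j X
    by (rule op_mean_PP[OF rep nontriv that A])
  have mean_mono: "op_mean (f j) X (A j) \<sqsubseteq> op_mean (f j) Y (A j)"
    if "X \<in> PP" "Y \<in> PP" "X \<sqsubseteq> Y" for j X Y
    using rep[of j] by (intro op_mean_mono_left that A) (auto simp: representing_function_def)
  have G_PP: "G X \<in> PP" if "X \<in> PP" for X
    using assms(2) mean_PP[OF that] by (auto simp: maps_PP_def G_def)
  have G_mono: "G X \<sqsubseteq> G Y" if "X \<in> PP" "Y \<in> PP" "X \<sqsubseteq> Y" for X Y
    unfolding G_def by (intro M_mono mean_PP mean_mono that)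
  have G_strict: "\<exists>r. 0 < r \<and> r < 1 \<and> G (\<alpha> *\<^sub>R X) \<sqsubseteq> (\<alpha> * r) *\<^sub>R G X"
    if X: "X \<in> PP" and \<alpha>: "1 < \<alpha>" for X \<alpha>
  proof -
    have aX: "\<alpha> *\<^sub>R X \<in> PP" using X \<alpha> by (intro PP_scaleR) auto
    have "\<forall>j. \<exists>r. 0 < r \<and> r < 1 \<and>
        op_mean (f j) (\<alpha> *\<^sub>R X) (A j) \<sqsubseteq> (\<alpha> * r) *\<^sub>R op_mean (f j) X (A j)"
      by (intro allI op_mean_scale_strict rep nontriv X A \<alpha>)
    then obtain r where r: "\<And>j. 0 < r j" "\<And>j. r j < 1"
      "\<And>j. op_mean (f j) (\<alpha> *\<^sub>R X) (A j) \<sqsubseteq> (\<alpha> * r j) *\<^sub>R op_mean (f j) X (A j)"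
      by metis
    \<comment> \<open>Finiteness of the index type gives a common factor below 1.\<close>
    define s where "s = Max (range r)"
    have s: "r j \<le> s" for j by (simp add: s_def)
    have s01: "0 < s" "s < 1"
      using r(1) s less_le_trans by (blast, simp add: s_def r(2))
    have "op_mean (f j) (\<alpha> *\<^sub>R X) (A j) \<sqsubseteq> (\<alpha> * s) *\<^sub>R op_mean (f j) X (A j)" for j
      using s[of j] \<alpha>
      by (intro loewner_le_trans[OF r(3) loewner_le_scaleR_left_mono[OF PP_positive[OF mean_PP[OF X]]]])
         simp
    then have "G (\<alpha> *\<^sub>R X) \<sqsubseteq> M (\<lambda>j. (\<alpha> * s) *\<^sub>R op_mean (f j) X (A j))"
      unfolding G_def using s01 \<alpha> by (intro M_mono mean_PP aX PP_scaleR X) auto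
    also have "\<dots> = (\<alpha> * s) *\<^sub>R G X"
      unfolding G_def using s01 \<alpha> by (intro M_hom mean_PP X) auto
    finally show ?thesis using s01 by blast
  qed
  have G_cont: "sot_tendsto (\<lambda>k. G (X k)) (G L)"
    if X: "\<And>k. X k \<in> PP" and L: "L \<in> PP" and dec: "decreases_to X L"
      and b: "\<And>k. norm (X k) \<le> b" and d: "0 < d" "\<And>k x. d * (norm x)\<^sup>2 \<le> inner (X k x) x"
    for X L d b
  proof -
    have "sot_tendsto (\<lambda>k. op_mean (f j) (X k) (A j)) (op_mean (f j) L (A j))" for j
      by (rule sot_tendsto_op_mean[OF representing_continuous[OF rep nontriv] X L A _ b d])
         (use dec in \<open>simp add: decreases_to_def\<close>)
    \<comment> \<open>The means decrease along with X_k, so the decreasing case of the continuity of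
      M applies.\<close>
    then have "decreases_to (\<lambda>k. op_mean (f j) (X k) (A j)) (op_mean (f j) L (A j))" for j
      using dec by (auto simp: decreases_to_def intro: mean_mono X)
    then show ?thesis
      unfolding G_def using mean_PP[OF X] mean_PP[OF L]
        assms(5)[unfolded monotone_continuous_def, rule_format,
          of "\<lambda>j k. op_mean (f j) (X k) (A j)" "\<lambda>j. op_mean (f j) L (A j)"]
      by blast
  qed
  \<comment> \<open>Above every \<open>norm (A j)\<close>, so that \<beta>I is a supersolution; the
    summand 1 keeps \<beta> positive on the zero space too.\<close>
  define \<beta> where "\<beta> = (\<Sum>j\<in>UNIV. norm (A j)) + 1"
  have \<beta>: "norm (A j) \<le> \<beta>" "0 < \<beta>" for j
    unfolding \<beta>_def using member_le_sum[of j UNIV "\<lambda>j. norm (A j)"]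
    by (auto intro!: add_nonneg_pos sum_nonneg)
  have "\<exists>d. 0 < d \<and> (\<forall>x. d * (norm x)\<^sup>2 \<le> inner (A j x) x)" for j
    by (rule PP_lower_bound[OF A[of j]]) blast
  then have "\<exists>\<delta>. \<forall>j. 0 < \<delta> j \<and> (\<forall>x. \<delta> j * (norm x)\<^sup>2 \<le> inner (A j x) x)"
    by (intro choice allI)
  then obtain \<delta> where \<delta>: "\<And>j. 0 < \<delta> j" "\<And>j x. \<delta> j * (norm x)\<^sup>2 \<le> inner (A j x) x"
    by blast
  \<comment> \<open>Below every \<open>\<delta> j\<close>, so that \<gamma>I is a subsolution; the
    minimum with \<beta> places it under the starting point.\<close>
  define \<gamma> where "\<gamma> = min \<beta> (Min (range \<delta>))"
  have \<gamma>: "0 < \<gamma>" "\<gamma> \<le> \<beta>" "\<gamma> \<le> \<delta> j" for j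
    by (auto simp: \<gamma>_def \<beta> \<delta> intro: min.coboundedI2)
  have lbA: "\<gamma> * (norm x)\<^sup>2 \<le> inner (A j x) x" for j x
    by (rule order_trans[OF mult_right_mono[OF \<gamma>(3)] \<delta>(2)]) simp
  have I_PP: "c *\<^sub>R (id_blinfun :: 'h \<Rightarrow>\<^sub>L 'h) \<in> PP" if "0 < c" for c
    by (rule PP_scaleR[OF PP_id that])
  have "G (\<beta> *\<^sub>R id_blinfun) \<sqsubseteq> M (\<lambda>_. \<beta> *\<^sub>R id_blinfun)"
    unfolding G_def
    by (intro M_mono mean_PP I_PP \<beta> op_mean_scaleR_id_le[OF rep nontriv A])
  then have super: "G (\<beta> *\<^sub>R id_blinfun) \<sqsubseteq> \<beta> *\<^sub>R id_blinfun"
    by (simp add: M_id \<beta>)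
  have "M (\<lambda>_. \<gamma> *\<^sub>R id_blinfun) \<sqsubseteq> G (\<gamma> *\<^sub>R id_blinfun)"
    unfolding G_def
    by (intro M_mono mean_PP I_PP \<gamma> op_mean_scaleR_id_ge[OF rep nontriv A] lbA)
  then have sub: "\<gamma> *\<^sub>R id_blinfun \<sqsubseteq> G (\<gamma> *\<^sub>R id_blinfun)"
    by (simp add: M_id \<gamma>)
  have "\<exists>X. X \<in> PP \<and> X = G X"
  proof (rule decreasing_iteration_fixed_point[of G])
    show "\<gamma> *\<^sub>R id_blinfun \<sqsubseteq> \<beta> *\<^sub>R (id_blinfun :: 'h \<Rightarrow>\<^sub>L 'h)"
      by (rule loewner_le_scaleR_left_mono[OF PP_positive[OF PP_id] \<gamma>(2)])
  qed (fact G_PP G_mono G_cont super sub I_PP[OF \<beta>(2)] I_PP[OF \<gamma>(1)])+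
  then obtain X where X: "X \<in> PP" "X = G X" by blast
  have refl: "B \<sqsubseteq> B" if "B \<in> PP" for B :: "'h \<Rightarrow>\<^sub>L 'h"
    using that by (simp add: loewner_le_iff PP_selfadj)
  \<comment> \<open>A fixed point is both a subsolution and a supersolution, so uniqueness and both
    comparison claims are instances of this.\<close>
  have comparison: "Z \<sqsubseteq> Y" if "Z \<in> PP" "Z \<sqsubseteq> G Z" "Y \<in> PP" "G Y \<sqsubseteq> Y" for Y Z
    using subsolution_le_supersolution[OF G_mono G_strict that] .
  have uniq: "Z = X" if "Z \<in> PP" "Z = G Z" for Z
    using that X comparison refl by (metis loewner_le_antisym)
  have "(\<exists>!X\<^sub>0. X\<^sub>0 \<in> PP \<and> X\<^sub>0 = G X\<^sub>0) \<and>
    (\<forall>X\<^sub>0. X\<^sub>0 \<in> PP \<and> X\<^sub>0 = G X\<^sub>0 \<longrightarrow>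
      (\<forall>Y\<in>PP. G Y \<sqsubseteq> Y \<longrightarrow> X\<^sub>0 \<sqsubseteq> Y) \<and> (\<forall>Y\<in>PP. Y \<sqsubseteq> G Y \<longrightarrow> Y \<sqsubseteq> X\<^sub>0))"
    using X uniq comparison refl by metis
  then show ?thesis unfolding G_def .
qed

end
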